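(* Let $E,F$ be complex Banach spaces, $U\subseteq E$ open, $v$ a weight on $U$, $p\in[1,\infty)$, and $f\in\mathcal H_v^\infty(U,F)$. The following are equivalent: (i) $f\in\mathcal H^\infty_{v\mathcal K_p}(U,F)$; (ii) there exist a quotient space $Z$ of $\ell_{p^*}$ ($c_0$ instead of $\ell_{p^*}$ if $p=1$), an operator $S\in\mathcal K_p(Z,F)$ and a mapping $g\in\mathcal H^\infty_{v\mathcal K_{up}}(U,Z)$ such that $f=S\circ g$. In this case, $\|f\|_{\mathcal H^\infty_{v\mathcal K_p}}=\inf\{\|S\|_{\mathcal K_p}\|g\|_{\mathcal H^\infty_{v\mathcal K_{up}}}\}$, where the infimum is taken over all possible $S$ and $g$ as in (ii).
   Context: A weight on $U$ is a strictly positive continuous function. $\mathcal H_v^\infty(U,F)$ is the Banach space of holomorphic $f\colon U\to F$ with $\|f\|_v:=\sup_{x\in U}v(x)\|f(x)\|<\infty$. $p^*$ is the conjugate index of $p$. Sequences in a Banach space $X$: $\ell_p(X)$ is the space of sequences with $\|(x_n)\|_p=(\sum\|x_n\|^p)^{1/p}<\infty$; $\ell_p^w(X)$ of those with $\|(x_n)\|_p^w=\sup_{x^*\in B_{X^*}}(\sum|x^*(x_n)|^p)^{1/p}<\infty$; $\ell_p^u(X)$ of those $(x_n)\in\ell_p^w(X)$ with $\|(x_n)_{n\ge m}\|_p^w\to0$ as $m\to\infty$. $p\text{-}\mathrm{conv}(x_n)=\{\sum_n a_nx_n:(a_n)\in B\}$, where $B=B_{\ell_{p^*}}$ if $1<p<\infty$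 and $B=B_{c_0}$ if $p=1$. A set $K\subseteq X$ is relatively $p$-compact (resp. relatively unconditionally $p$-compact) if $K\subseteq p\text{-}\mathrm{conv}(x_n)$ for some $(x_n)$ in $\ell_p(X)$ (resp. $\ell_p^u(X)$); $m_{\mathcal K_p}(K)$ (resp. $m_{\mathcal K_{up}}(K)$) is the infimum over all such sequences of $\|(x_n)\|_p$ (resp. $\|(x_n)\|_p^w$). $\mathcal K_p(X,Y)$ is the set of bounded linear $T\colon X\to Y$ with $T(B_X)$ relatively $p$-compact, with $\|T\|_{\mathcal K_p}=m_{\mathcal K_p}(T(B_X))$. For $\mathcal I=\mathcal K_p$ (resp. $\mathcal K_{up}$), $\mathcal H^\infty_{v\mathcal I}(U,F)$ is the set of $f\in\mathcal H_v^\infty(U,F)$ such that $(vf)(U)=\{v(x)f(x):x\in U\}$ is relatively $p$-compact (resp. relatively unconditionally $p$-compact), with $\|f\|_{\mathcal H^\infty_{v\mathcal I}}=m_{\mathcal I}((vf)(U))$. *)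

theory Defs
  imports "HOL-Analysis.Analysis" "HOL-Algebra.Module" "HOL-Algebra.AbelCoset"
begin

class complex_normed_vector = real_normed_vector +
  fixes scaleC :: "complex \<Rightarrow> 'a \<Rightarrow> 'a"
  assumes scaleC_add_right: "scaleC c (x + y) = scaleC c x + scaleC c y"
    and scaleC_add_left: "scaleC (c + d) x = scaleC c x + scaleC d x"
    and scaleC_scaleC: "scaleC c (scaleC d x) = scaleC (c * d) x"
    and scaleC_of_real: "scaleC (complex_of_real r) x = r *\<^sub>R x"
    and norm_scaleC: "norm (scaleC c x) = cmod c * norm x"

class complex_banach = complex_normed_vector + banach

instantiation complex :: complex_banach
begin

definition scaleC_complex :: "complex \<Rightarrow> complex \<Rightarrow> complex" where
  "scaleC_complex c x = c * x"

instance
  by standard (auto simp: scaleC_complex_def algebra_simps norm_mult scaleR_conv_of_real)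

end

text \<open>
  The space \<open>Z\<close> of the theorem is existentially quantified, so it cannot be a type. Spaces are
  therefore carrier-based: complex modules in the sense of HOL-Algebra with a norm. As in every
  HOL-Algebra module record, the fields \<open>mult\<close> and \<open>one\<close> are irrelevant and left undefined. Types
  of class \<open>complex_normed_vector\<close> enter through \<open>type_space\<close>.
\<close>

record 'a normed_module = "(complex, 'a) module" +
  nrm :: "'a \<Rightarrow> real"

definition complex_ring :: "complex ring" where
  "complex_ring = \<lparr>carrier = UNIV, mult = (*), one = 1, zero = 0, add = (+)\<rparr>"

definition type_space :: "'a::complex_normed_vector normed_module" where
  "type_space = \<lparr>carrier = UNIV, mult = undefined, one = undefined, zero = 0, add = (+),
     smult = scaleC, nrm = norm\<rparr>"

text \<open>The locale \<open>Metric_space\<close> demands symmetry and nonnegativity off the carrier too, hence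
  the case distinction.\<close>

definition norm_dist :: "'a normed_module \<Rightarrow> 'a \<Rightarrow> 'a \<Rightarrow> real" where
  "norm_dist X x y = (if x \<in> carrier X \<and> y \<in> carrier X then nrm X (x \<ominus>\<^bsub>X\<^esub> y) else 0)"

definition norm_topology :: "'a normed_module \<Rightarrow> 'a topology" where
  "norm_topology X = Metric_space.mtopology (carrier X) (norm_dist X)"

definition unit_ball :: "'a normed_module \<Rightarrow> 'a set" where
  "unit_ball X = {x \<in> carrier X. nrm X x \<le> 1}"

definition bounded_ops :: "'a normed_module \<Rightarrow> 'b normed_module \<Rightarrow> ('a \<Rightarrow> 'b) set" where
  "bounded_ops X Y = {T \<in> carrier X \<rightarrow> carrier Y.
     (\<forall>x\<in>carrier X. \<forall>y\<in>carrier X. T (x \<oplus>\<^bsub>X\<^esub> y) = T x \<oplus>\<^bsub>Y\<^esub> T y) \<and>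
     (\<forall>c. \<forall>x\<in>carrier X. T (c \<odot>\<^bsub>X\<^esub> x) = c \<odot>\<^bsub>Y\<^esub> T x) \<and>
     (\<exists>K. \<forall>x\<in>carrier X. nrm Y (T x) \<le> K * nrm X x)}"

text \<open>The closed unit ball of the dual space, for the operator norm.\<close>

definition dual_ball :: "'a normed_module \<Rightarrow> ('a \<Rightarrow> complex) set" where
  "dual_ball X = {\<phi> \<in> bounded_ops X type_space. \<forall>x\<in>unit_ball X. cmod (\<phi> x) \<le> 1}"


section \<open>Scalar sequence spaces and quotients\<close>

definition lq_space :: "real \<Rightarrow> (nat \<Rightarrow> complex) normed_module" where
  "lq_space q = \<lparr>carrier = {a. summable (\<lambda>n. cmod (a n) powr q)},
     mult = undefined, one = undefined, zero = (\<lambda>n. 0), add = (\<lambda>a b n. a n + b n),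
     smult = (\<lambda>c a n. c * a n), nrm = (\<lambda>a. (\<Sum>n. cmod (a n) powr q) powr (1 / q))\<rparr>"

definition c0_space :: "(nat \<Rightarrow> complex) normed_module" where
  "c0_space = \<lparr>carrier = {a. a \<longlonglongrightarrow> 0},
     mult = undefined, one = undefined, zero = (\<lambda>n. 0), add = (\<lambda>a b n. a n + b n),
     smult = (\<lambda>c a n. c * a n), nrm = (\<lambda>a. SUP n. cmod (a n))\<rparr>"

text \<open>\<open>\<ell>\<close> with the conjugate exponent of \<open>p\<close>, replaced by \<open>c\<^sub>0\<close> if \<open>p = 1\<close>.\<close>

definition coeff_space :: "real \<Rightarrow> (nat \<Rightarrow> complex) normed_module" where
  "coeff_space p = (if p = 1 then c0_space else lq_space (p / (p - 1)))"

text \<open>The quotient by \<open>M\<close>: cosets with the quotient norm. The set \<open>c \<odot> A\<close> is a coset only for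
  \<open>c \<noteq> 0\<close>; as in \<open>rcoset_mult\<close>, taking the union of the cosets of its elements covers
  \<open>c = 0\<close> as well.\<close>

definition quotient_module :: "'a normed_module \<Rightarrow> 'a set \<Rightarrow> 'a set normed_module" where
  "quotient_module X M = \<lparr>carrier = a_rcosets\<^bsub>X\<^esub> M,
     mult = undefined, one = undefined, zero = M, add = (<+>\<^bsub>X\<^esub>),
     smult = (\<lambda>c A. \<Union>a\<in>A. M +>\<^bsub>X\<^esub> (c \<odot>\<^bsub>X\<^esub> a)), nrm = (\<lambda>A. INF a\<in>A. nrm X a)\<rparr>"

definition quotient_spaces :: "'a normed_module \<Rightarrow> 'a set normed_module set" where
  "quotient_spaces X =
     {quotient_module X M | M. submodule M complex_ring X \<and> closedin (norm_topology X) M}"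


section \<open>Vector-valued sequences and p-compactness\<close>

definition strong_seqs :: "real \<Rightarrow> 'a normed_module \<Rightarrow> (nat \<Rightarrow> 'a) set" where
  "strong_seqs p X = {x \<in> UNIV \<rightarrow> carrier X. summable (\<lambda>n. nrm X (x n) powr p)}"

definition strong_norm :: "real \<Rightarrow> 'a normed_module \<Rightarrow> (nat \<Rightarrow> 'a) \<Rightarrow> real" where
  "strong_norm p X x = (\<Sum>n. nrm X (x n) powr p) powr (1 / p)"

definition weak_seqs :: "real \<Rightarrow> 'a normed_module \<Rightarrow> (nat \<Rightarrow> 'a) set" where
  "weak_seqs p X = {x \<in> UNIV \<rightarrow> carrier X.
     (\<forall>\<phi>\<in>dual_ball X. summable (\<lambda>n. cmod (\<phi> (x n)) powr p)) \<and>
     bdd_above ((\<lambda>\<phi>. (\<Sum>n. cmod (\<phi> (x n)) powr p) powr (1 / p)) ` dual_ball X)}"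

definition weak_norm :: "real \<Rightarrow> 'a normed_module \<Rightarrow> (nat \<Rightarrow> 'a) \<Rightarrow> real" where
  "weak_norm p X x = (SUP \<phi>\<in>dual_ball X. (\<Sum>n. cmod (\<phi> (x n)) powr p) powr (1 / p))"

definition uncond_seqs :: "real \<Rightarrow> 'a normed_module \<Rightarrow> (nat \<Rightarrow> 'a) set" where
  "uncond_seqs p X = {x \<in> weak_seqs p X. (\<lambda>m. weak_norm p X (\<lambda>n. x (n + m))) \<longlonglongrightarrow> 0}"

definition p_conv :: "real \<Rightarrow> 'a normed_module \<Rightarrow> (nat \<Rightarrow> 'a) \<Rightarrow> 'a set" where
  "p_conv p X x = {y. \<exists>a\<in>unit_ball (coeff_space p).
     limitin (norm_topology X) (\<lambda>N. \<Oplus>\<^bsub>X\<^esub>n\<in>{..<N}. a n \<odot>\<^bsub>X\<^esub> x n) y sequentially}"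

definition rel_p_compact :: "real \<Rightarrow> 'a normed_module \<Rightarrow> 'a set \<Rightarrow> bool" where
  "rel_p_compact p X K \<longleftrightarrow> K \<subseteq> carrier X \<and> (\<exists>x\<in>strong_seqs p X. K \<subseteq> p_conv p X x)"

definition p_compact_measure :: "real \<Rightarrow> 'a normed_module \<Rightarrow> 'a set \<Rightarrow> real" where
  "p_compact_measure p X K = Inf {strong_norm p X x | x. x \<in> strong_seqs p X \<and> K \<subseteq> p_conv p X x}"

definition rel_uncond_p_compact :: "real \<Rightarrow> 'a normed_module \<Rightarrow> 'a set \<Rightarrow> bool" where
  "rel_uncond_p_compact p X K \<longleftrightarrow> K \<subseteq> carrier X \<and> (\<exists>x\<in>uncond_seqs p X. K \<subseteq> p_conv p X x)"

definition uncond_p_compact_measure :: "real \<Rightarrow> 'a normed_module \<Rightarrow> 'a set \<Rightarrow> real" where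
  "uncond_p_compact_measure p X K =
     Inf {weak_norm p X x | x. x \<in> uncond_seqs p X \<and> K \<subseteq> p_conv p X x}"

definition p_compact_ops :: "real \<Rightarrow> 'a normed_module \<Rightarrow> 'b normed_module \<Rightarrow> ('a \<Rightarrow> 'b) set" where
  "p_compact_ops p X Y = {T \<in> bounded_ops X Y. rel_p_compact p Y (T ` unit_ball X)}"

definition p_compact_op_norm ::
    "real \<Rightarrow> 'a normed_module \<Rightarrow> 'b normed_module \<Rightarrow> ('a \<Rightarrow> 'b) \<Rightarrow> real" where
  "p_compact_op_norm p X Y T = p_compact_measure p Y (T ` unit_ball X)"


section \<open>Weighted holomorphic mappings\<close>

definition weight_on :: "'e::topological_space set \<Rightarrow> ('e \<Rightarrow> real) \<Rightarrow> bool" where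
  "weight_on U v \<longleftrightarrow> continuous_on U v \<and> (\<forall>x\<in>U. v x > 0)"

text \<open>Holomorphy on an open set \<open>U\<close> means complex Frechet differentiability at every point of \<open>U\<close>.
  All mappings below are only constrained by their values on \<open>U\<close>.\<close>

definition holomorphic_maps ::
    "'e::complex_normed_vector set \<Rightarrow> 'a normed_module \<Rightarrow> ('e \<Rightarrow> 'a) set" where
  "holomorphic_maps U F = {f \<in> U \<rightarrow> carrier F. \<forall>x\<in>U. \<exists>D\<in>bounded_ops type_space F.
     ((\<lambda>y. nrm F ((f y \<ominus>\<^bsub>F\<^esub> f x) \<ominus>\<^bsub>F\<^esub> D (y - x)) / norm (y - x)) \<longlongrightarrow> 0) (at x within U)}"

definition weighted_holo ::
    "'e::complex_normed_vector set \<Rightarrow> ('e \<Rightarrow> real) \<Rightarrow> 'a normed_module \<Rightarrow> ('e \<Rightarrow> 'a) set" where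
  "weighted_holo U v F = {f \<in> holomorphic_maps U F. bdd_above ((\<lambda>x. v x * nrm F (f x)) ` U)}"

definition weighted_range ::
    "'e set \<Rightarrow> ('e \<Rightarrow> real) \<Rightarrow> 'a normed_module \<Rightarrow> ('e \<Rightarrow> 'a) \<Rightarrow> 'a set" where
  "weighted_range U v F f = (\<lambda>x. complex_of_real (v x) \<odot>\<^bsub>F\<^esub> f x) ` U"

definition weighted_holo_Kp ::
    "real \<Rightarrow> 'e::complex_normed_vector set \<Rightarrow> ('e \<Rightarrow> real) \<Rightarrow> 'a normed_module \<Rightarrow> ('e \<Rightarrow> 'a) set" where
  "weighted_holo_Kp p U v F =
     {f \<in> weighted_holo U v F. rel_p_compact p F (weighted_range U v F f)}"

definition weighted_holo_Kp_norm ::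
    "real \<Rightarrow> 'e set \<Rightarrow> ('e \<Rightarrow> real) \<Rightarrow> 'a normed_module \<Rightarrow> ('e \<Rightarrow> 'a) \<Rightarrow> real" where
  "weighted_holo_Kp_norm p U v F f = p_compact_measure p F (weighted_range U v F f)"

definition weighted_holo_Kup ::
    "real \<Rightarrow> 'e::complex_normed_vector set \<Rightarrow> ('e \<Rightarrow> real) \<Rightarrow> 'a normed_module \<Rightarrow> ('e \<Rightarrow> 'a) set" where
  "weighted_holo_Kup p U v F =
     {f \<in> weighted_holo U v F. rel_uncond_p_compact p F (weighted_range U v F f)}"

definition weighted_holo_Kup_norm ::
    "real \<Rightarrow> 'e set \<Rightarrow> ('e \<Rightarrow> real) \<Rightarrow> 'a normed_module \<Rightarrow> ('e \<Rightarrow> 'a) \<Rightarrow> real" where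
  "weighted_holo_Kup_norm p U v F f = uncond_p_compact_measure p F (weighted_range U v F f)"

definition Kp_factorization ::
    "real \<Rightarrow> 'e::complex_normed_vector set \<Rightarrow> ('e \<Rightarrow> real) \<Rightarrow> 'a normed_module \<Rightarrow> ('e \<Rightarrow> 'a) \<Rightarrow>
     (nat \<Rightarrow> complex) set normed_module \<Rightarrow> ((nat \<Rightarrow> complex) set \<Rightarrow> 'a) \<Rightarrow>
     ('e \<Rightarrow> (nat \<Rightarrow> complex) set) \<Rightarrow> bool" where
  "Kp_factorization p U v F f Z S g \<longleftrightarrow>
     Z \<in> quotient_spaces (coeff_space p) \<and> S \<in> p_compact_ops p Z F \<and>
     g \<in> weighted_holo_Kup p U v Z \<and> (\<forall>x\<in>U. f x = S (g x))"

end

theory Submission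
  imports Defs "HOL-Complex_Analysis.Cauchy_Integral_Formula"
begin

text \<open>
  If \<open>v f\<close> has values in the p-convex hull of \<open>x\<close>, choose \<open>l\<^sub>n \<rightarrow> 0\<close> in \<open>(0, 1]\<close> such that \<open>y\<^sub>n = x\<^sub>n / l\<^sub>n\<close>
  is still p-summable with almost the same norm. Let \<open>T a = \<Sum> a\<^sub>n y\<^sub>n\<close>, \<open>Z\<close> the quotient of the coefficient
  space by the kernel of \<open>T\<close>, and \<open>S\<close> the induced injection. Then \<open>f\<close> lifts to \<open>g\<close> with \<open>v g\<close> in the p-convex
  hull of the cosets of \<open>l\<^sub>n e\<^sub>n\<close>, which are unconditionally p-summable with weak norm at most 1 because
  \<open>l\<^sub>n \<rightarrow> 0\<close>.

  No vector-valued integration is needed to see that \<open>g\<close> is holomorphic. Functionals bounded on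
  \<open>T\<close> of the damped unit ball are locally bounded along \<open>f\<close>, so scalar Cauchy estimates control them
  on the derivative and on the second-order Taylor remainder of \<open>f\<close>; by Hahn--Banach and the
  compactness of the damping, both then lie in \<open>S\<close> of a ball of the right size in \<open>Z\<close>.

  Conversely, Hahn--Banach in \<open>Z\<close> bounds the norm on the p-convex hull of \<open>z\<close> by the weak norm
  of \<open>z\<close>, so \<open>S\<close> maps \<open>v g\<close> into a multiple of the image of the unit ball.
\<close>

section \<open>Hahn--Banach in complex modules\<close>

text \<open>The obstacle behind the holomorphy argument is that \<open>S\<close> is injective but
  its inverse on the range may be unbounded, so smallness in norm of a remainder of \<open>f\<close>
  says nothing about \<open>Z\<close>. What does pull back is a bound by all test functionals, at
  the price of a factor 2. These functionals have no common bound on their norms, so the scalar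
  estimates may depend only on their size along \<open>f\<close>. The Cauchy estimates make the
  remainder quadratic, and division by \<open>norm (y - x)\<close> therefore still leaves something
  that tends to 0.

  The norm equality rests on how the splitting of x_n into l_n times y_n shares the cost: the size
  of \<open>x\<close> goes into \<open>y\<close>, hence into \<open>S\<close>, while
  \<open>g\<close> sees only the factors l_n and costs at most 1. Quotient norms and the infima that
  define the measures need not be attained, so estimates are proved with a strict margin, which a
  limit removes at the end.\<close>

lemma complex_ring_simps [simp]:
  "carrier complex_ring = UNIV" "\<zero>\<^bsub>complex_ring\<^esub> = 0" "\<one>\<^bsub>complex_ring\<^esub> = 1"
  "x \<oplus>\<^bsub>complex_ring\<^esub> y = x + y" "x \<otimes>\<^bsub>complex_ring\<^esub> y = x * y"
  by (simp_all add: complex_ring_def)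

lemma cring_complex_ring: "cring complex_ring"
proof (rule cringI)
  show "abelian_group complex_ring"
    by (rule abelian_groupI) (auto simp: algebra_simps intro: exI[of _ "- x" for x]  add.left_inverse)
  show "comm_monoid complex_ring"
    by (rule comm_monoidI) (auto simp: algebra_simps)
qed (auto simp: algebra_simps)

lemma complex_ring_uminus [simp]: "\<ominus>\<^bsub>complex_ring\<^esub> x = - x"
proof -
  interpret cring complex_ring by (rule cring_complex_ring)
  show ?thesis
    by (rule minus_equality) simp_all
qed

text \<open>No norm is fixed here: Hahn--Banach is applied to the norm of a quotient, whose carrier
  is not a type, and also to the seminorm \<open>penalty\<close> on the space of values of
  \<open>f\<close>.\<close>

locale cmodule = module complex_ring X for X :: "'a normed_module" (structure)
begin

lemma smult_cl [simp, intro]: "x \<in> carrier X \<Longrightarrow> c \<odot> x \<in> carrier X"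
  by simp

lemma smult_add: "x \<in> carrier X \<Longrightarrow> (c + d) \<odot> x = c \<odot> x \<oplus> d \<odot> x"
  using smult_l_distr[of c d x] by simp

lemma smult_smult: "x \<in> carrier X \<Longrightarrow> c \<odot> (d \<odot> x) = (c * d) \<odot> x"
  using smult_assoc1[of c d x] by simp

lemma smult_1 [simp]: "x \<in> carrier X \<Longrightarrow> 1 \<odot> x = x"
  using smult_one[of x] by simp

lemma smult_minus_one: "x \<in> carrier X \<Longrightarrow> (- 1) \<odot> x = \<ominus> x"
  using smult_l_minus[of 1 x] by simp

lemma smult_0 [simp]: "x \<in> carrier X \<Longrightarrow> 0 \<odot> x = \<zero>"
  using smult_l_null[of x] by simp

text \<open>Homogeneity is demanded only as an inequality for positive factors, the form that infima
  inherit directly; applying it to \<open>1/t\<close> as well gives equality in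
  \<open>sublinear_scale_eq\<close>.\<close>

definition sublinear :: "('a \<Rightarrow> real) \<Rightarrow> bool" where
  "sublinear q \<longleftrightarrow> q \<zero> = 0 \<and> (\<forall>x\<in>carrier X. \<forall>y\<in>carrier X. q (x \<oplus> y) \<le> q x + q y) \<and>
     (\<forall>t>0. \<forall>x\<in>carrier X. q (complex_of_real t \<odot> x) \<le> t * q x)"

definition seminorm :: "('a \<Rightarrow> real) \<Rightarrow> bool" where
  "seminorm N \<longleftrightarrow> (\<forall>x\<in>carrier X. \<forall>y\<in>carrier X. N (x \<oplus> y) \<le> N x + N y) \<and>
     (\<forall>c. \<forall>x\<in>carrier X. N (c \<odot> x) = cmod c * N x)"

lemma seminorm_zero: assumes "seminorm N" shows "N \<zero> = 0"
proof -
  have "N (0 \<odot> \<zero>) = 0" using assms unfolding seminorm_def by (metis M.zero_closed mult_zero_left norm_zero)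
  then show ?thesis by simp
qed

lemma seminorm_minus: assumes "seminorm N" "x \<in> carrier X" shows "N (\<ominus> x) = N x"
proof -
  have "N ((-1) \<odot> x) = N x" using assms unfolding seminorm_def by (metis mult_1 norm_minus_cancel norm_one)
  then show ?thesis using assms smult_minus_one by simp
qed

lemma seminorm_nonneg: assumes "seminorm N" "x \<in> carrier X" shows "0 \<le> N x"
proof -
  have "N (x \<oplus> \<ominus> x) \<le> N x + N (\<ominus> x)" using assms unfolding seminorm_def by auto
  then show ?thesis using seminorm_zero[OF assms(1)] seminorm_minus[OF assms] assms(2) by (simp add: M.r_neg)
qed

text \<open>Read as a lower bound for \<open>q (x \<oplus> y) - q y\<close>, this keeps the infima
  over rays and over chains bounded below.\<close>

lemma sublinear_minus: 
  assumes "sublinear q" "x \<in> carrier X" "y \<in> carrier X" 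
  shows "q y \<le> q (x \<oplus> y) + q (\<ominus> x)"
proof -
  have "q (\<ominus> x \<oplus> (x \<oplus> y)) \<le> q (\<ominus> x) + q (x \<oplus> y)"
    using assms unfolding sublinear_def by auto
  moreover have "\<ominus> x \<oplus> (x \<oplus> y) = y" using assms by (simp add: M.r_neg1)
  ultimately show ?thesis by simp
qed

lemma sublinear_scale_eq: 
  assumes "sublinear q" "x \<in> carrier X" "0 \<le> t" 
  shows "q (complex_of_real t \<odot> x) = t * q x"
proof (cases "t = 0")
  case True then show ?thesis using assms by (simp add: sublinear_def)
next
  case False
  then have t: "t > 0" using assms by simp
  have 1: "q (complex_of_real t \<odot> x) \<le> t * q x" using assms t unfolding sublinear_def by auto
  have "q (complex_of_real (1/t) \<odot> (complex_of_real t \<odot> x)) \<le> (1/t) * q (complex_of_real t \<odot> x)"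
    using assms t unfolding sublinear_def by (meson divide_pos_pos smult_cl zero_less_one)
  moreover have "complex_of_real (1/t) \<odot> (complex_of_real t \<odot> x) = x"
    using assms t by (simp add: smult_smult)
  ultimately have "q x \<le> (1/t) * q (complex_of_real t \<odot> x)" by simp
  then have "t * q x \<le> q (complex_of_real t \<odot> x)" using t by (simp add: field_simps)
  with 1 show ?thesis by simp
qed

text \<open>A minimal sublinear functional is fixed by every \<open>directional_min\<close>, hence additive.\<close>

definition directional_min :: "('a \<Rightarrow> real) \<Rightarrow> 'a \<Rightarrow> 'a \<Rightarrow> real" where
  "directional_min q y x = (INF t\<in>{0..}. q (x \<oplus> complex_of_real t \<odot> y) - t * q y)"

lemma directional_min_bdd:
  assumes "sublinear q" "x \<in> carrier X" "y \<in> carrier X"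
  shows "bdd_below ((\<lambda>t. q (x \<oplus> complex_of_real t \<odot> y) - t * q y) ` {0..})"
proof (rule bdd_belowI2)
  fix t :: real assume "t \<in> {0..}"
  then show "- q (\<ominus> x) \<le> q (x \<oplus> complex_of_real t \<odot> y) - t * q y"
    using sublinear_minus[of q x "complex_of_real t \<odot> y"] sublinear_scale_eq[of q y t] assms by auto
qed

lemma directional_min_le:
  assumes "sublinear q" "x \<in> carrier X" "y \<in> carrier X" "0 \<le> t"
  shows "directional_min q y x \<le> q (x \<oplus> complex_of_real t \<odot> y) - t * q y"
  unfolding directional_min_def
  by (rule cINF_lower[OF directional_min_bdd]) (use assms in auto)

lemma sublinear_directional_min:
  assumes "sublinear q" "y \<in> carrier X"
  shows "sublinear (directional_min q y)"
  unfolding sublinear_def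
proof (intro conjI ballI allI impI)
  show "directional_min q y \<zero> = 0"
    using assms by (simp add: directional_min_def sublinear_scale_eq)
next
  fix u w assume uw: "u \<in> carrier X" "w \<in> carrier X"
  \<comment> \<open>The parameter \<open>t + s\<close> serves the sum when \<open>t\<close> serves
    \<open>u\<close> and \<open>s\<close> serves \<open>w\<close>; the two infima are then taken one
    after the other.\<close>
  have *: "directional_min q y (u \<oplus> w) \<le> 
     (q (u \<oplus> complex_of_real t \<odot> y) - t * q y) + (q (w \<oplus> complex_of_real s \<odot> y) - s * q y)" 
    if "0 \<le> t" "0 \<le> s" for s t
  proof -
    have "directional_min q y (u \<oplus> w) \<le> q ((u \<oplus> w) \<oplus> complex_of_real (t + s) \<odot> y) - (t + s) * q y"
      by (rule directional_min_le) (use assms uw that in auto)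
    also have "(u \<oplus> w) \<oplus> complex_of_real (t + s) \<odot> y = 
        (u \<oplus> complex_of_real t \<odot> y) \<oplus> (w \<oplus> complex_of_real s \<odot> y)"
      using assms uw by (simp add: smult_add M.a_ac)
    also have "q \<dots> \<le> q (u \<oplus> complex_of_real t \<odot> y) + q (w \<oplus> complex_of_real s \<odot> y)"
      using assms uw unfolding sublinear_def by auto
    finally show ?thesis by (simp add: algebra_simps)
  qed
  have "directional_min q y (u \<oplus> w) - directional_min q y w 
      \<le> q (u \<oplus> complex_of_real t \<odot> y) - t * q y" if "0 \<le> t" for t
  proof -
    have "directional_min q y (u \<oplus> w) - (q (u \<oplus> complex_of_real t \<odot> y) - t * q y) \<le> directional_min q y w"
      unfolding directional_min_def[of q y w]
      by (rule cINF_greatest) (use *[OF that] in \<open>auto simp: algebra_simps\<close>)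
    then show ?thesis by simp
  qed
  then have "directional_min q y (u \<oplus> w) - directional_min q y w \<le> directional_min q y u"
    unfolding directional_min_def[of q y u] by (intro cINF_greatest) auto
  then show "directional_min q y (u \<oplus> w) \<le> directional_min q y u + directional_min q y w" by simp
next
  fix s :: real and u assume s: "0 < s" and u: "u \<in> carrier X"
  have "directional_min q y (complex_of_real s \<odot> u) / s \<le> q (u \<oplus> complex_of_real t \<odot> y) - t * q y" 
    if "0 \<le> t" for t
  proof -
    have "directional_min q y (complex_of_real s \<odot> u) \<le>
       q (complex_of_real s \<odot> u \<oplus> complex_of_real (s * t) \<odot> y) - (s * t) * q y"
      by (rule directional_min_le) (use assms u s that in auto)
    also have "complex_of_real s \<odot> u \<oplus> complex_of_real (s * t) \<odot> y = 
       complex_of_real s \<odot> (u \<oplus> complex_of_real t \<odot> y)"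
      using assms u by (simp add: smult_r_distr smult_smult)
    also have "q \<dots> = s * q (u \<oplus> complex_of_real t \<odot> y)"
      using assms u s by (intro sublinear_scale_eq) auto
    finally show ?thesis using s by (simp add: field_simps)
  qed
  then have "directional_min q y (complex_of_real s \<odot> u) / s \<le> directional_min q y u"
    unfolding directional_min_def[of q y u] by (intro cINF_greatest) auto
  then show "directional_min q y (complex_of_real s \<odot> u) \<le> s * directional_min q y u"
    using s by (simp add: field_simps)
qed

lemma minimal_sublinear:
  assumes p: "sublinear p"
  obtains q where "sublinear q" "\<forall>x\<in>carrier X. q x \<le> p x"
    "\<forall>r. sublinear r \<longrightarrow> (\<forall>x\<in>carrier X. r x \<le> q x) \<longrightarrow> (\<forall>x\<in>carrier X. r x = q x)"
proof -
  \<comment> \<open>Fixing the value 0 off the carrier lets the pointwise order of functions express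
    comparison on the carrier, so that minimality is equality of functions.\<close>
  define A where "A = {q. sublinear q \<and> (\<forall>x\<in>carrier X. q x \<le> p x) \<and> (\<forall>x. x \<notin> carrier X \<longrightarrow> q x = 0)}"
  \<comment> \<open>The order is reversed: upper bounds in Zorn's lemma become lower bounds of
    chains.\<close>
  have po: "partial_order_on A (relation_of (\<ge>) A)"
    by (rule partial_order_on_relation_ofI) auto
  have "\<exists>q\<in>A. \<forall>r\<in>A. r \<le> q \<longrightarrow> r = q"
  proof (rule predicate_Zorn[OF po])
    fix C assume C: "C \<in> Chains (relation_of (\<ge>) A)"
    have CA: "C \<subseteq> A" using C unfolding Chains_def relation_of_def by auto
    have ch: "q \<le> r \<or> r \<le> q" if "q \<in> C" "r \<in> C" for q r
      using C that unfolding Chains_def relation_of_def by auto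
    show "\<exists>u\<in>A. \<forall>a\<in>C. a \<ge> u"
    proof (cases "C = {}")
      case True
      have "(\<lambda>x. if x \<in> carrier X then p x else 0) \<in> A"
        using p unfolding A_def sublinear_def by auto
      then show ?thesis using True by blast
    next
      case False
      define u where "u x = (INF q\<in>C. q x)" for x
      have bdd: "bdd_below ((\<lambda>q. q x) ` C)" for x
      proof (cases "x \<in> carrier X")
        case True
        show ?thesis
        proof (rule bdd_belowI2)
          fix q assume "q \<in> C"
          then have q: "sublinear q" "\<And>x. x \<in> carrier X \<Longrightarrow> q x \<le> p x" using CA unfolding A_def by auto
          have "q \<zero> \<le> q (x \<oplus> \<zero>) + q (\<ominus> x)" by (rule sublinear_minus) (use q True in auto)
          then have "0 \<le> q x + q (\<ominus> x)" using q True by (simp add: sublinear_def)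
          moreover have "q (\<ominus> x) \<le> p (\<ominus> x)" using q True by auto
          ultimately show "- p (\<ominus> x) \<le> q x" by simp
        qed
      next
        case False then show ?thesis using CA by (intro bdd_belowI2[of _ 0]) (auto simp: A_def)
      qed
      have ul: "u x \<le> q x" if "q \<in> C" for q x
        unfolding u_def by (rule cINF_lower[OF bdd that])
      have "u \<zero> = 0"
        unfolding u_def using False CA by (subst INF_cong[of C C _ "\<lambda>_. 0"]) (auto simp: A_def sublinear_def)
      moreover have "u (x \<oplus> y) \<le> u x + u y" if xy: "x \<in> carrier X" "y \<in> carrier X" for x y
      proof -
        have *: "u (x \<oplus> y) \<le> q x + r y" if qr: "q \<in> C" "r \<in> C" for q r
        proof -
          \<comment> \<open>Subadditivity of the pointwise infimum needs one member below both
            \<open>q\<close> and \<open>r\<close>; this is where the chain property enters.\<close>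
          obtain s where s: "s \<in> C" "s \<le> q" "s \<le> r" using ch[OF qr] qr by auto
          have "u (x \<oplus> y) \<le> s (x \<oplus> y)" using ul s by auto
          also have "\<dots> \<le> s x + s y" using s CA xy unfolding A_def sublinear_def by auto
          also have "\<dots> \<le> q x + r y" using s by (simp add: add_mono le_funD)
          finally show ?thesis .
        qed
        have "u (x \<oplus> y) - u y \<le> q x" if "q \<in> C" for q
        proof -
          have "u (x \<oplus> y) - q x \<le> u y"
            unfolding u_def[of y] by (rule cINF_greatest) (use False *[OF that] in \<open>auto simp: algebra_simps\<close>)
          then show ?thesis by simp
        qed
        then have "u (x \<oplus> y) - u y \<le> u x"
          unfolding u_def[of x] by (intro cINF_greatest) (use False in auto)
        then show ?thesis by simp
      qed
      moreover have "u (complex_of_real t \<odot> x) \<le> t * u x" if t: "t > 0" and x: "x \<in> carrier X" for t x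
      proof -
        have "u (complex_of_real t \<odot> x) / t \<le> q x" if "q \<in> C" for q
        proof -
          have "u (complex_of_real t \<odot> x) \<le> q (complex_of_real t \<odot> x)" using ul that by auto
          also have "\<dots> \<le> t * q x" using that CA t x unfolding A_def sublinear_def by auto
          finally show ?thesis using t by (simp add: field_simps)
        qed
        then have "u (complex_of_real t \<odot> x) / t \<le> u x"
          unfolding u_def[of x] by (intro cINF_greatest) (use False in auto)
        then show ?thesis using t by (simp add: field_simps)
      qed
      ultimately have "sublinear u" unfolding sublinear_def by auto
      moreover obtain q0 where q0: "q0 \<in> C" using False by auto
      moreover have "u x \<le> p x" if "x \<in> carrier X" for x
        using ul[OF q0, of x] q0 CA that unfolding A_def by force
      moreover have "u x = 0" if "x \<notin> carrier X" for x
        unfolding u_def using False CA that by (subst INF_cong[of C C _ "\<lambda>_. 0"]) (auto simp: A_def)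
      ultimately have "u \<in> A" unfolding A_def by auto
      then show ?thesis using ul by (auto simp: le_fun_def)
    qed
  qed
  then obtain q where q: "q \<in> A" "\<And>r. r \<in> A \<Longrightarrow> r \<le> q \<Longrightarrow> r = q" by blast
  show ?thesis
  proof (rule that[of q])
    show "\<forall>r. sublinear r \<longrightarrow> (\<forall>x\<in>carrier X. r x \<le> q x) \<longrightarrow> (\<forall>x\<in>carrier X. r x = q x)"
    proof (intro allI impI ballI)
      fix r x assume r: "sublinear r" "\<forall>x\<in>carrier X. r x \<le> q x" and x: "x \<in> carrier X"
      define r' where "r' x = (if x \<in> carrier X then r x else 0)" for x
      have "r x \<le> p x" if "x \<in> carrier X" for x
        using r(2) q(1) that unfolding A_def by force
      then have "r' \<in> A" using r(1) unfolding A_def r'_def sublinear_def by auto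
      moreover have "r' \<le> q" using r q(1) unfolding r'_def A_def by (auto simp: le_fun_def)
      ultimately have "r' = q" using q by blast
      then show "r x = q x" using x unfolding r'_def by auto
    qed
  qed (use q(1) in \<open>auto simp: A_def\<close>)
qed

text \<open>Zorn's lemma is started from \<open>directional_min p z\<close> instead of
  \<open>p\<close>. That functional lies below \<open>p\<close> and is at most \<open>- p z\<close>
  at \<open>\<ominus> z\<close>, which forces a linear minorant to agree with \<open>p\<close> at
  \<open>z\<close>.\<close>

lemma real_hahn_banach:
  assumes p: "sublinear p" and z: "z \<in> carrier X"
  obtains q where "\<And>x y. x \<in> carrier X \<Longrightarrow> y \<in> carrier X \<Longrightarrow> q (x \<oplus> y) = q x + q y"
    "\<And>t x. x \<in> carrier X \<Longrightarrow> q (complex_of_real t \<odot> x) = t * q x"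
    "\<And>x. x \<in> carrier X \<Longrightarrow> q x \<le> p x" "q z = p z"
proof -
  obtain q where q: "sublinear q" "\<forall>x\<in>carrier X. q x \<le> directional_min p z x"
    and min: "\<forall>r. sublinear r \<longrightarrow> (\<forall>x\<in>carrier X. r x \<le> q x) \<longrightarrow> (\<forall>x\<in>carrier X. r x = q x)"
    using minimal_sublinear[OF sublinear_directional_min[OF p z]] by blast
  have add: "q (x \<oplus> y) = q x + q y" if xy: "x \<in> carrier X" "y \<in> carrier X" for x y
  proof -
    \<comment> \<open>The parameter 0 puts \<open>directional_min q y\<close> below
      \<open>q\<close>, so minimality makes them equal; the parameter 1 then yields
      superadditivity.\<close>
    have "directional_min q y x' \<le> q x'" if "x' \<in> carrier X" for x'
      using directional_min_le[OF q(1) that xy(2), of 0] that xy by simp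
    then have "directional_min q y x = q x" 
      using min sublinear_directional_min[OF q(1) xy(2)] xy(1) by blast
    then have "q x + q y \<le> q (x \<oplus> y)" 
      using directional_min_le[OF q(1) xy(1) xy(2), of 1] xy by simp
    then show ?thesis using q(1) xy unfolding sublinear_def by force
  qed
  have neg: "q (\<ominus> x) = - q x" if "x \<in> carrier X" for x
    using add[of x "\<ominus> x"] q(1) that by (simp add: M.r_neg sublinear_def)
  have scale: "q (complex_of_real t \<odot> x) = t * q x" if x: "x \<in> carrier X" for t x
  proof (cases "t \<ge> 0")
    case True then show ?thesis using sublinear_scale_eq q x by auto
  next
    case False
    have "q (complex_of_real t \<odot> x) = q (complex_of_real (-t) \<odot> (\<ominus> x))"
      using x by (simp add: smult_smult flip: smult_minus_one)
    also have "\<dots> = (-t) * q (\<ominus> x)"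
      by (rule sublinear_scale_eq) (use q x False in auto)
    finally show ?thesis using neg x by simp
  qed
  have le: "q x \<le> p x" if "x \<in> carrier X" for x
    using q(2) directional_min_le[OF p that z, of 0] z that by force
  have "q (\<ominus> z) \<le> directional_min p z (\<ominus> z)" using q z by auto
  also have "\<dots> \<le> p (\<ominus> z \<oplus> complex_of_real 1 \<odot> z) - 1 * p z"
    by (rule directional_min_le) (use p z in auto)
  also have "\<dots> = - p z" using z p by (simp add: M.l_neg sublinear_def)
  finally have "p z \<le> q z" using neg z by simp
  with le[OF z] show ?thesis using that[of q] add scale le by force
qed

text \<open>A complex functional is determined by its real part: \<open>q\<close> is completed to
  q(x) - i q(ix), and a rotation extends the bound from the real part to the modulus.\<close>

lemma hahn_banach:
  assumes N: "seminorm N" and z: "z \<in> carrier X"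
  obtains \<phi> where "\<forall>x\<in>carrier X. \<forall>y\<in>carrier X. \<phi> (x \<oplus> y) = \<phi> x + \<phi> y"
    "\<forall>c. \<forall>x\<in>carrier X. \<phi> (c \<odot> x) = c * \<phi> x"
    "\<forall>x\<in>carrier X. cmod (\<phi> x) \<le> N x" "\<phi> z = complex_of_real (N z)"
proof -
  have "sublinear N" using N seminorm_zero[OF N] unfolding sublinear_def seminorm_def by auto
  from real_hahn_banach[OF this z] obtain q where 
     q: "\<And>x y. x \<in> carrier X \<Longrightarrow> y \<in> carrier X \<Longrightarrow> q (x \<oplus> y) = q x + q y"
    "\<And>t x. x \<in> carrier X \<Longrightarrow> q (complex_of_real t \<odot> x) = t * q x"
    "\<And>x. x \<in> carrier X \<Longrightarrow> q x \<le> N x" "q z = N z" by blast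
  define \<phi> where "\<phi> x = Complex (q x) (- q (\<i> \<odot> x))" for x
  have add: "\<phi> (x \<oplus> y) = \<phi> x + \<phi> y" if "x \<in> carrier X" "y \<in> carrier X" for x y
    using that by (simp add: \<phi>_def q smult_r_distr complex_eq_iff)
  have scale: "\<phi> (c \<odot> x) = c * \<phi> x" if x: "x \<in> carrier X" for c x
  proof -
    have c: "c = complex_of_real (Re c) + complex_of_real (Im c) * \<i>" by (simp add: complex_eq_iff)
    have 1: "c \<odot> x = complex_of_real (Re c) \<odot> x \<oplus> complex_of_real (Im c) \<odot> (\<i> \<odot> x)"
      using x by (subst c) (simp add: smult_add smult_smult)
    have 2: "q (c \<odot> x) = Re c * q x + Im c * q (\<i> \<odot> x)"
      unfolding 1 using x by (simp add: q)
    have 3: "\<i> \<odot> (c \<odot> x) = complex_of_real (Re c) \<odot> (\<i> \<odot> x) \<oplus> complex_of_real (- Im c) \<odot> x"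
    proof -
      have "\<i> * c = complex_of_real (Re c) * \<i> + complex_of_real (- Im c)" by (simp add: complex_eq_iff)
      then show ?thesis using x by (simp only: smult_smult smult_add[symmetric] smult_cl)
    qed
    have 4: "q (\<i> \<odot> (c \<odot> x)) = Re c * q (\<i> \<odot> x) - Im c * q x"
      unfolding 3 using x q(2)[of x "- Im c"] by (simp add: q)
    show ?thesis by (simp add: \<phi>_def 2 4 complex_eq_iff)
  qed
  have bound: "cmod (\<phi> x) \<le> N x" if x: "x \<in> carrier X" for x
  proof (cases "\<phi> x = 0")
    case True then show ?thesis using seminorm_nonneg[OF N x] by simp
  next
    case False
    \<comment> \<open>The unimodular factor that rotates \<open>\<phi> x\<close> onto the positive
      real axis.\<close>
    define c where "c = cnj (\<phi> x) / cmod (\<phi> x)"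
    have c1: "cmod c = 1" using False by (simp add: c_def norm_divide)
    have "c * \<phi> x = cmod (\<phi> x)" using False 
      by (simp add: c_def field_simps complex_norm_square[symmetric] power2_eq_square mult.commute)
    then have "cmod (\<phi> x) = Re (\<phi> (c \<odot> x))" using scale x by simp
    also have "\<dots> = q (c \<odot> x)" by (simp add: \<phi>_def)
    also have "\<dots> \<le> N (c \<odot> x)" using q x by auto
    also have "\<dots> = N x" using N x c1 unfolding seminorm_def by auto
    finally show ?thesis .
  qed
  have "Re (\<phi> z) = N z" by (simp add: \<phi>_def q)
  moreover have "\<phi> z = complex_of_real (N z)"
  proof -
    \<comment> \<open>The real part already has the value \<open>N z\<close> that bounds the
      modulus, so the imaginary part must vanish.\<close>
    have "cmod (\<phi> z) \<le> Re (\<phi> z)" using bound[OF z] calculation by simp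
    then have "(cmod (\<phi> z))\<^sup>2 \<le> (Re (\<phi> z))\<^sup>2" by (simp add: power_mono)
    then have "Im (\<phi> z) = 0" by (simp add: cmod_power2)
    then show ?thesis using calculation by (simp add: complex_eq_iff)
  qed
  ultimately show ?thesis using that[of \<phi>] add scale bound by blast
qed

end

section \<open>The coefficient spaces\<close>

locale normed_cmodule = cmodule +
  assumes seminorm_nrm: "seminorm (nrm X)"
    and nrm_zero_imp: "x \<in> carrier X \<Longrightarrow> nrm X x = 0 \<Longrightarrow> x = \<zero>"

text \<open>Both sequences are normalised to norm 1 and Young's inequality is summed; its constants
  \<open>1/q\<close> and \<open>1/p\<close> add up to 1.\<close>

lemma Holder_sum:
  fixes a t :: "'i \<Rightarrow> real"
  assumes p: "1 < p" and a: "\<And>i. i \<in> I \<Longrightarrow> 0 \<le> a i" and t: "\<And>i. i \<in> I \<Longrightarrow> 0 \<le> t i"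
    and fin: "finite I" and q: "q = p / (p - 1)"
  shows "(\<Sum>i\<in>I. a i * t i) \<le> (\<Sum>i\<in>I. a i powr q) powr (1/q) * (\<Sum>i\<in>I. t i powr p) powr (1/p)"
proof -
  define A where "A = (\<Sum>i\<in>I. a i powr q)"
  define B where "B = (\<Sum>i\<in>I. t i powr p)"
  have q1: "q > 1" and pq: "1/q + 1/p = 1" using p by (auto simp: q field_simps)
  have nn: "A \<ge> 0" "B \<ge> 0" by (auto simp: A_def B_def sum_nonneg)
  show ?thesis
  proof (cases "A = 0 \<or> B = 0")
    case True
    then have "\<forall>i\<in>I. a i * t i = 0"
      using fin by (auto simp: A_def B_def sum_nonneg_eq_0_iff)
    then have "(\<Sum>i\<in>I. a i * t i) = 0" by (intro sum.neutral) blast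
    then show ?thesis by simp
  next
    case False
    then have pos: "A > 0" "B > 0" using nn by auto
    define \<alpha> where "\<alpha> = A powr (1/q)"
    define \<beta> where "\<beta> = B powr (1/p)"
    have ab: "\<alpha> > 0" "\<beta> > 0" "\<alpha> powr q = A" "\<beta> powr p = B"
      using pos q1 p by (auto simp: \<alpha>_def \<beta>_def powr_powr)
    have "(\<Sum>i\<in>I. (a i / \<alpha>) * (t i / \<beta>)) \<le> (\<Sum>i\<in>I. (a i / \<alpha>) powr q / q + (t i / \<beta>) powr p / p)"
      by (rule sum_mono, rule Youngs_inequality) (use a t ab p q1 pq in auto)
    also have "\<dots> = (\<Sum>i\<in>I. a i powr q / A / q) + (\<Sum>i\<in>I. t i powr p / B / p)"
      using a t ab by (simp add: sum.distrib powr_divide)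
    also have "\<dots> = 1/q + 1/p"
      using pos by (simp add: A_def B_def flip: sum_divide_distrib)
    finally have "(\<Sum>i\<in>I. (a i * t i) / (\<alpha> * \<beta>)) \<le> 1" using pq by simp
    then have "(\<Sum>i\<in>I. a i * t i) / (\<alpha> * \<beta>) \<le> 1" by (simp add: sum_divide_distrib)
    then show ?thesis using ab by (simp add: divide_le_eq \<alpha>_def \<beta>_def A_def B_def)
  qed
qed

lemma coeff_space_simps [simp]:
  "\<zero>\<^bsub>coeff_space p\<^esub> = (\<lambda>n. 0)" "a \<oplus>\<^bsub>coeff_space p\<^esub> b = (\<lambda>n. a n + b n)"
  "c \<odot>\<^bsub>coeff_space p\<^esub> a = (\<lambda>n. c * a n)"
  by (simp_all add: coeff_space_def c0_space_def lq_space_def)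

lemma coeff_space_one: 
  "carrier (coeff_space 1) = {a. a \<longlonglongrightarrow> 0}" "nrm (coeff_space 1) a = (SUP n. cmod (a n))"
  by (simp_all add: coeff_space_def c0_space_def)

lemma coeff_space_gt_one: 
  assumes "p \<noteq> 1" 
  shows "carrier (coeff_space p) = {a. summable (\<lambda>n. cmod (a n) powr (p/(p-1)))}"
    "nrm (coeff_space p) a = (\<Sum>n. cmod (a n) powr (p/(p-1))) powr (1 / (p/(p-1)))"
  using assms by (simp_all add: coeff_space_def lq_space_def)

lemma c0_bdd_above: "(a :: nat \<Rightarrow> complex) \<longlonglongrightarrow> 0 \<Longrightarrow> bdd_above (range (\<lambda>n. cmod (a n)))"
  using convergent_imp_bounded[of a 0] by (auto simp: bounded_iff bdd_above_def)

text \<open>One estimate covers both pairings, the sup norm with the 1-norm and that of conjugate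
  exponents. Finite index sets avoid convergence questions, and their freedom of choice serves
  single coordinates as well as blocks of a tail.\<close>

lemma coeff_holder:
  assumes p: "1 \<le> p" and a: "a \<in> carrier (coeff_space p)" and t: "\<And>i. i \<in> I \<Longrightarrow> 0 \<le> t i"
    and fin: "finite I" 
  shows "(\<Sum>i\<in>I. cmod (a i) * t i) \<le> nrm (coeff_space p) a * (\<Sum>i\<in>I. t i powr p) powr (1/p)"
proof (cases "p = 1")
  case True
  have le: "cmod (a i) \<le> nrm (coeff_space p) a" for i
    using a cSUP_upper[OF UNIV_I c0_bdd_above] by (simp add: True coeff_space_one)
  have "(\<Sum>i\<in>I. cmod (a i) * t i) \<le> (\<Sum>i\<in>I. nrm (coeff_space p) a * t i)"
    by (intro sum_mono mult_right_mono le t)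
  also have "\<dots> = nrm (coeff_space p) a * (\<Sum>i\<in>I. t i powr p) powr (1/p)"
    using t by (simp add: True sum_distrib_left sum_nonneg)
  finally show ?thesis .
next
  case False
  define q where "q = p/(p-1)"
  have p1: "p > 1" using False p by simp
  have q1: "q > 1" using p1 by (auto simp: q_def field_simps)
  have "(\<Sum>i\<in>I. cmod (a i) * t i) \<le> (\<Sum>i\<in>I. cmod (a i) powr q) powr (1/q) * (\<Sum>i\<in>I. t i powr p) powr (1/p)"
    by (rule Holder_sum) (use p1 t fin q_def in auto)
  also have "\<dots> \<le> (\<Sum>i. cmod (a i) powr q) powr (1/q) * (\<Sum>i\<in>I. t i powr p) powr (1/p)"
    using a q1 False fin p1
    by (intro mult_right_mono powr_mono2 sum_le_suminf sum_nonneg) (auto simp: coeff_space_gt_one q_def)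
  finally show ?thesis using False by (simp add: coeff_space_gt_one q_def)
qed

text \<open>Converse of \<open>coeff_holder\<close>. Together they give the norm axioms and the Fatou property
  without distinguishing \<open>c\<^sub>0\<close> from \<open>\<ell>\<close>.\<close>

lemma coeff_dual_criterion:
  assumes p: "1 \<le> p" and C: "0 \<le> C" and lim: "p = 1 \<Longrightarrow> a \<longlonglongrightarrow> 0"
    and le: "\<And>N t. (\<And>i. 0 \<le> t i) \<Longrightarrow> 
      (\<Sum>i<N. cmod (a i) * t i) \<le> C * (\<Sum>i<N. t i powr p) powr (1/p)"
  shows "a \<in> carrier (coeff_space p)" "nrm (coeff_space p) a \<le> C"
proof -
  have "a \<in> carrier (coeff_space p) \<and> nrm (coeff_space p) a \<le> C"
  proof (cases "p = 1")
    case True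
    have "cmod (a n) \<le> C" for n
      using le[of "\<lambda>i. if i = n then 1 else 0" "Suc n"] by (simp add: True sum.delta if_distrib[of "\<lambda>x. _ * x"] cong: if_cong)
    then show ?thesis using lim True by (auto simp: coeff_space_one intro: cSUP_least)
  next
    case False
    define q where "q = p/(p-1)"
    have p1: "p > 1" using False p by simp
    have q1: "q > 1" and qp: "(q - 1) * p = q" and qq: "1 - 1/p = 1/q" 
      using p1 by (auto simp: q_def field_simps)
    have bound: "(\<Sum>i<N. cmod (a i) powr q) \<le> C powr q" for N
    proof -
      define s where "s = (\<Sum>i<N. cmod (a i) powr q)"
      have s0: "s \<ge> 0" by (auto simp: s_def sum_nonneg)
      have "cmod (a i) * cmod (a i) powr (q - 1) = cmod (a i) powr q" for i
        by (simp add: powr_mult_base)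
      \<comment> \<open>The test sequence is the equality case of Hoelder's inequality: its p-norm
        is \<open>s powr (1/p)\<close> because \<open>(q - 1) * p = q\<close>.\<close>
      then have "s \<le> C * s powr (1/p)"
        using le[of "\<lambda>i. cmod (a i) powr (q-1)" N] by (simp add: powr_powr qp s_def)
      then have "s powr (1/q) \<le> C" if "s > 0"
        using that by (simp add: powr_diff field_simps flip: qq)
      then have "s \<le> C powr q"
        using s0 q1 powr_mono2[of q "s powr (1/q)" C] by (cases "s = 0") (auto simp: powr_powr)
      then show ?thesis by (simp add: s_def)
    qed
    have sm: "summable (\<lambda>n. cmod (a n) powr q)"
      by (rule summableI_nonneg_bounded) (use bound in auto)
    have "(\<Sum>n. cmod (a n) powr q) powr (1/q) \<le> (C powr q) powr (1/q)"
      using sm bound q1 by (intro powr_mono2 suminf_le_const suminf_nonneg) auto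
    also have "\<dots> = C" using C q1 by (simp add: powr_powr)
    finally show ?thesis using sm False by (simp add: coeff_space_gt_one q_def)
  qed
  then show "a \<in> carrier (coeff_space p)" "nrm (coeff_space p) a \<le> C" by auto
qed

lemma coeff_nrm_nonneg:
  assumes "1 \<le> p" "a \<in> carrier (coeff_space p)" shows "0 \<le> nrm (coeff_space p) a"
  using coeff_holder[OF assms, of "{0}" "\<lambda>_. 1"] by (simp add: order_trans[OF norm_ge_zero])

lemma coeff_le_nrm:
  assumes "1 \<le> p" "a \<in> carrier (coeff_space p)" shows "cmod (a n) \<le> nrm (coeff_space p) a"
  using coeff_holder[OF assms, of "{n}" "\<lambda>_. 1"] by simp

lemma coeff_add:
  assumes p: "1 \<le> p" and ab: "a \<in> carrier (coeff_space p)" "b \<in> carrier (coeff_space p)"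
  shows "(\<lambda>n. a n + b n) \<in> carrier (coeff_space p)"
    "nrm (coeff_space p) (\<lambda>n. a n + b n) \<le> nrm (coeff_space p) a + nrm (coeff_space p) b"
proof -
  have *: "(\<Sum>i<N. cmod (a i + b i) * t i) \<le> 
    (nrm (coeff_space p) a + nrm (coeff_space p) b) * (\<Sum>i<N. t i powr p) powr (1/p)"
    if t: "\<And>i. 0 \<le> t i" for N t
  proof -
    have "(\<Sum>i<N. cmod (a i + b i) * t i) \<le> (\<Sum>i<N. cmod (a i) * t i) + (\<Sum>i<N. cmod (b i) * t i)"
      by (auto simp flip: sum.distrib distrib_right intro!: sum_mono mult_right_mono t norm_triangle_ineq)
    also have "\<dots> \<le> nrm (coeff_space p) a * (\<Sum>i<N. t i powr p) powr (1/p) + 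
        nrm (coeff_space p) b * (\<Sum>i<N. t i powr p) powr (1/p)"
      by (intro add_mono coeff_holder p ab t) auto
    finally show ?thesis by (simp add: distrib_right)
  qed
  show "(\<lambda>n. a n + b n) \<in> carrier (coeff_space p)"
    "nrm (coeff_space p) (\<lambda>n. a n + b n) \<le> nrm (coeff_space p) a + nrm (coeff_space p) b"
    by (rule coeff_dual_criterion[OF p _ _ *];
        use ab coeff_nrm_nonneg[OF p] in \<open>auto simp: coeff_space_one intro!: tendsto_eq_intros\<close>)+
qed

text \<open>Damping, truncation, changes of phase and scalar multiples are all instances of this
  domination principle.\<close>

lemma coeff_solid:
  assumes p: "1 \<le> p" and a: "a \<in> carrier (coeff_space p)" and K: "0 \<le> K" 
    and le: "\<And>n. cmod (b n) \<le> K * cmod (a n)"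
  shows "b \<in> carrier (coeff_space p)" "nrm (coeff_space p) b \<le> K * nrm (coeff_space p) a"
proof -
  have *: "(\<Sum>i<N. cmod (b i) * t i) \<le> (K * nrm (coeff_space p) a) * (\<Sum>i<N. t i powr p) powr (1/p)"
    if t: "\<And>i. 0 \<le> t i" for N t
  proof -
    have "(\<Sum>i<N. cmod (b i) * t i) \<le> (\<Sum>i<N. (K * cmod (a i)) * t i)"
      by (intro sum_mono mult_right_mono t le)
    also have "\<dots> = K * (\<Sum>i<N. cmod (a i) * t i)"
      by (simp add: sum_distrib_left mult.assoc)
    also have "\<dots> \<le> K * (nrm (coeff_space p) a * (\<Sum>i<N. t i powr p) powr (1/p))"
      by (intro mult_left_mono coeff_holder p a t K) auto
    finally show ?thesis by simp
  qed
  have lim: "b \<longlonglongrightarrow> 0" if "p = 1"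
  proof (rule Lim_null_comparison)
    show "\<forall>\<^sub>F n in sequentially. norm (b n) \<le> K * cmod (a n)" using le by simp
    show "(\<lambda>n. K * cmod (a n)) \<longlonglongrightarrow> 0" 
      using a that by (auto simp: coeff_space_one intro!: tendsto_eq_intros)
  qed
  show "b \<in> carrier (coeff_space p)" "nrm (coeff_space p) b \<le> K * nrm (coeff_space p) a"
    by (rule coeff_dual_criterion[OF p _ lim *]; use a K coeff_nrm_nonneg[OF p] in auto)+
qed

lemma coeff_finite_support:
  assumes p: "1 \<le> p" and a: "\<And>n. n \<ge> N \<Longrightarrow> a n = 0"
  shows "a \<in> carrier (coeff_space p)"
proof (cases "p = 1")
  case True
  have "a \<longlonglongrightarrow> 0" by (rule tendsto_eventually) (use a in \<open>auto simp: eventually_sequentially\<close>)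
  then show ?thesis using True by (simp add: coeff_space_one)
next
  case False
  have "summable (\<lambda>n. cmod (a n) powr (p/(p-1)))"
    by (rule summable_finite[of "{..<N}"]) (use a in auto)
  then show ?thesis using False by (simp add: coeff_space_gt_one)
qed

lemma coeff_scale:
  assumes p: "1 \<le> p" and a: "a \<in> carrier (coeff_space p)"
  shows "(\<lambda>n. c * a n) \<in> carrier (coeff_space p)"
    "nrm (coeff_space p) (\<lambda>n. c * a n) = cmod c * nrm (coeff_space p) a"
proof -
  have 1: "(\<lambda>n. d * b n) \<in> carrier (coeff_space p)" 
    "nrm (coeff_space p) (\<lambda>n. d * b n) \<le> cmod d * nrm (coeff_space p) b" 
    if "b \<in> carrier (coeff_space p)" for b d
    using coeff_solid[OF p that, of "cmod d" "\<lambda>n. d * b n"] by (auto simp: norm_mult)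
  show c: "(\<lambda>n. c * a n) \<in> carrier (coeff_space p)" using 1 a by auto
  have "cmod c * nrm (coeff_space p) a \<le> nrm (coeff_space p) (\<lambda>n. c * a n)"
  proof (cases "c = 0")
    case True then show ?thesis using coeff_nrm_nonneg[OF p c] by simp
  next
    case False
    then show ?thesis using 1(2)[OF c, of "1/c"] by (simp add: norm_divide field_simps)
  qed
  with 1(2)[OF a, of c] show "nrm (coeff_space p) (\<lambda>n. c * a n) = cmod c * nrm (coeff_space p) a"
    by simp
qed

lemma normed_cmodule_coeff:
  assumes p: "1 \<le> p" shows "normed_cmodule (coeff_space p)"
proof -
  have ab: "abelian_group (coeff_space p)"
  proof (rule abelian_groupI)
    fix a assume "a \<in> carrier (coeff_space p)"
    then have "(\<lambda>n. (-1) * a n) \<in> carrier (coeff_space p)" using coeff_scale[OF p, of a "-1"] by blast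
    then show "\<exists>b\<in>carrier (coeff_space p). b \<oplus>\<^bsub>coeff_space p\<^esub> a = \<zero>\<^bsub>coeff_space p\<^esub>"
      by (rule rev_bexI) simp
  qed (use coeff_add[OF p] coeff_finite_support[OF p, of 0] in \<open>auto simp: algebra_simps\<close>)
  have "module complex_ring (coeff_space p)"
    by (rule moduleI[OF cring_complex_ring ab]) (use coeff_scale[OF p] in \<open>auto simp: algebra_simps\<close>)
  then interpret cmodule "coeff_space p" by (rule cmodule.intro)
  show ?thesis
  proof
    show "seminorm (nrm (coeff_space p))"
      unfolding seminorm_def using coeff_add[OF p] coeff_scale[OF p] by auto
    show "a = \<zero>\<^bsub>coeff_space p\<^esub>" if "a \<in> carrier (coeff_space p)" "nrm (coeff_space p) a = 0" for a
      using coeff_le_nrm[OF p that(1)] that(2) by (auto simp: fun_eq_iff)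
  qed
qed

text \<open>Tails vanish because the conjugate exponent is finite for \<open>p > 1\<close> and
  because the coefficients are null sequences for \<open>p = 1\<close>. This makes the series in
  \<open>q_damp_p_conv\<close> converge in norm.\<close>

lemma coeff_truncate:
  assumes p: "1 \<le> p" and a: "a \<in> carrier (coeff_space p)"
  shows "(\<lambda>N. nrm (coeff_space p) (\<lambda>n. if n < N then 0 else a n)) \<longlonglongrightarrow> 0"
proof (cases "p = 1")
  case True
  show ?thesis
  proof (rule LIMSEQ_I)
    fix r :: real assume r: "0 < r"
    then obtain N where N: "\<And>n. n \<ge> N \<Longrightarrow> cmod (a n) < r/2"
      using LIMSEQ_D[of a 0 "r/2"] a by (auto simp: True coeff_space_one)
    have "norm (nrm (coeff_space p) (\<lambda>n. if n < M then 0 else a n) - 0) < r" if M: "M \<ge> N" for M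
    proof -
      have "nrm (coeff_space p) (\<lambda>n. if n < M then 0 else a n) \<le> r/2"
        unfolding True coeff_space_one using N M r by (intro cSUP_least) (auto intro: less_imp_le)
      moreover have "0 \<le> nrm (coeff_space p) (\<lambda>n. if n < M then 0 else a n)"
        by (rule coeff_nrm_nonneg[OF p coeff_solid(1)[OF p a, of 1]]) auto
      ultimately show ?thesis using r by simp
    qed
    then show "\<exists>no. \<forall>n\<ge>no. norm (nrm (coeff_space p) (\<lambda>na. if na < n then 0 else a na) - 0) < r" by blast
  qed
next
  case False
  define q where "q = p/(p-1)"
  have q1: "q > 1" using False p by (auto simp: q_def field_simps)
  define h where "h n = cmod (a n) powr q" for n
  have sm: "summable h" using a False unfolding coeff_space_gt_one[OF False] q_def h_def by simp
  have "(\<Sum>n. cmod (if n < N then 0 else a n) powr q) = (\<Sum>n. h (n + N))" for N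
  proof -
    have eq: "cmod (if n < N then 0 else a n) powr q = (if n < N then 0 else h n)" for n by (simp add: h_def)
    have "summable (\<lambda>n. if n < N then 0 else h n)"
      by (rule summable_comparison_test'[OF sm, of 0]) (simp add: h_def)
    from suminf_split_initial_segment[OF this, of N]
    show ?thesis unfolding eq by simp
  qed
  then have "nrm (coeff_space p) (\<lambda>n. if n < N then 0 else a n) = (\<Sum>n. h (n + N)) powr (1/q)" for N
    using False by (simp add: coeff_space_gt_one q_def)
  moreover have "(\<lambda>N. (\<Sum>n. h (n + N)) powr (1/q)) \<longlonglongrightarrow> 0"
    using suminf_exist_split2[OF sm] q1 suminf_nonneg[OF summable_ignore_initial_segment[OF sm]]
    by (intro tendsto_eq_intros tendsto_powr') (auto intro!: always_eventually simp: h_def)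
  ultimately show ?thesis by simp
qed

text \<open>The equality case of Hoelder's inequality on finitely many coordinates. It converts a
  bound for a functional on the unit ball into a p-norm bound for its values on the unit
  vectors.\<close>

lemma coeff_dual_attained:
  assumes p: "1 \<le> p" and t: "\<And>i. 0 \<le> t i" 
  obtains c :: "nat \<Rightarrow> real" where "\<And>i. 0 \<le> c i" "\<And>i. i \<ge> N \<Longrightarrow> c i = 0"
    "nrm (coeff_space p) (\<lambda>i. complex_of_real (c i)) \<le> 1"
    "(\<Sum>i<N. c i * t i) = (\<Sum>i<N. t i powr p) powr (1/p)"
proof (cases "p = 1")
  case True
  show ?thesis
  proof (rule that[of "\<lambda>i. if i < N then 1 else 0"])
    show "nrm (coeff_space p) (\<lambda>i. complex_of_real (if i < N then 1 else 0)) \<le> 1"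
      unfolding True coeff_space_one by (rule cSUP_least) auto
  qed (use t True in \<open>auto simp: sum_nonneg if_distrib[of "\<lambda>x. x * _"] cong: if_cong\<close>)
next
  case False
  define q where "q = p/(p-1)"
  have p1: "p > 1" using False p by simp
  have q1: "q > 1" and qp: "(p - 1) * q = p" and qq: "1 - 1/q = 1/p" 
    using p1 by (auto simp: q_def field_simps)
  define s where "s = (\<Sum>i<N. t i powr p)"
  have s0: "s \<ge> 0" by (auto simp: s_def sum_nonneg)
  show ?thesis
  proof (cases "s = 0")
    case True
    show ?thesis
      by (rule that[of "\<lambda>_. 0"]) (use True False in \<open>auto simp: coeff_space_gt_one s_def\<close>)
  next
    case s: False
    then have s1: "s > 0" using s0 by simp
    \<comment> \<open>Division by \<open>s powr (1/q)\<close> normalises the q-norm to 1, as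
      \<open>(p - 1) * q = p\<close>.\<close>
    define c where "c i = (if i < N then t i powr (p-1) / s powr (1/q) else 0)" for i
    have "(\<Sum>i<N. c i * t i) = (\<Sum>i<N. t i powr p / s powr (1/q))"
      by (rule sum.cong) (use t powr_mult_base[of "t _" "p-1"] in \<open>auto simp: c_def mult.commute\<close>)
    also have "\<dots> = s / s powr (1/q)" by (simp add: s_def sum_divide_distrib)
    also have "\<dots> = s powr (1/p)" using s1 by (simp add: powr_diff flip: qq)
    finally have 1: "(\<Sum>i<N. c i * t i) = s powr (1/p)" .
    have "(\<Sum>n. cmod (complex_of_real (c n)) powr q) = (\<Sum>n<N. c n powr q)"
      by (subst suminf_finite[of "{..<N}"]) (auto simp: c_def norm_divide)
    also have "\<dots> = (\<Sum>n<N. t n powr p / s)"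
      by (rule sum.cong) (use t s1 q1 in \<open>auto simp: c_def powr_divide powr_powr qp\<close>)
    also have "\<dots> = 1" using s1 by (simp add: s_def flip: sum_divide_distrib)
    finally have 2: "nrm (coeff_space p) (\<lambda>i. complex_of_real (c i)) = 1"
      using False by (simp add: coeff_space_gt_one q_def)
    show ?thesis by (rule that[of c]) (use 1 2 s1 t in \<open>auto simp: c_def s_def\<close>)
  qed
qed

text \<open>The norm is tested on finitely many coordinates at a time, so a uniform bound survives
  coordinatewise limits. For \<open>p = 1\<close> such a limit may leave c_0; the null factor
  \<open>l\<close> brings it back.\<close>

lemma coeff_fatou:
  assumes p: "1 \<le> p" and a: "\<And>k. a k \<in> carrier (coeff_space p)" 
    and C: "\<And>k. nrm (coeff_space p) (a k) \<le> C" 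
    and lim: "\<And>n. (\<lambda>k. a k n) \<longlonglongrightarrow> b n" 
    and l: "l \<longlonglongrightarrow> 0" "\<And>n. 0 \<le> l n" "\<And>n. l n \<le> (1::real)"
  shows "(\<lambda>n. complex_of_real (l n) * b n) \<in> carrier (coeff_space p)" 
    "nrm (coeff_space p) (\<lambda>n. complex_of_real (l n) * b n) \<le> C"
proof -
  have C0: "0 \<le> C" using order_trans[OF coeff_nrm_nonneg[OF p a] C] by auto
  have bC: "cmod (b n) \<le> C" for n
  proof (rule LIMSEQ_le_const2[OF tendsto_norm[OF lim]])
    show "\<exists>N. \<forall>k\<ge>N. norm (a k n) \<le> C" using order_trans[OF coeff_le_nrm[OF p a] C] by blast
  qed
  have *: "(\<Sum>i<N. cmod (complex_of_real (l i) * b i) * t i) \<le> C * (\<Sum>i<N. t i powr p) powr (1/p)"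
    if t: "\<And>i. 0 \<le> t i" for N t
  proof -
    have "(\<Sum>i<N. cmod (complex_of_real (l i) * b i) * t i) \<le> (\<Sum>i<N. cmod (b i) * t i)"
      using l by (intro sum_mono mult_right_mono t) (auto simp: norm_mult mult_left_le_one_le)
    also have "\<dots> \<le> C * (\<Sum>i<N. t i powr p) powr (1/p)"
    proof (rule LIMSEQ_le_const2)
      show "(\<lambda>k. \<Sum>i<N. cmod (a k i) * t i) \<longlonglongrightarrow> (\<Sum>i<N. cmod (b i) * t i)"
        by (intro tendsto_intros lim)
      have "(\<Sum>i<N. cmod (a k i) * t i) \<le> C * (\<Sum>i<N. t i powr p) powr (1/p)" for k
        using coeff_holder[OF p a, of "{..<N}" t k] t mult_right_mono[OF C, of "(\<Sum>i<N. t i powr p) powr (1/p)" k] 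
        by force
      then show "\<exists>M. \<forall>k\<ge>M. (\<Sum>i<N. cmod (a k i) * t i) \<le> C * (\<Sum>i<N. t i powr p) powr (1/p)" by blast
    qed
    finally show ?thesis .
  qed
  have lim': "(\<lambda>n. complex_of_real (l n) * b n) \<longlonglongrightarrow> 0"
  proof (rule Lim_null_comparison)
    show "\<forall>\<^sub>F n in sequentially. norm (complex_of_real (l n) * b n) \<le> l n * C"
      using l bC by (auto simp: norm_mult intro!: always_eventually mult_left_mono)
    show "(\<lambda>n. l n * C) \<longlonglongrightarrow> 0" using l by (auto intro!: tendsto_eq_intros)
  qed
  show "(\<lambda>n. complex_of_real (l n) * b n) \<in> carrier (coeff_space p)" 
    "nrm (coeff_space p) (\<lambda>n. complex_of_real (l n) * b n) \<le> C"
    by (rule coeff_dual_criterion[OF p C0 lim' *]; simp)+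
qed

text \<open>A countable product of closed discs is compact by Tychonoff and metrizable, hence
  sequentially compact; this stands in for a diagonal argument.\<close>

lemma pointwise_bounded_subsequence:
  fixes a :: "nat \<Rightarrow> nat \<Rightarrow> complex"
  assumes "\<And>k n. cmod (a k n) \<le> C"
  obtains b r where "strict_mono (r :: nat \<Rightarrow> nat)" "\<And>n. (\<lambda>k. a (r k) n) \<longlonglongrightarrow> b n"
proof -
  have "compactin (product_topology (\<lambda>_. euclidean) UNIV) (PiE UNIV (\<lambda>_::nat. cball (0::complex) C))"
    by (simp add: compactin_PiE)
  then have "compact (PiE UNIV (\<lambda>_::nat. cball (0::complex) C))"
    by (simp add: euclidean_product_topology)
  then have "seq_compact (PiE UNIV (\<lambda>_::nat. cball (0::complex) C))"
    by (simp add: compact_eq_seq_compact_metric)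
  moreover have "\<forall>k. a k \<in> PiE UNIV (\<lambda>_::nat. cball (0::complex) C)" using assms by auto
  ultimately obtain b r where r: "strict_mono r" "(a \<circ> r) \<longlonglongrightarrow> b" unfolding seq_compact_def by blast
  have "(\<lambda>k. (a \<circ> r) k n) \<longlonglongrightarrow> b n" for n
    by (rule continuous_on_tendsto_compose[OF _ r(2), of UNIV]) (auto intro: continuous_on_product_coordinates)
  then show ?thesis using that r by (auto simp: o_def)
qed

section \<open>Normed modules and quotients\<close>

lemma type_space_simps [simp]:
  "carrier (type_space :: 'a::complex_normed_vector normed_module) = UNIV"
  "\<zero>\<^bsub>type_space :: 'a normed_module\<^esub> = 0"
  "x \<oplus>\<^bsub>type_space\<^esub> y = x + y" "c \<odot>\<^bsub>type_space\<^esub> x = scaleC c x" "nrm type_space x = norm x"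
  for x y :: "'a::complex_normed_vector"
  by (simp_all add: type_space_def)

lemma scaleC_one [simp]: "scaleC 1 x = (x :: 'a::complex_normed_vector)"
  using scaleC_of_real[of 1 x] by simp

lemma scaleC_minus_one: "scaleC (- 1) x = - (x :: 'a::complex_normed_vector)"
  using scaleC_of_real[of "- 1" x] by simp

lemma scaleC_zero [simp]: "scaleC 0 x = (0 :: 'a::complex_normed_vector)" "scaleC c 0 = (0 :: 'a)"
  using norm_scaleC[of 0 x] norm_scaleC[of c "0::'a"] by simp_all

lemma bounded_linear_scaleC: "bounded_linear (scaleC c :: 'a::complex_normed_vector \<Rightarrow> 'a)"
proof (rule bounded_linear_intro[where K = "cmod c"])
  show "scaleC c (r *\<^sub>R x) = r *\<^sub>R scaleC c x" for r and x :: 'a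
    by (simp add: scaleC_scaleC mult.commute flip: scaleC_of_real)
qed (auto simp: scaleC_add_right norm_scaleC mult.commute)

lemma bounded_linear_scaleC_left: "bounded_linear (\<lambda>c. scaleC c x :: 'a::complex_normed_vector)"
proof (rule bounded_linear_intro[where K = "norm x"])
  show "scaleC (r *\<^sub>R c) x = r *\<^sub>R scaleC c x" for r c
    by (simp add: scaleR_conv_of_real scaleC_scaleC flip: scaleC_of_real)
qed (auto simp: scaleC_add_left norm_scaleC)

lemma normed_cmodule_type_space: "normed_cmodule (type_space :: 'a::complex_normed_vector normed_module)"
proof -
  have ab: "abelian_group (type_space :: 'a normed_module)"
    by (rule abelian_groupI) (auto simp: algebra_simps intro: exI[of _ "- x" for x] add.left_inverse)
  have "module complex_ring (type_space :: 'a normed_module)"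
    by (rule moduleI[OF cring_complex_ring ab]) (auto simp: scaleC_add_left scaleC_add_right scaleC_scaleC)
  then interpret cmodule "type_space :: 'a normed_module" by (rule cmodule.intro)
  show ?thesis
  proof
    show "seminorm (nrm (type_space :: 'a normed_module))"
      unfolding seminorm_def by (auto simp: norm_triangle_ineq norm_scaleC)
  qed auto
qed

interpretation ts: normed_cmodule "type_space :: 'a::complex_normed_vector normed_module"
  by (rule normed_cmodule_type_space)

lemma type_space_uminus [simp]: "\<ominus>\<^bsub>type_space\<^esub> x = - (x :: 'a::complex_normed_vector)"
  using ts.smult_minus_one[of x] by (simp add: scaleC_minus_one)

lemma type_space_minus [simp]: "x \<ominus>\<^bsub>type_space\<^esub> y = x - (y :: 'a::complex_normed_vector)"
  by (simp add: a_minus_def)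

lemma finsum_type_space [simp]: 
  "(\<Oplus>\<^bsub>type_space\<^esub>i\<in>I. f i) = (\<Sum>i\<in>I. f i :: 'a::complex_normed_vector)"
proof (induction I rule: infinite_finite_induct)
  \<comment> \<open>On infinite index sets both sums default to 0.\<close>
  case (infinite I)
  then show ?case by (simp add: finsum_def finprod_def)
qed (simp_all add: ts.M.finsum_insert)

lemma norm_topology_type_space [simp]: 
  "norm_topology (type_space :: 'a::complex_normed_vector normed_module) = euclidean"
proof -
  have "norm_dist type_space = (dist :: 'a \<Rightarrow> 'a \<Rightarrow> real)"
    by (auto simp: norm_dist_def dist_norm fun_eq_iff)
  then show ?thesis by (simp add: norm_topology_def)
qed

section \<open>Norm topology and dual unit ball\<close>

context normed_cmodule
begin

lemma nrm_add: "x \<in> carrier X \<Longrightarrow> y \<in> carrier X \<Longrightarrow> nrm X (x \<oplus> y) \<le> nrm X x + nrm X y"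
  using seminorm_nrm unfolding seminorm_def by auto

lemma nrm_smult: "x \<in> carrier X \<Longrightarrow> nrm X (c \<odot> x) = cmod c * nrm X x"
  using seminorm_nrm unfolding seminorm_def by auto

lemmas nrm_nonneg = seminorm_nonneg[OF seminorm_nrm]
lemmas nrm_uminus = seminorm_minus[OF seminorm_nrm]
lemmas nrm_zero = seminorm_zero[OF seminorm_nrm]

lemma nrm_minus_commute: "x \<in> carrier X \<Longrightarrow> y \<in> carrier X \<Longrightarrow> nrm X (x \<ominus> y) = nrm X (y \<ominus> x)"
  using nrm_uminus[of "x \<ominus> y"] by (simp add: a_minus_def M.minus_add M.a_comm)

lemma minus_eq_zero_iff: "x \<in> carrier X \<Longrightarrow> y \<in> carrier X \<Longrightarrow> x \<ominus> y = \<zero> \<longleftrightarrow> x = y"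
  using M.r_neg[of y] M.a_assoc[of x "\<ominus> y" y] by (metis M.a_inv_closed M.l_neg M.l_zero M.r_zero a_minus_def)

sublocale metric: Metric_space "carrier X" "norm_dist X"
proof
  show "0 \<le> norm_dist X x y" for x y
    by (auto simp: norm_dist_def intro: nrm_nonneg)
  show "norm_dist X x y = norm_dist X y x" for x y
    by (auto simp: norm_dist_def nrm_minus_commute)
  show "norm_dist X x y = 0 \<longleftrightarrow> x = y" if "x \<in> carrier X" "y \<in> carrier X" for x y
    using that nrm_zero_imp[of "x \<ominus> y"] nrm_zero minus_eq_zero_iff[OF that] by (auto simp: norm_dist_def)
  show "norm_dist X x z \<le> norm_dist X x y + norm_dist X y z" 
    if "x \<in> carrier X" "y \<in> carrier X" "z \<in> carrier X" for x y z
  proof -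
    have "x \<ominus> z = (x \<ominus> y) \<oplus> (y \<ominus> z)"
      using that by (simp add: a_minus_def M.a_assoc M.r_neg1 M.r_neg2)
    then show ?thesis using that nrm_add[of "x \<ominus> y" "y \<ominus> z"] by (simp add: norm_dist_def)
  qed
qed

lemma limitin_norm_topology:
  assumes "\<And>n. f n \<in> carrier X"
  shows "limitin (norm_topology X) f l sequentially \<longleftrightarrow> 
    l \<in> carrier X \<and> (\<lambda>n. nrm X (f n \<ominus> l)) \<longlonglongrightarrow> 0"
proof (cases "l \<in> carrier X")
  case True
  then show ?thesis using assms nrm_nonneg[of "f _ \<ominus> l"]
    unfolding norm_topology_def metric.limit_metric_sequentially lim_sequentially
    by (simp add: norm_dist_def)
qed (simp add: norm_topology_def metric.limit_metric_sequentially)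

lemma zero_dual_ball: "(\<lambda>_. 0) \<in> dual_ball X"
  by (auto simp: dual_ball_def bounded_ops_def intro!: ts.smult_r_null[simplified] exI[of _ 0])

lemma additive_finsum:
  fixes f :: "nat \<Rightarrow> 'a"
  assumes "\<And>x y. x \<in> carrier X \<Longrightarrow> y \<in> carrier X \<Longrightarrow> \<phi> (x \<oplus> y) = \<phi> x + (\<phi> y :: 'b::complex_normed_vector)"
    and "\<And>n. f n \<in> carrier X"
  shows "\<phi> (\<Oplus>n\<in>{..<N}. f n) = (\<Sum>n<N. \<phi> (f n))"
proof (induction N)
  case 0
  have "\<phi> (\<zero> \<oplus> \<zero>) = \<phi> \<zero> + \<phi> \<zero>" using assms(1) by blast
  then show ?case by simp
next
  case (Suc N)
  then show ?case using assms by (simp add: lessThan_Suc M.finsum_insert add.commute)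
qed

lemma dual_ball_le_nrm:
  assumes "\<phi> \<in> dual_ball X" "x \<in> carrier X" shows "cmod (\<phi> x) \<le> nrm X x"
proof -
  have hom: "\<phi> (c \<odot> x) = c * \<phi> x" for c
    using assms unfolding dual_ball_def bounded_ops_def by (simp add: scaleC_complex_def)
  have le1: "cmod (\<phi> y) \<le> 1" if "y \<in> carrier X" "nrm X y \<le> 1" for y
    using assms that unfolding dual_ball_def unit_ball_def by auto
  \<comment> \<open>Scaling by \<open>1/r\<close> with \<open>r\<close> strictly above the norm also
    covers vectors of norm 0.\<close>
  have *: "cmod (\<phi> x) \<le> r" if "r > nrm X x" for r
  proof -
    have r: "r > 0" using that nrm_nonneg[OF assms(2)] by simp
    have "nrm X (complex_of_real (1/r) \<odot> x) \<le> 1" 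
      using r that nrm_smult[OF assms(2), of "complex_of_real (1/r)"] by (simp add: norm_divide)
    from le1[OF _ this] have "cmod (complex_of_real (1/r) * \<phi> x) \<le> 1" 
      using assms(2) hom by simp
    then show ?thesis using r by (simp add: norm_mult norm_divide)
  qed
  show ?thesis by (rule dense_ge) (use * in auto)
qed

lemma dual_ballI:
  assumes "\<forall>x\<in>carrier X. \<forall>y\<in>carrier X. \<phi> (x \<oplus> y) = \<phi> x + \<phi> y"
    "\<forall>c. \<forall>x\<in>carrier X. \<phi> (c \<odot> x) = c * \<phi> x"
    "\<forall>x\<in>carrier X. cmod (\<phi> x) \<le> nrm X x" 
  shows "\<phi> \<in> dual_ball X"
  using assms unfolding dual_ball_def bounded_ops_def unit_ball_def
  by (auto simp: scaleC_complex_def intro!: exI[of _ 1] intro: order_trans)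

lemma dual_ball_attains_nrm:
  assumes "x \<in> carrier X" obtains \<phi> where "\<phi> \<in> dual_ball X" "\<phi> x = complex_of_real (nrm X x)"
proof -
  obtain \<phi> where \<phi>: "\<forall>x\<in>carrier X. \<forall>y\<in>carrier X. \<phi> (x \<oplus> y) = \<phi> x + \<phi> y"
    "\<forall>c. \<forall>x\<in>carrier X. \<phi> (c \<odot> x) = c * \<phi> x"
    "\<forall>x\<in>carrier X. cmod (\<phi> x) \<le> nrm X x" "\<phi> x = complex_of_real (nrm X x)"
    by (rule hahn_banach[OF seminorm_nrm assms])
  show ?thesis by (rule that[OF dual_ballI[OF \<phi>(1-3)] \<phi>(4)])
qed

end

section \<open>Quotients by closed submodules\<close>

locale closed_submodule = normed_cmodule +
  fixes M
  assumes submod: "submodule M complex_ring X" and closed: "closedin (norm_topology X) M"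
begin

abbreviation "Z \<equiv> quotient_module X M"
abbreviation "q a \<equiv> M +> a"

sublocale sub: abelian_subgroup M X
  by (rule abelian_subgroupI3[OF additive_subgroup.intro])
    (use submod in \<open>auto simp: submodule_def intro: M.abelian_group_axioms\<close>)

lemma M_smult: "x \<in> M \<Longrightarrow> c \<odot> x \<in> M"
  using submoduleE(4)[OF submod, of c x] by simp

lemma carrier_Z: "carrier Z = q ` carrier X"
  by (auto simp: quotient_module_def A_RCOSETS_def')

lemma q_closed [simp]: "a \<in> carrier X \<Longrightarrow> q a \<in> carrier Z"
  by (simp add: carrier_Z)

lemma mem_q: "a \<in> carrier X \<Longrightarrow> b \<in> carrier X \<Longrightarrow> b \<in> q a \<longleftrightarrow> b \<ominus> a \<in> M"
  by (simp add: sub.a_rcos_module a_minus_def)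

lemma q_self: "a \<in> carrier X \<Longrightarrow> a \<in> q a"
  by (rule sub.a_rcos_self)

lemma q_subset: "a \<in> carrier X \<Longrightarrow> b \<in> q a \<Longrightarrow> b \<in> carrier X"
  by (rule sub.a_elemrcos_carrier)

lemma q_eqI: "b \<in> q a \<Longrightarrow> a \<in> carrier X \<Longrightarrow> q b = q a"
  using sub.a_repr_independence' by simp

lemma q_eq_iff: "a \<in> carrier X \<Longrightarrow> b \<in> carrier X \<Longrightarrow> q a = q b \<longleftrightarrow> a \<ominus> b \<in> M"
  using mem_q[of b a] q_self[of a] q_eqI[of a b] by metis

lemma Z_add: "a \<in> carrier X \<Longrightarrow> b \<in> carrier X \<Longrightarrow> q a \<oplus>\<^bsub>Z\<^esub> q b = q (a \<oplus> b)"
  by (simp add: quotient_module_def sub.a_rcos_sum)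

lemma Z_zero: "\<zero>\<^bsub>Z\<^esub> = q \<zero>"
  by (simp add: quotient_module_def sub.a_rcos_const)

text \<open>The union that defines scalar multiplication runs over equal cosets because
  \<open>M\<close> is stable under scalars; for \<open>c = 0\<close> all of them are
  \<open>M\<close> itself.\<close>

lemma Z_smult: assumes a: "a \<in> carrier X" shows "c \<odot>\<^bsub>Z\<^esub> q a = q (c \<odot> a)"
proof -
  have "q (c \<odot> b) = q (c \<odot> a)" if "b \<in> q a" for b
  proof -
    have b: "b \<in> carrier X" using q_subset[OF a that] .
    have "c \<odot> (b \<ominus> a) \<in> M" using M_smult mem_q a b that by auto
    moreover have "c \<odot> (b \<ominus> a) = c \<odot> b \<ominus> c \<odot> a"
      using a b by (simp add: a_minus_def smult_r_distr smult_r_minus)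
    ultimately show ?thesis using a b by (simp add: q_eq_iff)
  qed
  then have "(\<Union>b\<in>q a. q (c \<odot> b)) = (\<Union>b\<in>q a. q (c \<odot> a))" by (rule SUP_cong[OF refl])
  also have "\<dots> = q (c \<odot> a)" using q_self[OF a] by blast
  finally show ?thesis by (simp add: quotient_module_def)
qed

lemma Z_bdd: "a \<in> carrier X \<Longrightarrow> bdd_below (nrm X ` q a)"
  by (rule bdd_belowI2[of _ 0]) (use nrm_nonneg q_subset in blast)

lemma Z_nrm: "nrm Z A = (INF a\<in>A. nrm X a)"
  by (simp add: quotient_module_def)

lemma nrm_q_le: "a \<in> carrier X \<Longrightarrow> nrm Z (q a) \<le> nrm X a"
  unfolding Z_nrm by (rule cINF_lower[OF Z_bdd q_self])

text \<open>The infimum in the quotient norm need not be attained, so representatives are always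
  chosen below a strict bound.\<close>

lemma nrm_Z_lt: 
  assumes "A \<in> carrier Z" "nrm Z A < r"
  obtains a where "a \<in> carrier X" "A = q a" "nrm X a < r"
proof -
  obtain b where b: "b \<in> carrier X" "A = q b" using assms by (auto simp: carrier_Z)
  have "\<exists>a\<in>A. nrm X a < r"
    using cINF_less_iff[OF _ Z_bdd[OF b(1)]] q_self[OF b(1)] assms(2) b(2) unfolding Z_nrm by blast
  then show ?thesis using that b q_subset q_eqI by metis
qed

lemma normed_cmodule_Z: "normed_cmodule Z"
proof -
  have ab: "abelian_group Z"
  proof (rule abelian_groupI)
    show "\<exists>y\<in>carrier Z. y \<oplus>\<^bsub>Z\<^esub> x = \<zero>\<^bsub>Z\<^esub>" if x: "x \<in> carrier Z" for x
    proof -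
      obtain a where "a \<in> carrier X" "x = q a" using x by (auto simp: carrier_Z)
      then show ?thesis by (intro bexI[of _ "q (\<ominus> a)"]) (auto simp: Z_add Z_zero M.l_neg)
    qed
  qed (auto simp: carrier_Z Z_add Z_zero M.a_ac)
  have "module complex_ring Z"
    by (rule moduleI[OF cring_complex_ring ab]) 
      (auto simp: carrier_Z Z_add Z_smult smult_add smult_r_distr smult_smult)
  then interpret Z: cmodule Z by (rule cmodule.intro)
  have nn: "0 \<le> nrm Z A" if A: "A \<in> carrier Z" for A
  proof -
    obtain a where "a \<in> carrier X" "A = q a" using A by (auto simp: carrier_Z)
    then show ?thesis unfolding Z_nrm using q_self q_subset nrm_nonneg by (intro cINF_greatest) blast+
  qed
  have tri: "nrm Z (A \<oplus>\<^bsub>Z\<^esub> B) \<le> nrm Z A + nrm Z B" if AB: "A \<in> carrier Z" "B \<in> carrier Z" for A B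
  proof (rule field_le_epsilon)
    fix e :: real assume "e > 0"
    then obtain a b where ab: "a \<in> carrier X" "A = q a" "nrm X a < nrm Z A + e/2"
      "b \<in> carrier X" "B = q b" "nrm X b < nrm Z B + e/2"
      using nrm_Z_lt[OF AB(1), of "nrm Z A + e/2"] nrm_Z_lt[OF AB(2), of "nrm Z B + e/2"]
      by (metis less_add_same_cancel1 half_gt_zero)
    have "nrm Z (A \<oplus>\<^bsub>Z\<^esub> B) \<le> nrm X (a \<oplus> b)" using nrm_q_le[of "a \<oplus> b"] ab by (simp add: Z_add)
    also have "\<dots> \<le> nrm X a + nrm X b" using ab by (intro nrm_add)
    finally show "nrm Z (A \<oplus>\<^bsub>Z\<^esub> B) \<le> nrm Z A + nrm Z B + e" using ab by simp
  qed
  have le: "nrm Z (c \<odot>\<^bsub>Z\<^esub> A) \<le> cmod c * nrm Z A" if A: "A \<in> carrier Z" for c A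
  proof -
    obtain a0 where a0: "a0 \<in> carrier X" "A = q a0" using A by (auto simp: carrier_Z)
    have *: "nrm Z (c \<odot>\<^bsub>Z\<^esub> A) \<le> cmod c * nrm X a" if "a \<in> A" for a
    proof -
      have a: "a \<in> carrier X" "A = q a" using that a0 q_subset q_eqI by auto
      then show ?thesis using nrm_q_le[of "c \<odot> a"] by (simp add: Z_smult nrm_smult)
    qed
    show ?thesis
    proof (cases "c = 0")
      case True
      then show ?thesis using *[of a0] a0 q_self by simp
    next
      case False
      have "nrm Z (c \<odot>\<^bsub>Z\<^esub> A) / cmod c \<le> nrm Z A"
        unfolding Z_nrm[of A] using False * a0 q_self
        by (intro cINF_greatest) (auto simp: field_simps)
      then show ?thesis using False by (simp add: field_simps)
    qed
  qed
  have scale: "nrm Z (c \<odot>\<^bsub>Z\<^esub> A) = cmod c * nrm Z A" if A: "A \<in> carrier Z" for c A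
  proof (cases "c = 0")
    case True
    then show ?thesis using le[OF A, of c] nn[OF Z.smult_cl[OF A, of c]] by simp
  next
    case False
    have "nrm Z ((1/c) \<odot>\<^bsub>Z\<^esub> (c \<odot>\<^bsub>Z\<^esub> A)) \<le> cmod (1/c) * nrm Z (c \<odot>\<^bsub>Z\<^esub> A)"
      by (rule le) (use A in auto)
    then have "cmod c * nrm Z A \<le> nrm Z (c \<odot>\<^bsub>Z\<^esub> A)" 
      using False A by (simp add: Z.smult_smult norm_divide field_simps)
    with le[OF A, of c] show ?thesis by simp
  qed
  show ?thesis
  proof
    show "Z.seminorm (nrm Z)" unfolding Z.seminorm_def using tri scale by blast
    show "A = \<zero>\<^bsub>Z\<^esub>" if A: "A \<in> carrier Z" "nrm Z A = 0" for A
    proof -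
      obtain a where a: "a \<in> carrier X" "A = q a" using A by (auto simp: carrier_Z)
      \<comment> \<open>Closedness of \<open>M\<close> enters here: a representative
        \<open>b\<close> of norm below \<open>r\<close> makes \<open>a \<ominus> b\<close> an
        element of \<open>M\<close> within distance \<open>r\<close> of \<open>a\<close>.\<close>
      have "a \<in> M"
      proof (rule ccontr)
        assume "a \<notin> M"
        then obtain r where r: "r > 0" "disjnt M (metric.mball a r)"
          using closed a unfolding norm_topology_def metric.closedin_metric by blast
        obtain b where b: "b \<in> carrier X" "A = q b" "nrm X b < r"
          using nrm_Z_lt[OF A(1), of r] A(2) r(1) by auto
        have "a \<ominus> b \<in> M" using a b by (metis q_eq_iff)
        moreover have "a \<ominus> (a \<ominus> b) = b"
          using a b by (simp add: a_minus_def M.minus_add M.minus_minus flip: M.a_assoc) (simp add: M.r_neg)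
        then have "a \<ominus> b \<in> metric.mball a r" using a b by (simp add: norm_dist_def)
        ultimately show False using r(2) by (auto simp: disjnt_iff)
      qed
      then have "a \<ominus> \<zero> \<in> M" using a by (simp add: a_minus_def)
      then show ?thesis using a by (simp add: Z_zero q_eq_iff)
    qed
  qed
qed

end

section \<open>From a factorization to p-compactness\<close>

lemma p_conv_type_space:
  "p_conv p type_space x = {y :: 'a::complex_normed_vector. 
     \<exists>a\<in>unit_ball (coeff_space p). (\<lambda>n. scaleC (a n) (x n)) sums y}"
  by (simp add: p_conv_def sums_def)

lemma strong_seqs_type_space:
  "x \<in> strong_seqs p type_space \<longleftrightarrow> summable (\<lambda>n. norm (x n :: 'a::complex_normed_vector) powr p)"
  by (simp add: strong_seqs_def)

lemma strong_norm_nonneg: "0 \<le> strong_norm p X x"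
  by (simp add: strong_norm_def)

lemma strong_seqs_scale:
  fixes x :: "nat \<Rightarrow> 'a::complex_normed_vector"
  assumes "x \<in> strong_seqs p type_space" "0 \<le> w" "1 \<le> p"
  shows "(\<lambda>n. scaleC (complex_of_real w) (x n)) \<in> strong_seqs p type_space"
    "strong_norm p type_space (\<lambda>n. scaleC (complex_of_real w) (x n)) = w * strong_norm p type_space x"
proof -
  have eq: "norm (scaleC (complex_of_real w) (x n)) powr p = w powr p * norm (x n) powr p" for n
    using assms by (simp add: norm_scaleC powr_mult)
  have sm: "summable (\<lambda>n. norm (x n) powr p)" using assms by (simp add: strong_seqs_type_space)
  show "(\<lambda>n. scaleC (complex_of_real w) (x n)) \<in> strong_seqs p type_space"
    unfolding strong_seqs_type_space eq by (rule summable_mult[OF sm])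
  have "0 \<le> (\<Sum>n. norm (x n) powr p)" by (rule suminf_nonneg[OF sm]) simp
  then show "strong_norm p type_space (\<lambda>n. scaleC (complex_of_real w) (x n)) = w * strong_norm p type_space x"
    unfolding strong_norm_def using assms by (simp add: eq suminf_mult[OF sm] powr_mult powr_powr)
qed

lemma p_conv_scale:
  fixes x :: "nat \<Rightarrow> 'a::complex_normed_vector"
  assumes "y \<in> p_conv p type_space x" 
  shows "scaleC c y \<in> p_conv p type_space (\<lambda>n. scaleC c (x n))"
proof -
  obtain a where a: "a \<in> unit_ball (coeff_space p)" "(\<lambda>n. scaleC (a n) (x n)) sums y"
    using assms by (auto simp: p_conv_type_space)
  have "(\<lambda>n. scaleC c (scaleC (a n) (x n))) sums scaleC c y"
    by (rule bounded_linear.sums[OF bounded_linear_scaleC a(2)])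
  then show ?thesis using a(1) by (auto simp: p_conv_type_space scaleC_scaleC mult.commute)
qed

context normed_cmodule
begin

lemma weak_norm_upper:
  assumes "z \<in> weak_seqs p X" "\<phi> \<in> dual_ball X" 
  shows "(\<Sum>n. cmod (\<phi> (z n)) powr p) powr (1/p) \<le> weak_norm p X z"
  unfolding weak_norm_def using assms by (intro cSUP_upper) (auto simp: weak_seqs_def)

lemma weak_norm_nonneg:
  assumes "z \<in> weak_seqs p X" shows "0 \<le> weak_norm p X z"
  using weak_norm_upper[OF assms zero_dual_ball] by simp

lemma dual_ball_linear:
  assumes "\<phi> \<in> dual_ball X"
  shows "x \<in> carrier X \<Longrightarrow> y \<in> carrier X \<Longrightarrow> \<phi> (x \<oplus> y) = \<phi> x + \<phi> y"
    "x \<in> carrier X \<Longrightarrow> \<phi> (c \<odot> x) = c * \<phi> x"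
    "x \<in> carrier X \<Longrightarrow> y \<in> carrier X \<Longrightarrow> \<phi> (x \<ominus> y) = \<phi> x - \<phi> y"
proof -
  show add: "\<phi> (x \<oplus> y) = \<phi> x + \<phi> y" if "x \<in> carrier X" "y \<in> carrier X" for x y
    using assms that by (simp add: dual_ball_def bounded_ops_def)
  show scale: "\<phi> (c \<odot> x) = c * \<phi> x" if "x \<in> carrier X" for c x
    using assms that by (simp add: dual_ball_def bounded_ops_def scaleC_complex_def)
  show "\<phi> (x \<ominus> y) = \<phi> x - \<phi> y" if "x \<in> carrier X" "y \<in> carrier X"
    using add[of x "\<ominus> y"] scale[of y "-1"] that by (simp add: a_minus_def smult_minus_one)
qed

text \<open>Tested with a norming functional of \<open>A\<close>, the partial sums are controlled by
  Hoelder's inequality between \<open>a\<close> and the scalars \<open>\<phi> (z n)\<close>; the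
  bound does not depend on \<open>N\<close> and passes to the limit.\<close>

lemma p_conv_nrm_le:
  assumes p: "1 \<le> p" and z: "z \<in> weak_seqs p X" and A: "A \<in> p_conv p X z"
  shows "A \<in> carrier X" "nrm X A \<le> weak_norm p X z"
proof -
  obtain a where a: "a \<in> unit_ball (coeff_space p)"
    and lim: "limitin (norm_topology X) (\<lambda>N. \<Oplus>n\<in>{..<N}. a n \<odot> z n) A sequentially"
    using A by (auto simp: p_conv_def)
  have zc: "z n \<in> carrier X" for n using z by (auto simp: weak_seqs_def)
  define s where "s N = (\<Oplus>n\<in>{..<N}. a n \<odot> z n)" for N
  have sc: "s N \<in> carrier X" for N unfolding s_def using zc by (intro M.finsum_closed) auto
  have Ac: "A \<in> carrier X" and lim0: "(\<lambda>N. nrm X (s N \<ominus> A)) \<longlonglongrightarrow> 0"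
    using lim limitin_norm_topology[OF sc] unfolding s_def by auto
  show "A \<in> carrier X" by (rule Ac)
  obtain \<phi> where \<phi>: "\<phi> \<in> dual_ball X" "\<phi> A = complex_of_real (nrm X A)"
    using dual_ball_attains_nrm[OF Ac] by blast
  have bd: "cmod (\<phi> (s N)) \<le> weak_norm p X z" for N
  proof -
    have sm: "summable (\<lambda>n. cmod (\<phi> (z n)) powr p)" using z \<phi> by (auto simp: weak_seqs_def)
    have "\<phi> (s N) = (\<Sum>n<N. a n * \<phi> (z n))"
      unfolding s_def using zc dual_ball_linear[OF \<phi>(1)]
      by (subst additive_finsum) auto
    then have "cmod (\<phi> (s N)) \<le> (\<Sum>n<N. cmod (a n) * cmod (\<phi> (z n)))"
      by (auto simp: norm_mult intro!: sum_norm_le)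
    also have "\<dots> \<le> nrm (coeff_space p) a * (\<Sum>n<N. cmod (\<phi> (z n)) powr p) powr (1/p)"
      using a by (intro coeff_holder p) (auto simp: unit_ball_def)
    also have "\<dots> \<le> 1 * (\<Sum>n<N. cmod (\<phi> (z n)) powr p) powr (1/p)"
      using a by (intro mult_right_mono) (auto simp: unit_ball_def)
    also have "\<dots> \<le> (\<Sum>n. cmod (\<phi> (z n)) powr p) powr (1/p)"
      using p sm by (auto intro!: powr_mono2 sum_le_suminf sum_nonneg)
    also have "\<dots> \<le> weak_norm p X z" by (rule weak_norm_upper[OF z \<phi>(1)])
    finally show ?thesis .
  qed
  have "nrm X A \<le> weak_norm p X z + nrm X (s N \<ominus> A)" for N
  proof -
    have "nrm X A = cmod (\<phi> A)" using \<phi> nrm_nonneg[OF Ac] by simp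
    also have "\<dots> \<le> cmod (\<phi> (s N)) + cmod (\<phi> (s N) - \<phi> A)"
      by (metis norm_triangle_sub norm_minus_commute)
    also have "\<phi> (s N) - \<phi> A = \<phi> (s N \<ominus> A)" using dual_ball_linear(3)[OF \<phi>(1) sc Ac] by simp
    also have "cmod (\<phi> (s N)) + cmod \<dots> \<le> weak_norm p X z + nrm X (s N \<ominus> A)"
      using bd dual_ball_le_nrm[OF \<phi>(1)] sc Ac by (intro add_mono) auto
    finally show ?thesis .
  qed
  moreover have "(\<lambda>N. weak_norm p X z + nrm X (s N \<ominus> A)) \<longlonglongrightarrow> weak_norm p X z + 0"
    by (intro tendsto_intros lim0)
  ultimately show "nrm X A \<le> weak_norm p X z"
    using LIMSEQ_le_const by fastforce
qed

end

lemma normed_cmodule_quotient: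
  assumes "1 \<le> p" "Z \<in> quotient_spaces (coeff_space p)" shows "normed_cmodule Z"
proof -
  obtain M where "Z = quotient_module (coeff_space p) M" "submodule M complex_ring (coeff_space p)" 
    "closedin (norm_topology (coeff_space p)) M"
    using assms by (auto simp: quotient_spaces_def)
  moreover from this interpret closed_submodule "coeff_space p" M
    using normed_cmodule_coeff[OF assms(1)] by (intro closed_submodule.intro) (auto simp: closed_submodule_axioms_def)
  show ?thesis using normed_cmodule_Z calculation by simp
qed

lemma p_conv_range_factorization:
  fixes f :: "'e::complex_banach \<Rightarrow> 'f::complex_banach"
  assumes p: "1 \<le> p" and fac: "Kp_factorization p U v type_space f Z S g"
    and y: "S ` unit_ball Z \<subseteq> p_conv p type_space y"
    and z: "z \<in> uncond_seqs p Z" "weighted_range U v Z g \<subseteq> p_conv p Z z"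
    and w: "weak_norm p Z z < w"
  shows "weighted_range U v type_space f \<subseteq> p_conv p type_space (\<lambda>n. scaleC (complex_of_real w) (y n))"
proof -
  interpret Z: normed_cmodule Z
    using fac normed_cmodule_quotient[OF p] by (auto simp: Kp_factorization_def)
  have S: "S \<in> bounded_ops Z type_space" and g: "\<And>x. x \<in> U \<Longrightarrow> g x \<in> carrier Z" "\<And>x. x \<in> U \<Longrightarrow> f x = S (g x)"
    using fac by (auto simp: Kp_factorization_def p_compact_ops_def weighted_holo_Kup_def weighted_holo_def holomorphic_maps_def)
  have S_scale: "S (c \<odot>\<^bsub>Z\<^esub> A) = scaleC c (S A)" if "A \<in> carrier Z" for c A
    using S that by (auto simp: bounded_ops_def)
  have zw: "z \<in> weak_seqs p Z" using z by (simp add: uncond_seqs_def)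
  \<comment> \<open>The strict inequality makes \<open>w\<close> positive even when the weak norm is
    0, so division by \<open>w\<close> is legitimate.\<close>
  have w0: "w > 0" using Z.weak_norm_nonneg[OF zw] w by simp
  show ?thesis
    unfolding weighted_range_def
  proof (rule image_subsetI)
    fix x assume x: "x \<in> U"
    define A where "A = complex_of_real (v x) \<odot>\<^bsub>Z\<^esub> g x"
    have "A \<in> p_conv p Z z" using z(2) x by (auto simp: weighted_range_def A_def)
    then have A: "A \<in> carrier Z" "nrm Z A \<le> w" using Z.p_conv_nrm_le[OF p zw] w by force+
    have "complex_of_real (1/w) \<odot>\<^bsub>Z\<^esub> A \<in> unit_ball Z"
      using A w0 Z.nrm_smult[OF A(1), of "complex_of_real (1/w)"] by (simp add: unit_ball_def norm_divide)
    then have "S (complex_of_real (1/w) \<odot>\<^bsub>Z\<^esub> A) \<in> p_conv p type_space y" using y by blast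
    from p_conv_scale[OF this, of "complex_of_real w"]
    have "scaleC (complex_of_real w) (scaleC (complex_of_real (1/w)) (S A))
        \<in> p_conv p type_space (\<lambda>n. scaleC (complex_of_real w) (y n))"
      unfolding S_scale[OF A(1)] .
    moreover have "scaleC (complex_of_real w) (scaleC (complex_of_real (1/w)) (S A)) = S A"
      using w0 by (simp add: scaleC_scaleC)
    moreover have "S A = complex_of_real (v x) \<odot>\<^bsub>type_space\<^esub> f x"
      using g[OF x] S_scale by (simp add: A_def)
    ultimately show "complex_of_real (v x) \<odot>\<^bsub>type_space\<^esub> f x \<in> p_conv p type_space (\<lambda>n. scaleC (complex_of_real w) (y n))"
      by simp
  qed
qed

text \<open>Neither infimum need be attained, and the hypothesis asks for a strict gap above
  \<open>w\<close>; both infima are therefore raised by \<open>e\<close>, and continuity of the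
  product removes \<open>e\<close>.\<close>

lemma le_mult_Inf:
  fixes m :: real
  assumes P: "P \<noteq> {}" "\<And>s. s \<in> P \<Longrightarrow> 0 \<le> s" and Q: "Q \<noteq> {}" "\<And>w. w \<in> Q \<Longrightarrow> 0 \<le> w"
    and le: "\<And>s w w'. s \<in> P \<Longrightarrow> w \<in> Q \<Longrightarrow> w < w' \<Longrightarrow> m \<le> w' * s"
  shows "m \<le> Inf P * Inf Q"
proof -
  have "m \<le> (Inf P + e) * (Inf Q + e)" if e: "e > 0" for e
  proof -
    obtain s where s: "s \<in> P" "s < Inf P + e" using cInf_lessD[OF P(1), of "Inf P + e"] e by auto
    obtain w where w: "w \<in> Q" "w < Inf Q + e" using cInf_lessD[OF Q(1), of "Inf Q + e"] e by auto
    have "m \<le> (Inf Q + e) * s" by (rule le[OF s(1) w])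
    also have "\<dots> \<le> (Inf Q + e) * (Inf P + e)"
      using s w Q(2)[OF w(1)] by (intro mult_left_mono) auto
    finally show ?thesis by (simp add: mult.commute)
  qed
  then have "\<forall>\<^sub>F e in at_right 0. m \<le> (Inf P + e) * (Inf Q + e)"
    by (auto simp: eventually_at_right_field intro: exI[of _ 1])
  moreover have "((\<lambda>e. (Inf P + e) * (Inf Q + e)) \<longlongrightarrow> Inf P * Inf Q) (at_right 0)"
    by (auto intro!: tendsto_eq_intros)
  ultimately show ?thesis by (intro tendsto_lowerbound) auto
qed

lemma factorization_imp_Kp:
  fixes f :: "'e::complex_banach \<Rightarrow> 'f::complex_banach"
  assumes p: "1 \<le> p" and f: "f \<in> weighted_holo U v type_space" 
    and fac: "Kp_factorization p U v type_space f Z S g"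
  shows "f \<in> weighted_holo_Kp p U v type_space"
    "weighted_holo_Kp_norm p U v type_space f \<le> 
       p_compact_op_norm p Z type_space S * weighted_holo_Kup_norm p U v Z g"
proof -
  interpret Z: normed_cmodule Z
    using fac normed_cmodule_quotient[OF p] by (auto simp: Kp_factorization_def)
  \<comment> \<open>\<open>P\<close> and \<open>Q\<close> collect the sequences over which the norms
    of \<open>S\<close> and \<open>g\<close> are infima.\<close>
  define P where "P = {y \<in> strong_seqs p (type_space :: 'f normed_module). S ` unit_ball Z \<subseteq> p_conv p type_space y}"
  define Q where "Q = {z \<in> uncond_seqs p Z. weighted_range U v Z g \<subseteq> p_conv p Z z}"
  have ne: "P \<noteq> {}" "Q \<noteq> {}"
    using fac by (auto simp: P_def Q_def Kp_factorization_def p_compact_ops_def weighted_holo_Kup_def 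
        rel_p_compact_def rel_uncond_p_compact_def)
  have conv: "weighted_range U v type_space f \<subseteq> p_conv p type_space (\<lambda>n. scaleC (complex_of_real w) (y n))"
    if "y \<in> P" "z \<in> Q" "weak_norm p Z z < w" for y z w
    by (rule p_conv_range_factorization[OF p fac]) (use that in \<open>auto simp: P_def Q_def\<close>)
  have Q0: "0 \<le> weak_norm p Z z" if "z \<in> Q" for z
    using Z.weak_norm_nonneg that by (auto simp: Q_def uncond_seqs_def)
  obtain y0 z0 where yz: "y0 \<in> P" "z0 \<in> Q" using ne by auto
  have "rel_p_compact p type_space (weighted_range U v type_space f)"
    unfolding rel_p_compact_def
  proof (intro conjI bexI)
    show "weighted_range U v type_space f \<subseteq> p_conv p type_space (\<lambda>n. scaleC (complex_of_real (weak_norm p Z z0 + 1)) (y0 n))"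
      by (rule conv[OF yz]) simp
    show "(\<lambda>n. scaleC (complex_of_real (weak_norm p Z z0 + 1)) (y0 n)) \<in> strong_seqs p type_space"
      by (rule strong_seqs_scale(1)) (use yz Q0[OF yz(2)] p in \<open>auto simp: P_def\<close>)
  qed auto
  then show "f \<in> weighted_holo_Kp p U v type_space" using f by (simp add: weighted_holo_Kp_def)
  have "weighted_holo_Kp_norm p U v type_space f \<le> Inf (strong_norm p type_space ` P) * Inf (weak_norm p Z ` Q)"
  proof (rule le_mult_Inf)
    fix s w w' assume "s \<in> strong_norm p type_space ` P" "w \<in> weak_norm p Z ` Q" and ww: "w < w'"
    then obtain y z where y: "y \<in> P" "s = strong_norm p type_space y" and z: "z \<in> Q" "w = weak_norm p Z z" by auto
    have w0: "0 \<le> w'" using Q0 z ww by force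
    have "weighted_holo_Kp_norm p U v type_space f \<le> 
        strong_norm p type_space (\<lambda>n. scaleC (complex_of_real w') (y n))"
      unfolding weighted_holo_Kp_norm_def p_compact_measure_def
    proof (rule cInf_lower, intro CollectI exI conjI refl)
      show "(\<lambda>n. scaleC (complex_of_real w') (y n)) \<in> strong_seqs p type_space"
        using y w0 p by (intro strong_seqs_scale(1)) (auto simp: P_def)
      show "weighted_range U v type_space f \<subseteq> p_conv p type_space (\<lambda>n. scaleC (complex_of_real w') (y n))"
        using conv[OF y(1) z(1)] z(2) ww by simp
    qed (auto intro!: bdd_belowI[of _ 0] simp: strong_norm_nonneg)
    also have "\<dots> = w' * s" using strong_seqs_scale(2)[of y p w'] y w0 p by (simp add: P_def)
    finally show "weighted_holo_Kp_norm p U v type_space f \<le> w' * s" .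
  qed (use ne Q0 strong_norm_nonneg in auto)
  moreover have "strong_norm p type_space ` P = {strong_norm p type_space x | x. x \<in> strong_seqs p type_space \<and> S ` unit_ball Z \<subseteq> p_conv p type_space x}"
    "weak_norm p Z ` Q = {weak_norm p Z x | x. x \<in> uncond_seqs p Z \<and> weighted_range U v Z g \<subseteq> p_conv p Z x}"
    by (auto simp: P_def Q_def)
  ultimately show "weighted_holo_Kp_norm p U v type_space f \<le> 
       p_compact_op_norm p Z type_space S * weighted_holo_Kup_norm p U v Z g"
    by (simp add: p_compact_op_norm_def p_compact_measure_def weighted_holo_Kup_norm_def uncond_p_compact_measure_def)
qed

section \<open>Cauchy estimates and summable weights\<close>

text \<open>The second bound is Taylor's formula at 0 evaluated at 1, with the second derivative
  controlled on the whole closed unit disc by Cauchy's inequality.\<close>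

lemma Cauchy_remainder_bound:
  assumes h: "h holomorphic_on ball 0 R" and C: "\<And>\<zeta>. \<zeta> \<in> ball 0 R \<Longrightarrow> cmod (h \<zeta>) \<le> C"
    and \<rho>: "0 < \<rho>" "\<rho> < R"
  shows "cmod (deriv h 0) \<le> C / \<rho>" "2 \<le> \<rho> \<Longrightarrow> cmod (h 1 - h 0 - deriv h 0) \<le> 8 * C / \<rho>\<^sup>2"
proof -
  have higher: "cmod ((deriv ^^ n) h z) \<le> fact n * C / s ^ n" if "0 < s" "cmod z + s < R" for n z s
  proof (rule Cauchy_inequality)
    have sub: "cball z s \<subseteq> ball 0 R"
    proof
      fix w assume "w \<in> cball z s"
      then show "w \<in> ball 0 R" using that norm_triangle_ineq4[of z "z - w"] by (simp add: dist_norm)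
    qed
    then show "h holomorphic_on ball z s" "continuous_on (cball z s) h"
      using h ball_subset_cball[of z s] by (meson holomorphic_on_imp_continuous_on holomorphic_on_subset subset_trans)+
    show "cmod (h x) \<le> C" if "cmod (z - x) = s" for x
      using C sub that by (force simp: dist_norm)
  qed (use that in auto)
  show "cmod (deriv h 0) \<le> C / \<rho>" using higher[of \<rho> 0 1] \<rho> by simp
  show "cmod (h 1 - h 0 - deriv h 0) \<le> 8 * C / \<rho>\<^sup>2" if \<rho>2: "2 \<le> \<rho>"
  proof -
    have C0: "0 \<le> C" using order_trans[OF norm_ge_zero C[of 0]] \<rho> by simp
    have "cmod ((deriv ^^ 0) h 1 - (\<Sum>i\<le>1. (deriv ^^ i) h 0 * (1 - 0) ^ i / fact i)) 
        \<le> (8 * C / \<rho>\<^sup>2) * cmod (1 - 0) ^ Suc 1 / fact 1"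
    proof (rule complex_Taylor[where S = "cball 0 1"])
      show "((deriv ^^ i) h has_field_derivative (deriv ^^ Suc i) h x) (at x within cball 0 1)"
        if "x \<in> cball 0 1" for i x
      proof -
        have "(deriv ^^ i) h holomorphic_on ball 0 R" by (intro holomorphic_higher_deriv h) auto
        moreover have "x \<in> ball 0 R" using that \<rho> \<rho>2 by simp
        ultimately show ?thesis
          using holomorphic_derivI[of "(deriv ^^ i) h" "ball 0 R" x] has_field_derivative_at_within by fastforce
      qed
      show "cmod ((deriv ^^ Suc 1) h x) \<le> 8 * C / \<rho>\<^sup>2" if "x \<in> cball 0 1" for x
      proof -
        \<comment> \<open>Circles of radius \<open>\<rho> - 1\<close> around points of the closed
          unit disc stay inside \<open>ball 0 R\<close>. Since \<open>\<rho> - 1\<close> is at least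
          \<open>\<rho> / 2\<close>, the factor 2 becomes 8.\<close>
        have "cmod ((deriv ^^ Suc 1) h x) \<le> fact (Suc 1) * C / (\<rho> - 1) ^ Suc 1"
          by (rule higher) (use that \<rho> \<rho>2 in auto)
        also have "\<dots> = 2 * C / (\<rho> - 1)\<^sup>2" by (simp add: power2_eq_square)
        also have "\<dots> \<le> 2 * C / (\<rho> / 2)\<^sup>2"
          using \<rho>2 C0 by (intro divide_left_mono power_mono mult_pos_pos) auto
        finally show ?thesis by (simp add: power_divide)
      qed
    qed auto
    then show ?thesis by (simp add: algebra_simps)
  qed
qed

text \<open>On the complex line through \<open>x\<close> in direction \<open>u\<close>, the map
  \<open>\<phi> \<circ> f\<close> is a scalar holomorphic function with derivative
  \<open>\<phi> (D u)\<close> at 0, and its Taylor remainder at 1 is the wanted one. The bounds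
  contain \<open>C\<close> but not \<open>K\<close>, so they are uniform over functionals of
  arbitrarily large norm.\<close>

lemma holomorphic_maps_directional_bound:
  fixes f :: "'e::complex_normed_vector \<Rightarrow> 'f::complex_normed_vector"
  assumes f: "f \<in> holomorphic_maps U type_space" and U: "ball x R \<subseteq> U" and r: "0 < r" "r < R"
    and D: "D \<in> bounded_ops type_space type_space"
      "((\<lambda>y. norm (f y - f x - D (y - x)) / norm (y - x)) \<longlongrightarrow> 0) (at x within U)"
    and \<phi>: "\<And>a b. \<phi> (a + b) = \<phi> a + \<phi> b" "\<And>c a. \<phi> (scaleC c a) = c * \<phi> a" "\<And>a. cmod (\<phi> a) \<le> K * norm a"
    and C: "\<And>y. y \<in> ball x R \<Longrightarrow> cmod (\<phi> (f y)) \<le> C"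
  shows "cmod (\<phi> (D u)) \<le> C * norm u / r"
    "2 * norm u \<le> r \<Longrightarrow> cmod (\<phi> (f (x + u) - f x - D u)) \<le> 8 * C * (norm u)\<^sup>2 / r\<^sup>2"
proof -
  have bl_op: "bounded_linear E" if E: "E \<in> bounded_ops type_space type_space" for E :: "'e \<Rightarrow> 'f"
  proof -
    obtain K where K: "\<And>z. norm (E z) \<le> K * norm z" using E by (auto simp: bounded_ops_def)
    show ?thesis
    proof (rule bounded_linear_intro[where K = K])
      show "E (r *\<^sub>R z) = r *\<^sub>R E z" for r z
        using E by (simp add: bounded_ops_def flip: scaleC_of_real)
    qed (use E K in \<open>auto simp: bounded_ops_def mult.commute\<close>)
  qed
  have bl\<phi>: "bounded_linear \<phi>"
  proof (rule bounded_linear_intro[where K = K])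
    show "\<phi> (r *\<^sub>R z) = r *\<^sub>R \<phi> z" for r z
      by (simp add: \<phi>(2) scaleR_conv_of_real flip: scaleC_of_real)
  qed (use \<phi> in \<open>auto simp: mult.commute\<close>)
  have D0: "D 0 = 0" using bl_op[OF D(1)] by (simp add: linear_simps)
  have \<phi>0: "\<phi> 0 = 0" using bl\<phi> by (simp add: linear_simps)
  have \<phi>diff: "\<phi> (a - b) = \<phi> a - \<phi> b" for a b using bl\<phi> by (simp add: linear_simps)
  have C0: "0 \<le> C" using order_trans[OF norm_ge_zero C[of x]] r by simp
  have "cmod (\<phi> (D u)) \<le> C * norm u / r \<and> 
    (2 * norm u \<le> r \<longrightarrow> cmod (\<phi> (f (x + u) - f x - D u)) \<le> 8 * C * (norm u)\<^sup>2 / r\<^sup>2)"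
  proof (cases "u = 0")
    case True
    then show ?thesis using C0 r by (simp add: D0 \<phi>0)
  next
    case False
    define h where "h \<zeta> = \<phi> (f (x + scaleC \<zeta> u))" for \<zeta>
    have mem: "x + scaleC \<zeta> u \<in> ball x R" if "\<zeta> \<in> ball 0 (R / norm u)" for \<zeta>
      using that False by (simp add: dist_norm norm_scaleC field_simps)
    have der: "(h has_field_derivative \<phi> (E u)) (at \<zeta>)" 
      if \<zeta>: "\<zeta> \<in> ball 0 (R / norm u)" and E: "E \<in> bounded_ops type_space type_space"
        "((\<lambda>y. norm (f y - f (x + scaleC \<zeta> u) - E (y - (x + scaleC \<zeta> u))) / norm (y - (x + scaleC \<zeta> u))) \<longlongrightarrow> 0) 
           (at (x + scaleC \<zeta> u) within U)" for E \<zeta>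
    proof -
      have "(f has_derivative E) (at (x + scaleC \<zeta> u) within U)"
        using E(2) bl_op[OF E(1)] by (simp add: has_derivative_iff_norm)
      then have "(f has_derivative E) (at (x + scaleC \<zeta> u) within ball x R)" by (rule has_derivative_subset[OF _ U])
      then have fd: "(f has_derivative E) (at (x + scaleC \<zeta> u))" 
        using at_within_open[OF mem[OF \<zeta>] open_ball] by simp
      have ld: "((\<lambda>\<zeta>. x + scaleC \<zeta> u) has_derivative (\<lambda>\<zeta>. scaleC \<zeta> u)) (at \<zeta>)"
        using bounded_linear_imp_has_derivative[OF bounded_linear_scaleC_left[of u]]
        by (auto intro!: derivative_eq_intros)
      have "(h has_derivative (\<lambda>t. \<phi> (E (scaleC t u)))) (at \<zeta>)"
        unfolding h_def using bounded_linear.has_derivative[OF bl\<phi> has_derivative_compose[OF ld fd]] by simp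
      moreover have "\<phi> (E (scaleC t u)) = \<phi> (E u) * t" for t
        using E(1) by (simp add: bounded_ops_def \<phi>(2) mult.commute)
      ultimately show ?thesis by (simp add: has_field_derivative_def)
    qed
    have "\<exists>E\<in>bounded_ops type_space type_space.
        ((\<lambda>y. norm (f y - f z - E (y - z)) / norm (y - z)) \<longlongrightarrow> 0) (at z within U)" if "z \<in> U" for z
      using f that by (auto simp: holomorphic_maps_def)
    then have hol: "h holomorphic_on ball 0 (R / norm u)"
      using der mem U unfolding holomorphic_on_open[OF open_ball] by blast
    have d0: "deriv h 0 = \<phi> (D u)"
      by (rule DERIV_imp_deriv, rule der) (use D r False in auto)
    have b: "cmod (h \<zeta>) \<le> C" if "\<zeta> \<in> ball 0 (R / norm u)" for \<zeta>
      using C mem[OF that] by (simp add: h_def)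
    \<comment> \<open>In the parameter of the line the radius \<open>r\<close> becomes
      \<open>r / norm u\<close>, and \<open>2 * norm u \<le> r\<close> says that this is at least
      2.\<close>
    have \<rho>: "0 < r / norm u" "r / norm u < R / norm u" using r False by (auto simp: divide_strict_right_mono)
    have 1: "cmod (\<phi> (D u)) \<le> C * norm u / r"
      using Cauchy_remainder_bound(1)[OF hol b \<rho>] by (simp add: d0)
    have 2: "cmod (\<phi> (f (x + u) - f x - D u)) \<le> 8 * C * (norm u)\<^sup>2 / r\<^sup>2" if "2 * norm u \<le> r"
    proof -
      have "cmod (h 1 - h 0 - \<phi> (D u)) \<le> 8 * C / (r / norm u)\<^sup>2"
        using Cauchy_remainder_bound(2)[OF hol b \<rho>] that False by (simp add: d0 field_simps)
      moreover have "h 1 - h 0 - \<phi> (D u) = \<phi> (f (x + u) - f x - D u)" by (simp add: h_def \<phi>diff)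
      ultimately show ?thesis by (simp add: power_divide)
    qed
    show ?thesis using 1 2 by blast
  qed
  then show "cmod (\<phi> (D u)) \<le> C * norm u / r"
    "2 * norm u \<le> r \<Longrightarrow> cmod (\<phi> (f (x + u) - f x - D u)) \<le> 8 * C * (norm u)\<^sup>2 / r\<^sup>2" by auto
qed

text \<open>A convergent positive series still converges after division by the square roots of its
  tails, by telescoping, and these roots tend to 0. A small multiple of their reciprocals, added to
  1, gives the weights.\<close>

lemma summable_weights:
  fixes s :: "nat \<Rightarrow> real"
  assumes s: "summable s" "\<And>n. 0 \<le> s n" and e: "0 < e"
  obtains w where "\<And>n. 1 \<le> w n" "incseq w" "filterlim w at_top sequentially"
    "summable (\<lambda>n. s n * w n)" "(\<Sum>n. s n * w n) \<le> (\<Sum>n. s n) + e"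
proof -
  \<comment> \<open>The geometric sequence keeps all tails strictly positive, even if
    \<open>s\<close> is eventually 0.\<close>
  define s' where "s' n = s n + (1/2)^n" for n
  have "summable s'" unfolding s'_def using s by (intro summable_add summable_geometric) auto
  moreover have "0 < s' n" "s n \<le> s' n" for n using s(2)[of n] by (auto simp: s'_def add_nonneg_pos)
  ultimately have s': "summable s'" "\<And>n. 0 < s' n" "\<And>n. s n \<le> s' n" by auto
  define r where "r n = (\<Sum>k. s' (k + n))" for n
  have sm: "summable (\<lambda>k. s' (k + n))" for n using s'(1) by (simp add: summable_iff_shift)
  have r_Suc: "r n = s' n + r (Suc n)" for n
    unfolding r_def using suminf_split_head[OF sm[of n]] by simp
  have rpos: "0 < r n" for n
    unfolding r_def using suminf_pos[OF sm] s' by blast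
  have r0: "r \<longlonglongrightarrow> 0" unfolding r_def by (rule suminf_exist_split2[OF s'(1)])
  have rle: "r (Suc n) \<le> r n" for n using r_Suc[of n] s'(2)[of n] by simp
  have tele: "s' n / sqrt (r n) \<le> 2 * (sqrt (r n) - sqrt (r (Suc n)))" for n
  proof -
    have "s' n = r n - r (Suc n)" using r_Suc[of n] by simp
    also have "\<dots> = (sqrt (r n) - sqrt (r (Suc n))) * (sqrt (r n) + sqrt (r (Suc n)))"
      using rpos[of n] rpos[of "Suc n"] by (simp add: algebra_simps)
    also have "\<dots> \<le> (sqrt (r n) - sqrt (r (Suc n))) * (2 * sqrt (r n))"
      using rle[of n] by (intro mult_left_mono) auto
    finally show ?thesis using rpos[of n] by (simp add: field_simps)
  qed
  have part: "(\<Sum>n<N. s' n / sqrt (r n)) \<le> 2 * sqrt (r 0)" for N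
  proof -
    have "(\<Sum>n<N. s' n / sqrt (r n)) \<le> (\<Sum>n<N. 2 * (sqrt (r n) - sqrt (r (Suc n))))"
      by (rule sum_mono) (rule tele)
    also have "\<dots> = 2 * (sqrt (r 0) - sqrt (r N))"
      using sum_lessThan_telescope'[of "\<lambda>n. sqrt (r n)" N] by (simp only: sum_distrib_left[symmetric])
    also have "\<dots> \<le> 2 * sqrt (r 0)" using real_sqrt_ge_zero[OF less_imp_le[OF rpos[of N]]] by simp
    finally show ?thesis .
  qed
  \<comment> \<open>Chosen so that the telescoped bound \<open>2 * sqrt (r 0)\<close> contributes
    exactly \<open>e\<close>.\<close>
  define \<eta> where "\<eta> = e / (2 * sqrt (r 0))"
  have \<eta>: "0 < \<eta>" using e rpos[of 0] by (simp add: \<eta>_def)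
  define w where "w n = 1 + \<eta> / sqrt (r n)" for n
  have sw: "s n * w n = s n + \<eta> * (s n / sqrt (r n))" for n by (simp add: w_def algebra_simps)
  have part': "(\<Sum>n<N. s n / sqrt (r n)) \<le> 2 * sqrt (r 0)" for N
    using s' rpos by (intro order_trans[OF sum_mono part]) (auto intro!: divide_right_mono simp: less_imp_le)
  have sm2: "summable (\<lambda>n. s n / sqrt (r n))"
    using s(2) rpos part' by (intro summableI_nonneg_bounded) (auto simp: less_imp_le)
  show ?thesis
  proof (rule that[of w])
    show "1 \<le> w n" for n using \<eta> rpos by (simp add: w_def less_imp_le)
    show "incseq w"
      unfolding w_def using \<eta> rle rpos 
      by (intro incseq_SucI add_left_mono divide_left_mono mult_pos_pos) (auto simp: less_imp_le)
    have "filterlim (\<lambda>n. sqrt (r n)) (at_right 0) sequentially"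
      using tendsto_real_sqrt[OF r0] rpos less_imp_neq[OF rpos, THEN not_sym] by (auto simp: filterlim_at)
    then have "filterlim (\<lambda>n. \<eta> / sqrt (r n)) at_top sequentially"
      using \<eta> filterlim_tendsto_pos_mult_at_top[OF tendsto_const \<eta>, of "\<lambda>n. inverse (sqrt (r n))"]
      by (simp add: field_class.field_divide_inverse filterlim_compose[OF filterlim_inverse_at_top_right])
    then show "filterlim w at_top sequentially"
      unfolding w_def by (intro filterlim_tendsto_add_at_top[OF tendsto_const])
    show "summable (\<lambda>n. s n * w n)"
      unfolding sw by (intro summable_add s summable_mult sm2)
    have "(\<Sum>n. s n * w n) = (\<Sum>n. s n) + \<eta> * (\<Sum>n. s n / sqrt (r n))"
      unfolding sw suminf_mult[OF sm2, symmetric] by (intro suminf_add[symmetric] s summable_mult sm2)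
    also have "\<dots> \<le> (\<Sum>n. s n) + \<eta> * (2 * sqrt (r 0))"
      using \<eta> by (intro add_left_mono mult_left_mono suminf_le_const sm2 part') auto
    also have "\<eta> * (2 * sqrt (r 0)) = e" using rpos[of 0] by (simp add: \<eta>_def)
    finally show "(\<Sum>n. s n * w n) \<le> (\<Sum>n. s n) + e" .
  qed
qed

section \<open>The quotient of the coefficient space by the kernel of a sequence\<close>

text \<open>In the application \<open>l n\<close> times \<open>y n\<close> is the given sequence, so
  that the operator it defines is \<open>T\<close> composed with \<open>damp\<close>.\<close>

locale weighted_sequence =
  fixes p :: real and y :: "nat \<Rightarrow> 'f::complex_banach" and l :: "nat \<Rightarrow> real"
  assumes p: "1 \<le> p" and y: "summable (\<lambda>n. norm (y n) powr p)"
    and l: "\<And>n. 0 \<le> l n" "\<And>n. l n \<le> 1" "decseq l" "l \<longlonglongrightarrow> 0"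
begin

abbreviation "X \<equiv> coeff_space p"

definition T :: "(nat \<Rightarrow> complex) \<Rightarrow> 'f" where
  "T a = (\<Sum>n. scaleC (a n) (y n))"

definition damp :: "(nat \<Rightarrow> complex) \<Rightarrow> nat \<Rightarrow> complex" where
  "damp a = (\<lambda>n. complex_of_real (l n) * a n)"

definition M :: "(nat \<Rightarrow> complex) set" where
  "M = {a \<in> carrier X. T a = 0}"

sublocale X: normed_cmodule X by (rule normed_cmodule_coeff[OF p])

lemma X_minus: "a \<in> carrier X \<Longrightarrow> b \<in> carrier X \<Longrightarrow> a \<ominus>\<^bsub>X\<^esub> b = (\<lambda>n. a n - b n)"
  by (simp add: a_minus_def X.smult_minus_one[symmetric])

lemma X_diff: "a \<in> carrier X \<Longrightarrow> b \<in> carrier X \<Longrightarrow> (\<lambda>n. a n - b n) \<in> carrier X"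
  using X.M.minus_closed[of a b] by (simp add: X_minus)

lemma damp_closed: "a \<in> carrier X \<Longrightarrow> damp a \<in> carrier X"
  and damp_nrm: "a \<in> carrier X \<Longrightarrow> nrm X (damp a) \<le> nrm X a"
proof -
  assume a: "a \<in> carrier X"
  have "cmod (damp a n) \<le> 1 * cmod (a n)" for n
    using l(1)[of n] l(2)[of n] by (simp add: damp_def norm_mult mult_left_le_one_le)
  from coeff_solid[OF p a _ this] show "damp a \<in> carrier X" "nrm X (damp a) \<le> nrm X a" by auto
qed

text \<open>Hoelder's inequality on a shifted block separates \<open>a\<close> from the tail of
  \<open>y\<close>, which makes the tails of the series for \<open>T\<close> uniformly small on
  bounded sets.\<close>

lemma tail_sum_bound:
  assumes a: "a \<in> carrier X"
  shows "(\<Sum>i<k. norm (scaleC (a (i + N)) (y (i + N)))) \<le> nrm X a * (\<Sum>i. norm (y (i + N)) powr p) powr (1/p)"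
proof -
  have sm: "summable (\<lambda>i. norm (y (i + N)) powr p)" using summable_ignore_initial_segment[OF y] .
  have "(\<Sum>i<k. norm (scaleC (a (i + N)) (y (i + N)))) = (\<Sum>i\<in>{N..<N+k}. cmod (a i) * norm (y i))"
    using sum.shift_bounds_nat_ivl[of "\<lambda>i. cmod (a i) * norm (y i)" 0 N k] 
    by (simp add: norm_scaleC atLeast0LessThan add.commute)
  also have "\<dots> \<le> nrm X a * (\<Sum>i\<in>{N..<N+k}. norm (y i) powr p) powr (1/p)"
    by (intro coeff_holder p a) auto
  also have "(\<Sum>i\<in>{N..<N+k}. norm (y i) powr p) = (\<Sum>i<k. norm (y (i + N)) powr p)"
    using sum.shift_bounds_nat_ivl[of "\<lambda>i. norm (y i) powr p" 0 N k] 
    by (simp add: atLeast0LessThan add.commute)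
  also have "nrm X a * \<dots> powr (1/p) \<le> nrm X a * (\<Sum>i. norm (y (i + N)) powr p) powr (1/p)"
    using X.nrm_nonneg[OF a] p 
    by (intro mult_left_mono powr_mono2 sum_le_suminf[OF sm] sum_nonneg) auto
  finally show ?thesis .
qed

lemma T_summable:
  assumes "a \<in> carrier X" shows "summable (\<lambda>n. norm (scaleC (a n) (y n)))"
  by (rule summableI_nonneg_bounded) (use tail_sum_bound[OF assms, where N = 0] in auto)

lemma T_summable': "a \<in> carrier X \<Longrightarrow> summable (\<lambda>n. scaleC (a n) (y n))"
  by (rule summable_norm_cancel[OF T_summable])

lemma T_tail_bound:
  assumes a: "a \<in> carrier X"
  shows "norm (\<Sum>i. scaleC (a (i + N)) (y (i + N))) \<le> nrm X a * (\<Sum>i. norm (y (i + N)) powr p) powr (1/p)"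
proof -
  have sm: "summable (\<lambda>i. norm (scaleC (a (i + N)) (y (i + N))))"
    using summable_ignore_initial_segment[OF T_summable[OF a]] .
  show ?thesis by (rule order_trans[OF summable_norm[OF sm] suminf_le_const[OF sm tail_sum_bound[OF a]]])
qed

lemma T_bound: "a \<in> carrier X \<Longrightarrow> norm (T a) \<le> strong_norm p type_space y * nrm X a"
  using T_tail_bound[of a 0] by (simp add: T_def strong_norm_def mult.commute)

lemma T_add: "a \<in> carrier X \<Longrightarrow> b \<in> carrier X \<Longrightarrow> T (\<lambda>n. a n + b n) = T a + T b"
  unfolding T_def scaleC_add_left by (simp add: suminf_add T_summable')

lemma T_scale: "a \<in> carrier X \<Longrightarrow> T (\<lambda>n. c * a n) = scaleC c (T a)"
  unfolding T_def by (simp add: bounded_linear.suminf[OF bounded_linear_scaleC T_summable'] scaleC_scaleC)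

lemma T_diff: "a \<in> carrier X \<Longrightarrow> b \<in> carrier X \<Longrightarrow> T (\<lambda>n. a n - b n) = T a - T b"
  using T_add[of "\<lambda>n. a n - b n" b] X_diff by simp

text \<open>On bounded sets \<open>T\<close> is sequentially continuous for coordinatewise
  convergence: beyond \<open>N\<close> the series is uniformly small, and the finitely many terms
  before \<open>N\<close> converge.\<close>

lemma T_null:
  assumes d: "\<And>k. d k \<in> carrier X" "\<And>k. nrm X (d k) \<le> C" and lim: "\<And>n. (\<lambda>k. d k n) \<longlonglongrightarrow> 0"
  shows "(\<lambda>k. T (d k)) \<longlonglongrightarrow> 0"
proof -
  define \<tau> where "\<tau> N = (\<Sum>i. norm (y (i + N)) powr p) powr (1/p)" for N
  have \<tau>0: "\<tau> \<longlonglongrightarrow> 0"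
    unfolding \<tau>_def using suminf_exist_split2[OF y] p suminf_nonneg[OF summable_ignore_initial_segment[OF y]]
    by (intro tendsto_eq_intros tendsto_powr') (auto intro!: always_eventually)
  have C0: "0 \<le> C" using order_trans[OF X.nrm_nonneg[OF d(1)] d(2)] .
  show ?thesis
  proof (rule LIMSEQ_I)
    fix e :: real assume e: "0 < e"
    \<comment> \<open>The summand 1 keeps the denominator positive when
      \<open>C = 0\<close>.\<close>
    then have "0 < e / (2 * (C + 1))" using C0 by simp
    from LIMSEQ_D[OF \<tau>0 this] obtain N where N: "\<bar>\<tau> N\<bar> < e / (2 * (C + 1))" by auto
    have \<tau>nn: "0 \<le> \<tau> N" by (simp add: \<tau>_def)
    have tail: "C * \<tau> N \<le> e/2"
    proof -
      have "C * \<tau> N \<le> (C + 1) * (e / (2 * (C + 1)))" using N C0 \<tau>nn by (intro mult_mono) auto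
      also have "\<dots> = e/2" using C0 by (simp add: field_simps)
      finally show ?thesis .
    qed
    have "(\<lambda>k. \<Sum>n<N. scaleC (d k n) (y n)) \<longlonglongrightarrow> (\<Sum>n<N. scaleC 0 (y n))"
      by (intro tendsto_intros bounded_linear.tendsto[OF bounded_linear_scaleC_left] lim)
    then have "(\<lambda>k. \<Sum>n<N. scaleC (d k n) (y n)) \<longlonglongrightarrow> 0" by simp
    from LIMSEQ_D[OF this, of "e/2"] e obtain K where K: "\<And>k. k \<ge> K \<Longrightarrow> norm (\<Sum>n<N. scaleC (d k n) (y n)) < e/2"
      by auto
    have "norm (T (d k) - 0) < e" if "k \<ge> K" for k
    proof -
      have "T (d k) = (\<Sum>i. scaleC (d k (i + N)) (y (i + N))) + (\<Sum>n<N. scaleC (d k n) (y n))"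
        unfolding T_def by (rule suminf_split_initial_segment[OF T_summable'[OF d(1)]])
      then have "norm (T (d k)) \<le> norm (\<Sum>i. scaleC (d k (i + N)) (y (i + N))) + norm (\<Sum>n<N. scaleC (d k n) (y n))"
        by (simp add: norm_triangle_ineq)
      also have "\<dots> < C * \<tau> N + e/2"
      proof (rule add_le_less_mono)
        have "norm (\<Sum>i. scaleC (d k (i + N)) (y (i + N))) \<le> nrm X (d k) * \<tau> N"
          unfolding \<tau>_def by (rule T_tail_bound[OF d(1)])
        also have "\<dots> \<le> C * \<tau> N" by (rule mult_right_mono[OF d(2) \<tau>nn])
        finally show "norm (\<Sum>i. scaleC (d k (i + N)) (y (i + N))) \<le> C * \<tau> N" .
      qed (rule K[OF that])
      finally show ?thesis using tail by simp
    qed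
    then show "\<exists>K. \<forall>k\<ge>K. norm (T (d k) - 0) < e" by blast
  qed
qed

sublocale Q: closed_submodule X M
proof (intro closed_submodule.intro closed_submodule_axioms.intro)
  show "normed_cmodule X" by (rule X.normed_cmodule_axioms)
  show "submodule M complex_ring X"
  proof (rule X.submoduleI)
    show "\<ominus>\<^bsub>X\<^esub> a \<in> M" if "a \<in> M" for a
      using that T_scale[of a "-1"] X.smult_minus_one[of a] X.smult_cl[of a "-1"] 
      by (auto simp: M_def)
    show "\<zero>\<^bsub>X\<^esub> \<in> M" using X.M.zero_closed by (simp add: M_def T_def)
    show "a \<oplus>\<^bsub>X\<^esub> b \<in> M" if "a \<in> M" "b \<in> M" for a b
      using that T_add[of a b] X.M.a_closed[of a b] by (auto simp: M_def)
    show "c \<odot>\<^bsub>X\<^esub> a \<in> M" if "a \<in> M" for c a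
      using that T_scale[of a c] X.smult_cl[of a c] by (auto simp: M_def)
  qed (auto simp: M_def)
  show "closedin (norm_topology X) M"
    unfolding norm_topology_def X.metric.closedin_metric
  proof (intro conjI allI impI)
    fix a assume a: "a \<in> carrier X - M"
    \<comment> \<open>Raising the bound of \<open>T\<close> by 1 makes it positive; within distance
      \<open>norm (T a) / Y\<close> of \<open>a\<close> the operator \<open>T\<close> cannot
      vanish.\<close>
    define Y where "Y = strong_norm p type_space y + 1"
    have Y: "Y > 0" "strong_norm p type_space y \<le> Y" using strong_norm_nonneg[of p type_space y] by (auto simp: Y_def)
    have Ta: "T a \<noteq> 0" using a by (auto simp: M_def)
    have "b \<notin> X.metric.mball a (norm (T a) / Y)" if b: "b \<in> M" for b
    proof
      assume mb: "b \<in> X.metric.mball a (norm (T a) / Y)"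
      have bX: "b \<in> carrier X" "T b = 0" using b by (auto simp: M_def)
      have "nrm X (\<lambda>n. a n - b n) < norm (T a) / Y"
        using mb a bX X_minus[of a b] by (auto simp: norm_dist_def)
      then have "Y * nrm X (\<lambda>n. a n - b n) < norm (T a)" using Y by (simp add: field_simps)
      moreover have "norm (T a) = norm (T (\<lambda>n. a n - b n))" using a bX by (simp add: T_diff)
      moreover have "norm (T (\<lambda>n. a n - b n)) \<le> strong_norm p type_space y * nrm X (\<lambda>n. a n - b n)"
        using a bX by (intro T_bound X_diff) auto
      moreover have "\<dots> \<le> Y * nrm X (\<lambda>n. a n - b n)"
        using a bX Y by (intro mult_right_mono X.nrm_nonneg X_diff) auto
      ultimately show False by linarith
    qed
    then show "\<exists>r>0. disjnt M (X.metric.mball a r)"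
      using Ta Y by (intro exI[of _ "norm (T a) / Y"]) (auto simp: disjnt_iff)
  qed (auto simp: M_def)
qed

abbreviation "Z \<equiv> quotient_module X M"
abbreviation "q a \<equiv> M +>\<^bsub>X\<^esub> a"

sublocale Z: normed_cmodule Z by (rule Q.normed_cmodule_Z)

text \<open>On cosets of the kernel the chosen representative does not matter, by
  \<open>S_q\<close>.\<close>

definition S :: "(nat \<Rightarrow> complex) set \<Rightarrow> 'f" where
  "S A = T (SOME a. a \<in> A)"

lemma S_q: assumes a: "a \<in> carrier X" shows "S (q a) = T a"
proof -
  define b where "b = (SOME b. b \<in> q a)"
  have b: "b \<in> q a" unfolding b_def using Q.q_self[OF a] by (rule someI[of "\<lambda>b. b \<in> q a"])
  have bX: "b \<in> carrier X" by (rule Q.q_subset[OF a b])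
  then have "b \<ominus>\<^bsub>X\<^esub> a \<in> M" using Q.mem_q[OF a bX] b by blast
  then have "T b = T a" unfolding M_def X_minus[OF bX a] using T_diff[OF bX a] by simp
  then show ?thesis unfolding S_def b_def[symmetric] .
qed

text \<open>The point of dividing by the kernel: lifts along \<open>S\<close> are unique, so
  identities in \<open>Z\<close> can be checked after applying \<open>S\<close>.\<close>

lemma S_inj: "inj_on S (carrier Z)"
proof (rule inj_onI)
  fix A B assume AB: "A \<in> carrier Z" "B \<in> carrier Z" "S A = S B"
  obtain a b where ab: "a \<in> carrier X" "A = q a" "b \<in> carrier X" "B = q b"
    using AB(1,2) by (auto simp: Q.carrier_Z)
  have "T a = T b" using AB(3) unfolding ab(2,4) S_q[OF ab(1)] S_q[OF ab(3)] .
  then have "a \<ominus>\<^bsub>X\<^esub> b \<in> M" 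
    unfolding M_def X_minus[OF ab(1,3)] using X_diff[OF ab(1,3)] T_diff[OF ab(1,3)] by simp
  then show "A = B" unfolding ab(2,4) Q.q_eq_iff[OF ab(1,3)] .
qed

lemma S_bounded: "S \<in> bounded_ops Z type_space"
  unfolding bounded_ops_def
proof (intro CollectI conjI ballI allI exI)
  fix A assume A: "A \<in> carrier Z"
  have Y: "0 \<le> strong_norm p type_space y" by (rule strong_norm_nonneg)
  obtain a where a: "a \<in> carrier X" "A = q a" using A by (auto simp: Q.carrier_Z)
  show "S (c \<odot>\<^bsub>Z\<^esub> A) = c \<odot>\<^bsub>type_space\<^esub> S A" for c
    using a X.smult_cl[OF a(1), of c] by (simp add: Q.Z_smult S_q T_scale)
  show "S (A \<oplus>\<^bsub>Z\<^esub> B) = S A \<oplus>\<^bsub>type_space\<^esub> S B" if "B \<in> carrier Z" for B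
  proof -
    obtain b where "b \<in> carrier X" "B = q b" using \<open>B \<in> carrier Z\<close> by (auto simp: Q.carrier_Z)
    then show ?thesis using a X.M.a_closed[of a b] by (simp add: Q.Z_add S_q T_add)
  qed
  show "nrm type_space (S A) \<le> strong_norm p type_space y * nrm Z A"
  proof (rule field_le_epsilon)
    fix e :: real assume e: "0 < e"
    define \<delta> where "\<delta> = e / (strong_norm p type_space y + 1)"
    have \<delta>: "\<delta> > 0" "strong_norm p type_space y * \<delta> \<le> e" using e Y by (auto simp: \<delta>_def field_simps)
    obtain b where b: "b \<in> carrier X" "A = q b" "nrm X b < nrm Z A + \<delta>"
      using Q.nrm_Z_lt[OF A, of "nrm Z A + \<delta>"] \<delta> by auto
    have "norm (S A) \<le> strong_norm p type_space y * nrm X b" using T_bound b by (simp add: S_q)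
    also have "\<dots> \<le> strong_norm p type_space y * (nrm Z A + \<delta>)" using b Y by (intro mult_left_mono) auto
    finally show "nrm type_space (S A) \<le> strong_norm p type_space y * nrm Z A + e" 
      using \<delta> by (simp add: distrib_left)
  qed
qed auto

text \<open>An element of the closed unit ball need not have a representative of norm at most 1,
  only one of norm below any \<open>\<delta> > 1\<close>; the excess is shifted from the
  coefficients to \<open>y\<close>.\<close>

lemma S_ball_subset:
  assumes \<delta>: "1 < \<delta>"
  shows "S ` unit_ball Z \<subseteq> p_conv p type_space (\<lambda>n. scaleC (complex_of_real \<delta>) (y n))"
proof (rule image_subsetI)
  fix A assume "A \<in> unit_ball Z"
  then have A: "A \<in> carrier Z" "nrm Z A < \<delta>" using \<delta> by (auto simp: unit_ball_def)
  obtain a where a: "a \<in> carrier X" "A = q a" "nrm X a < \<delta>"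
    using Q.nrm_Z_lt[OF A] by blast
  have b: "(\<lambda>n. complex_of_real (1/\<delta>) * a n) \<in> unit_ball X"
    using X.smult_cl[OF a(1), of "complex_of_real (1/\<delta>)"] X.nrm_smult[OF a(1), of "complex_of_real (1/\<delta>)"] a(3) \<delta>
    by (simp add: unit_ball_def norm_divide)
  have "(\<lambda>n. scaleC (a n) (y n)) sums S A"
    using a summable_sums[OF T_summable'[OF a(1)]] by (simp add: S_q T_def)
  then have "(\<lambda>n. scaleC (complex_of_real (1/\<delta>) * a n) (scaleC (complex_of_real \<delta>) (y n))) sums S A"
    using \<delta> by (simp add: scaleC_scaleC)
  then show "S A \<in> p_conv p type_space (\<lambda>n. scaleC (complex_of_real \<delta>) (y n))"
    using b by (auto simp: p_conv_type_space)
qed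

section \<open>The unconditionally p-summable sequence in the quotient\<close>

definition unit :: "nat \<Rightarrow> nat \<Rightarrow> complex" where
  "unit n = (\<lambda>i. if i = n then 1 else 0)"

definition z :: "nat \<Rightarrow> (nat \<Rightarrow> complex) set" where
  "z n = q (damp (unit n))"

lemma unit_closed: "unit n \<in> carrier X"
  by (rule coeff_finite_support[OF p, of "Suc n"]) (simp add: unit_def)

lemma finsum_damp_unit:
  "(\<Oplus>\<^bsub>Z\<^esub>n\<in>{..<N}. a n \<odot>\<^bsub>Z\<^esub> z n) = q (damp (\<lambda>i. if i < N then a i else 0))"
proof (induction N)
  case 0
  have "damp (\<lambda>i. 0) = \<zero>\<^bsub>X\<^esub>" by (simp add: damp_def)
  then show ?case by (simp add: Q.Z_zero)
next
  case (Suc N)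
  have u: "damp (unit n) \<in> carrier X" for n by (rule damp_closed[OF unit_closed])
  have zc: "a n \<odot>\<^bsub>Z\<^esub> z n \<in> carrier Z" for n using u unfolding z_def by (intro Z.smult_cl Q.q_closed)
  have c: "damp (\<lambda>i. if i < N then a i else 0) \<in> carrier X"
    by (rule damp_closed, rule coeff_finite_support[OF p, of N]) simp
  have "(\<Oplus>\<^bsub>Z\<^esub>n\<in>{..<Suc N}. a n \<odot>\<^bsub>Z\<^esub> z n) = a N \<odot>\<^bsub>Z\<^esub> z N \<oplus>\<^bsub>Z\<^esub> q (damp (\<lambda>i. if i < N then a i else 0))"
    using zc Suc.IH by (simp add: lessThan_Suc Z.M.finsum_insert)
  also have "\<dots> = q (a N \<odot>\<^bsub>X\<^esub> damp (unit N) \<oplus>\<^bsub>X\<^esub> damp (\<lambda>i. if i < N then a i else 0))"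
    using u c by (simp only: z_def Q.Z_smult Q.Z_add X.smult_cl)
  also have "a N \<odot>\<^bsub>X\<^esub> damp (unit N) \<oplus>\<^bsub>X\<^esub> damp (\<lambda>i. if i < N then a i else 0) = damp (\<lambda>i. if i < Suc N then a i else 0)"
    by (auto simp: damp_def unit_def fun_eq_iff less_Suc_eq)
  finally show ?case .
qed

lemma q_damp_p_conv:
  assumes a: "a \<in> unit_ball X"
  shows "q (damp a) \<in> p_conv p Z z"
proof -
  have aX: "a \<in> carrier X" using a by (simp add: unit_ball_def)
  have tX: "(\<lambda>i. if i < N then a i else 0) \<in> carrier X" for N
    by (rule coeff_finite_support[OF p, of N]) simp
  have lim: "limitin (norm_topology Z) (\<lambda>N. q (damp (\<lambda>i. if i < N then a i else 0))) (q (damp a)) sequentially"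
  proof (subst Z.limitin_norm_topology)
    show "q (damp (\<lambda>i. if i < N then a i else 0)) \<in> carrier Z" for N
      by (intro Q.q_closed damp_closed tX)
    show "q (damp a) \<in> carrier Z \<and> (\<lambda>N. nrm Z (q (damp (\<lambda>i. if i < N then a i else 0)) \<ominus>\<^bsub>Z\<^esub> q (damp a))) \<longlonglongrightarrow> 0"
    proof
      show "q (damp a) \<in> carrier Z" by (intro Q.q_closed damp_closed aX)
      have tr: "(\<lambda>i. if i < N then 0 else a i) \<in> carrier X" for N
        by (rule coeff_solid(1)[OF p aX, of 1]) auto
      \<comment> \<open>The difference is the coset of minus the damped tail of \<open>a\<close>,
        whose norm is at most that of the tail.\<close>
      have "nrm Z (q (damp (\<lambda>i. if i < N then a i else 0)) \<ominus>\<^bsub>Z\<^esub> q (damp a)) \<le> nrm X (\<lambda>i. if i < N then 0 else a i)" for N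
      proof -
        have "q (damp (\<lambda>i. if i < N then a i else 0)) \<ominus>\<^bsub>Z\<^esub> q (damp a) = 
            q (damp (\<lambda>i. if i < N then a i else 0)) \<oplus>\<^bsub>Z\<^esub> (- 1) \<odot>\<^bsub>Z\<^esub> q (damp a)"
          using Z.smult_minus_one[OF Q.q_closed[OF damp_closed[OF aX]]] by (simp add: a_minus_def)
        also have "\<dots> = q (damp (\<lambda>i. if i < N then a i else 0) \<oplus>\<^bsub>X\<^esub> (- 1) \<odot>\<^bsub>X\<^esub> damp a)"
          using damp_closed[OF tX] damp_closed[OF aX] by (simp only: Q.Z_smult Q.Z_add X.smult_cl)
        also have "damp (\<lambda>i. if i < N then a i else 0) \<oplus>\<^bsub>X\<^esub> (- 1) \<odot>\<^bsub>X\<^esub> damp a = 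
            (- 1) \<odot>\<^bsub>X\<^esub> damp (\<lambda>i. if i < N then 0 else a i)"
          by (auto simp: damp_def fun_eq_iff)
        also have "nrm Z (q \<dots>) \<le> nrm X \<dots>" by (intro Q.nrm_q_le X.smult_cl damp_closed tr)
        also have "\<dots> = nrm X (damp (\<lambda>i. if i < N then 0 else a i))"
          using X.nrm_smult[OF damp_closed[OF tr], of "- 1" N] by simp
        also have "\<dots> \<le> nrm X (\<lambda>i. if i < N then 0 else a i)" by (rule damp_nrm[OF tr])
        finally show ?thesis .
      qed
      then show "(\<lambda>N. nrm Z (q (damp (\<lambda>i. if i < N then a i else 0)) \<ominus>\<^bsub>Z\<^esub> q (damp a))) \<longlonglongrightarrow> 0"
        by (intro tendsto_sandwich[OF _ _ tendsto_const coeff_truncate[OF p aX]])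
          (auto intro!: always_eventually Z.nrm_nonneg Z.M.minus_closed Q.q_closed damp_closed tX aX)
    qed
  qed
  show ?thesis unfolding p_conv_def finsum_damp_unit using a lim by blast
qed

text \<open>Composed with the quotient map, \<open>\<phi>\<close> is a functional of norm at most 1
  on the coefficient space. Testing it on an extremal sequence of unit norm produces the p-norm of
  its values on the unit vectors.\<close>

lemma dual_unit_sum:
  assumes \<phi>: "\<phi> \<in> dual_ball Z"
  shows "(\<Sum>n<N. cmod (\<phi> (q (unit n))) powr p) \<le> 1"
proof -
  define t where "t n = cmod (\<phi> (q (unit n)))" for n
  obtain c where c: "\<And>i. 0 \<le> c i" "\<And>i. i \<ge> N \<Longrightarrow> c i = 0"
    "nrm X (\<lambda>i. complex_of_real (c i)) \<le> 1"
    "(\<Sum>i<N. c i * t i) = (\<Sum>i<N. t i powr p) powr (1/p)"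
    by (rule coeff_dual_attained[OF p, of t N]) (auto simp: t_def)
  \<comment> \<open>The conjugate phases make every term of the pairing nonnegative, so that nothing
    cancels.\<close>
  define b where "b i = complex_of_real (c i) * cnj (sgn (\<phi> (q (unit i))))" for i
  have cX: "(\<lambda>i. complex_of_real (c i)) \<in> carrier X"
    by (rule coeff_finite_support[OF p, of N]) (simp add: c)
  have "cmod (b i) \<le> 1 * cmod (complex_of_real (c i))" for i
    using c(1)[of i] by (simp add: b_def norm_mult norm_sgn)
  from coeff_solid[OF p cX _ this] c(3) have b: "b \<in> carrier X" "nrm X b \<le> 1" by auto
  have tr: "(\<lambda>i. if i < k then b i else 0) \<in> carrier X" for k
    by (rule coeff_finite_support[OF p, of k]) simp
  have "\<phi> (q (\<lambda>i. if i < k then b i else 0)) = (\<Sum>i<k. b i * \<phi> (q (unit i)))" for k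
  proof (induction k)
    case 0
    have "\<phi> \<zero>\<^bsub>Z\<^esub> = 0" using Z.dual_ball_linear(2)[OF \<phi> Z.M.zero_closed, of 0] by simp
    moreover have "\<zero>\<^bsub>Z\<^esub> = q (\<lambda>i. 0)" by (simp add: Q.Z_zero)
    ultimately show ?case by simp
  next
    case (Suc k)
    have "(\<lambda>i. if i < Suc k then b i else 0) = (\<lambda>i. if i < k then b i else 0) \<oplus>\<^bsub>X\<^esub> b k \<odot>\<^bsub>X\<^esub> unit k"
      by (auto simp: unit_def fun_eq_iff less_Suc_eq)
    then have "q (\<lambda>i. if i < Suc k then b i else 0) = q (\<lambda>i. if i < k then b i else 0) \<oplus>\<^bsub>Z\<^esub> b k \<odot>\<^bsub>Z\<^esub> q (unit k)"
      using tr unit_closed by (simp only: Q.Z_smult Q.Z_add X.smult_cl)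
    then show ?case using Suc.IH Q.q_closed[OF tr] Q.q_closed[OF unit_closed]
      by (simp add: Z.dual_ball_linear[OF \<phi>] Z.smult_cl)
  qed
  moreover have "(\<lambda>i. if i < N then b i else 0) = b" using c(2) by (auto simp: b_def fun_eq_iff)
  ultimately have "\<phi> (q b) = (\<Sum>i<N. b i * \<phi> (q (unit i)))" by metis
  also have "\<dots> = complex_of_real (\<Sum>i<N. c i * t i)"
  proof -
    have "cnj (sgn w) * w = complex_of_real (cmod w)" for w
      by (cases "w = 0") (auto simp: sgn_eq complex_norm_square[symmetric] power2_eq_square mult.commute field_simps)
    then show ?thesis by (simp add: b_def t_def mult.assoc)
  qed
  finally have "\<phi> (q b) = complex_of_real ((\<Sum>i<N. t i powr p) powr (1/p))" using c(4) by simp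
  moreover have "cmod (\<phi> (q b)) \<le> 1"
    using Z.dual_ball_le_nrm[OF \<phi> Q.q_closed[OF b(1)]] Q.nrm_q_le[OF b(1)] b(2) by linarith
  ultimately have "(\<Sum>i<N. t i powr p) powr (1/p) \<le> 1" by simp
  then have "((\<Sum>i<N. t i powr p) powr (1/p)) powr p \<le> 1 powr p" using p by (intro powr_mono2) auto
  then show ?thesis using p by (simp add: powr_powr sum_nonneg t_def)
qed

text \<open>As \<open>l\<close> decreases, \<open>l m\<close> dominates every factor of the tail
  from \<open>m\<close> on and can be pulled out of \<open>dual_unit_sum\<close>. Convergence of
  \<open>l\<close> to 0 then gives unconditional summability, and the case \<open>m = 0\<close>
  gives weak norm at most 1.\<close>

lemma z_tail_sum:
  assumes \<phi>: "\<phi> \<in> dual_ball Z"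
  shows "summable (\<lambda>n. cmod (\<phi> (z (n + m))) powr p)" 
    "(\<Sum>n. cmod (\<phi> (z (n + m))) powr p) powr (1/p) \<le> l m"
proof -
  have z_eq: "\<phi> (z n) = complex_of_real (l n) * \<phi> (q (unit n))" for n
  proof -
    have "damp (unit n) = complex_of_real (l n) \<odot>\<^bsub>X\<^esub> unit n" by (auto simp: damp_def unit_def fun_eq_iff)
    then have "z n = complex_of_real (l n) \<odot>\<^bsub>Z\<^esub> q (unit n)" by (simp only: z_def Q.Z_smult[OF unit_closed])
    then show ?thesis using Z.dual_ball_linear(2)[OF \<phi> Q.q_closed[OF unit_closed]] by simp
  qed
  have part: "(\<Sum>n<k. cmod (\<phi> (z (n + m))) powr p) \<le> l m powr p" for k
  proof -
    have "(\<Sum>n<k. cmod (\<phi> (z (n + m))) powr p) \<le> (\<Sum>n<k. l m powr p * cmod (\<phi> (q (unit (n + m)))) powr p)"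
    proof (rule sum_mono)
      fix n
      have "l (n + m) \<le> l m" using l(3) by (simp add: decseqD)
      then have "cmod (\<phi> (z (n + m))) \<le> l m * cmod (\<phi> (q (unit (n + m))))"
        using l(1)[of "n + m"] by (simp add: z_eq norm_mult mult_right_mono)
      then have "cmod (\<phi> (z (n + m))) powr p \<le> (l m * cmod (\<phi> (q (unit (n + m))))) powr p"
        using p by (intro powr_mono2) auto
      then show "cmod (\<phi> (z (n + m))) powr p \<le> l m powr p * cmod (\<phi> (q (unit (n + m)))) powr p"
        using l(1) by (simp add: powr_mult)
    qed
    also have "\<dots> = l m powr p * (\<Sum>n\<in>{m..<m+k}. cmod (\<phi> (q (unit n))) powr p)"
      using sum.shift_bounds_nat_ivl[of "\<lambda>n. cmod (\<phi> (q (unit n))) powr p" 0 m k]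
      by (simp add: atLeast0LessThan add.commute sum_distrib_left)
    also have "\<dots> \<le> l m powr p * (\<Sum>n<m+k. cmod (\<phi> (q (unit n))) powr p)"
      by (intro mult_left_mono sum_mono2) auto
    also have "\<dots> \<le> l m powr p * 1" by (intro mult_left_mono dual_unit_sum[OF \<phi>]) auto
    finally show ?thesis by simp
  qed
  show sm: "summable (\<lambda>n. cmod (\<phi> (z (n + m))) powr p)"
    by (rule summableI_nonneg_bounded[OF _ part]) simp
  have "(\<Sum>n. cmod (\<phi> (z (n + m))) powr p) powr (1/p) \<le> (l m powr p) powr (1/p)"
    using p by (intro powr_mono2 suminf_le_const[OF sm part] suminf_nonneg[OF sm]) auto
  then show "(\<Sum>n. cmod (\<phi> (z (n + m))) powr p) powr (1/p) \<le> l m" using p l(1) by (simp add: powr_powr)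
qed

lemma z_weak: "(\<lambda>n. z (n + m)) \<in> weak_seqs p Z" "weak_norm p Z (\<lambda>n. z (n + m)) \<le> l m"
proof -
  have "z n \<in> carrier Z" for n unfolding z_def by (intro Q.q_closed damp_closed unit_closed)
  then show "(\<lambda>n. z (n + m)) \<in> weak_seqs p Z" 
    unfolding weak_seqs_def using z_tail_sum by (auto intro!: bdd_aboveI2[of _ _ "l m"])
  show "weak_norm p Z (\<lambda>n. z (n + m)) \<le> l m"
    unfolding weak_norm_def using z_tail_sum(2) Z.zero_dual_ball by (intro cSUP_least) auto
qed

lemma z_uncond: "z \<in> uncond_seqs p Z" "weak_norm p Z z \<le> 1"
proof -
  have "(\<lambda>m. weak_norm p Z (\<lambda>n. z (n + m))) \<longlonglongrightarrow> 0"
    using z_weak Z.weak_norm_nonneg[OF z_weak(1)]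
    by (intro tendsto_sandwich[OF _ _ tendsto_const l(4)]) auto
  then show "z \<in> uncond_seqs p Z" using z_weak(1)[of 0] by (simp add: uncond_seqs_def)
  show "weak_norm p Z z \<le> 1" using order_trans[OF z_weak(2)[of 0] l(2)] by simp
qed

end

section \<open>Exact preimages from the Hahn--Banach theorem\<close>

context weighted_sequence
begin

text \<open>Functionals in the unit ball of the dual of the range of \<open>T \<circ> damp\<close> with its quotient norm.\<close>

definition test_functional :: "('f \<Rightarrow> complex) \<Rightarrow> bool" where
  "test_functional \<phi> \<longleftrightarrow> (\<forall>a b. \<phi> (a + b) = \<phi> a + \<phi> b) \<and> (\<forall>c a. \<phi> (scaleC c a) = c * \<phi> a) \<and>
     (\<exists>K. \<forall>a. cmod (\<phi> a) \<le> K * norm a) \<and> (\<forall>a\<in>carrier X. cmod (\<phi> (T (damp a))) \<le> nrm X a)"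

text \<open>The infimal convolution of the quotient norm on the range of
  \<open>T \<circ> damp\<close> with \<open>L\<close> times the norm. It is finite everywhere and
  dominated by \<open>L\<close> times the norm, so functionals below it are bounded; large
  \<open>L\<close> punishes the distance to the range.\<close>

definition penalty :: "real \<Rightarrow> 'f \<Rightarrow> real" where
  "penalty L x = (INF a\<in>carrier X. nrm X a + L * norm (x - T (damp a)))"

lemma T_damp_add: "a \<in> carrier X \<Longrightarrow> b \<in> carrier X \<Longrightarrow> T (damp (\<lambda>n. a n + b n)) = T (damp a) + T (damp b)"
  using T_add[OF damp_closed damp_closed, of a b] by (simp add: damp_def algebra_simps)

lemma T_damp_scale: "a \<in> carrier X \<Longrightarrow> T (damp (\<lambda>n. c * a n)) = scaleC c (T (damp a))"
  using T_scale[OF damp_closed, of a c] by (simp add: damp_def algebra_simps)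

lemma zero_X: "(\<lambda>n. 0) \<in> carrier X"
  using X.M.zero_closed by simp

lemma T_damp_zero: "T (damp (\<lambda>n. 0)) = 0"
  using T_damp_scale[OF zero_X, of 0] by simp

lemma penalty_le:
  assumes "0 \<le> L" "a \<in> carrier X"
  shows "penalty L x \<le> nrm X a + L * norm (x - T (damp a))"
  unfolding penalty_def
  by (rule cINF_lower) (use assms X.nrm_nonneg in \<open>auto intro!: bdd_belowI2[of _ 0]\<close>)

lemma penalty_ge:
  assumes "\<And>a. a \<in> carrier X \<Longrightarrow> m \<le> nrm X a + L * norm (x - T (damp a))" shows "m \<le> penalty L x"
  unfolding penalty_def by (rule cINF_greatest) (use assms zero_X in auto)

lemma penalty_seminorm:
  assumes L: "0 \<le> L" shows "ts.seminorm (penalty L)"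
proof -
  have nn: "0 \<le> penalty L x" for x
    by (rule penalty_ge) (use L X.nrm_nonneg in auto)
  have add: "penalty L (x + w) \<le> penalty L x + penalty L w" for x w
  proof -
    have *: "penalty L (x + w) \<le> (nrm X a + L * norm (x - T (damp a))) + (nrm X b + L * norm (w - T (damp b)))"
      if ab: "a \<in> carrier X" "b \<in> carrier X" for a b
    proof -
      have abX: "(\<lambda>n. a n + b n) \<in> carrier X" using X.M.a_closed[OF ab] by simp
      have "penalty L (x + w) \<le> nrm X (\<lambda>n. a n + b n) + L * norm (x + w - T (damp (\<lambda>n. a n + b n)))"
        by (rule penalty_le[OF L abX])
      also have "nrm X (\<lambda>n. a n + b n) \<le> nrm X a + nrm X b" using X.nrm_add[OF ab] by simp
      also have "x + w - T (damp (\<lambda>n. a n + b n)) = (x - T (damp a)) + (w - T (damp b))"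
        by (simp add: T_damp_add[OF ab])
      also have "L * norm \<dots> \<le> L * (norm (x - T (damp a)) + norm (w - T (damp b)))"
        by (intro mult_left_mono norm_triangle_ineq L)
      finally show ?thesis by (simp add: algebra_simps)
    qed
    have "penalty L (x + w) - penalty L w \<le> penalty L x"
    proof (rule penalty_ge)
      fix a assume a: "a \<in> carrier X"
      have "penalty L (x + w) - (nrm X a + L * norm (x - T (damp a))) \<le> penalty L w"
        by (rule penalty_ge) (use *[OF a] in \<open>simp add: algebra_simps\<close>)
      then show "penalty L (x + w) - penalty L w \<le> nrm X a + L * norm (x - T (damp a))" by simp
    qed
    then show ?thesis by simp
  qed
  have zero: "penalty L 0 = 0"
    using penalty_le[OF L zero_X, of 0] nn[of 0] X.nrm_zero by (simp add: T_damp_zero)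
  have le: "penalty L (scaleC c x) \<le> cmod c * penalty L x" for c x
  proof (cases "c = 0")
    case True then show ?thesis by (simp add: zero)
  next
    case False
    have "penalty L (scaleC c x) / cmod c \<le> penalty L x"
    proof (rule penalty_ge)
      fix a assume a: "a \<in> carrier X"
      have cX: "(\<lambda>n. c * a n) \<in> carrier X" using X.smult_cl[OF a, of c] by simp
      have "scaleC c x - T (damp (\<lambda>n. c * a n)) = scaleC c (x - T (damp a))"
        using scaleC_add_right[of c "x - T (damp a)" "T (damp a)"] by (simp add: T_damp_scale[OF a])
      then have "penalty L (scaleC c x) \<le> cmod c * nrm X a + L * (cmod c * norm (x - T (damp a)))"
        using penalty_le[OF L cX, of "scaleC c x"] X.nrm_smult[OF a, of c] by (simp add: norm_scaleC)
      then show "penalty L (scaleC c x) / cmod c \<le> nrm X a + L * norm (x - T (damp a))"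
        using False by (simp add: field_simps)
    qed
    then show ?thesis using False by (simp add: field_simps)
  qed
  have "penalty L (scaleC c x) = cmod c * penalty L x" for c x
  proof (cases "c = 0")
    case True then show ?thesis by (simp add: zero)
  next
    case False
    have "cmod c * penalty L x \<le> penalty L (scaleC c x)"
      using le[of "1/c" "scaleC c x"] False by (simp add: scaleC_scaleC norm_divide field_simps)
    then show ?thesis using le[of c x] by simp
  qed
  then show ?thesis using add by (simp add: ts.seminorm_def)
qed

text \<open>A norming functional of \<open>penalty L\<close> at \<open>w\<close> is a test
  functional: the competitor 0 bounds it by \<open>L\<close> times the norm, and at
  \<open>T (damp a)\<close> the competitor \<open>a\<close> bounds it by
  \<open>nrm X a\<close>.\<close>

lemma penalty_bound:
  assumes w: "\<And>\<phi>. test_functional \<phi> \<Longrightarrow> cmod (\<phi> w) \<le> c" and L: "0 \<le> L"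
  shows "penalty L w \<le> c"
proof -
  obtain \<phi> where \<phi>: "\<forall>x\<in>carrier type_space. \<forall>y\<in>carrier type_space. \<phi> (x \<oplus>\<^bsub>type_space\<^esub> y) = \<phi> x + \<phi> (y::'f)"
    "\<forall>c. \<forall>x\<in>carrier type_space. \<phi> (c \<odot>\<^bsub>type_space\<^esub> x) = c * \<phi> x"
    "\<forall>x\<in>carrier type_space. cmod (\<phi> x) \<le> penalty L x" "\<phi> w = complex_of_real (penalty L w)"
    by (rule ts.hahn_banach[OF penalty_seminorm[OF L], of w]) auto
  have "cmod (\<phi> x) \<le> L * norm x" for x
    using \<phi>(3) penalty_le[OF L zero_X, of x] X.nrm_zero by (auto simp: T_damp_zero intro: order_trans)
  moreover have "cmod (\<phi> (T (damp a))) \<le> nrm X a" if "a \<in> carrier X" for a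
    using \<phi>(3) penalty_le[OF L that, of "T (damp a)"] by (auto intro: order_trans)
  ultimately have "test_functional \<phi>" using \<phi>(1,2) unfolding test_functional_def by auto
  from w[OF this] show ?thesis using \<phi>(4) by simp
qed

text \<open>Hahn--Banach only gives approximate preimages of \<open>w\<close> under \<open>T \<circ> damp\<close>; as \<open>damp\<close> maps bounded
  sequences to relatively compact ones, a coordinatewise limit of them is an exact preimage.\<close>

lemma S_preimage:
  assumes w: "\<And>\<phi>. test_functional \<phi> \<Longrightarrow> cmod (\<phi> w) \<le> c" and c: "0 < c"
  obtains A where "A \<in> carrier Z" "S A = w" "nrm Z A \<le> 2 * c"
proof -
  \<comment> \<open>Doubling \<open>c\<close> creates the strict inequality needed to pick a
    competitor in the infimum, and the growing factor \<open>Suc k\<close> drives the defect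
    \<open>w - T (damp a)\<close> to 0.\<close>
  have "\<exists>a\<in>carrier X. nrm X a + real (Suc k) * norm (w - T (damp a)) < 2 * c" for k
  proof -
    have "penalty (real (Suc k)) w \<le> c" by (rule penalty_bound[OF w]) auto
    then have "penalty (real (Suc k)) w < 2 * c" using c by simp
    moreover have "bdd_below ((\<lambda>a. nrm X a + real (Suc k) * norm (w - T (damp a))) ` carrier X)"
      using X.nrm_nonneg by (auto intro!: bdd_belowI2[of _ 0])
    ultimately show ?thesis unfolding penalty_def using zero_X by (subst (asm) cINF_less_iff) auto
  qed
  then obtain a where a: "\<And>k. a k \<in> carrier X" 
    and a2c: "\<And>k. nrm X (a k) + real (Suc k) * norm (w - T (damp (a k))) < 2 * c" by metis
  have an: "nrm X (a k) \<le> 2 * c" for k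
  proof -
    have "0 \<le> real (Suc k) * norm (w - T (damp (a k)))" by simp
    then show ?thesis using a2c[of k] by linarith
  qed
  have aw: "norm (w - T (damp (a k))) \<le> (2 * c) / real (Suc k)" for k
    using a2c[of k] X.nrm_nonneg[OF a, of k] by (simp add: field_simps del: of_nat_Suc)
  have "cmod (a k n) \<le> 2 * c" for k n using order_trans[OF coeff_le_nrm[OF p a] an] .
  then obtain b r where r: "strict_mono r" and lim: "\<And>n. (\<lambda>k. a (r k) n) \<longlonglongrightarrow> b n"
    using pointwise_bounded_subsequence[of a "2 * c"] by metis
  \<comment> \<open>For \<open>p = 1\<close> only the damped limit is known to lie in the
    coefficient space; \<open>b\<close> itself may fail to.\<close>
  have b: "damp b \<in> carrier X" "nrm X (damp b) \<le> 2 * c"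
    unfolding damp_def by (rule coeff_fatou[OF p a an lim l(4,1,2)])+
  \<comment> \<open>Bounded by \<open>4 * c\<close>, the sum of two bounds \<open>2 * c\<close>, and
    coordinatewise null, so that \<open>T_null\<close> applies.\<close>
  define d where "d k = (\<lambda>n. damp (a (r k)) n - damp b n)" for k
  have dX: "d k \<in> carrier X" for k unfolding d_def by (intro X_diff damp_closed a b)
  have dn: "nrm X (d k) \<le> 4 * c" for k
  proof -
    have "nrm X (damp (a (r k)) \<oplus>\<^bsub>X\<^esub> (- 1) \<odot>\<^bsub>X\<^esub> damp b) \<le> 
        nrm X (damp (a (r k))) + nrm X ((- 1) \<odot>\<^bsub>X\<^esub> damp b)"
      by (intro X.nrm_add damp_closed a X.smult_cl b)
    moreover have "nrm X ((- 1) \<odot>\<^bsub>X\<^esub> damp b) = nrm X (damp b)" unfolding X.nrm_smult[OF b(1)] by simp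
    moreover have "damp (a (r k)) \<oplus>\<^bsub>X\<^esub> (- 1) \<odot>\<^bsub>X\<^esub> damp b = d k" by (simp add: d_def)
    ultimately show ?thesis using order_trans[OF damp_nrm[OF a] an, of "r k"] b(2) by simp
  qed
  have "(\<lambda>k. d k n) \<longlonglongrightarrow> 0" for n
    unfolding d_def damp_def using lim[of n] by (auto intro!: tendsto_eq_intros)
  from T_null[OF dX dn this] have "(\<lambda>k. T (damp (a (r k))) - T (damp b)) \<longlonglongrightarrow> 0"
    by (simp add: d_def T_diff damp_closed a b)
  then have 1: "(\<lambda>k. T (damp (a (r k)))) \<longlonglongrightarrow> T (damp b)" by (simp add: LIM_zero_iff)
  have "(\<lambda>k. w - T (damp (a k))) \<longlonglongrightarrow> 0"
  proof (rule Lim_null_comparison)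
    show "(\<lambda>k. (2 * c) / real (Suc k)) \<longlonglongrightarrow> 0" by (rule LIMSEQ_Suc[OF lim_const_over_n])
  qed (use aw in auto)
  then have "(\<lambda>k. T (damp (a k))) \<longlonglongrightarrow> w" 
    using tendsto_diff[OF tendsto_const[of w], of "\<lambda>k. w - T (damp (a k))" 0] by simp
  then have "(\<lambda>k. T (damp (a (r k)))) \<longlonglongrightarrow> w" using LIMSEQ_subseq_LIMSEQ[OF _ r] by (auto simp: o_def)
  with 1 have "T (damp b) = w" by (rule LIMSEQ_unique)
  then show ?thesis 
    using that[of "q (damp b)"] Q.q_closed[OF b(1)] S_q[OF b(1)] Q.nrm_q_le[OF b(1)] b(2) by simp
qed

lemma S_add: "A \<in> carrier Z \<Longrightarrow> B \<in> carrier Z \<Longrightarrow> S (A \<oplus>\<^bsub>Z\<^esub> B) = S A + S B"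
  and S_scale: "A \<in> carrier Z \<Longrightarrow> S (c \<odot>\<^bsub>Z\<^esub> A) = scaleC c (S A)"
  using S_bounded by (auto simp: bounded_ops_def)

lemma S_minus: "A \<in> carrier Z \<Longrightarrow> B \<in> carrier Z \<Longrightarrow> S (A \<ominus>\<^bsub>Z\<^esub> B) = S A - S B"
  using S_add[of A "(- 1) \<odot>\<^bsub>Z\<^esub> B"] S_scale[of B "- 1"] Z.smult_cl[of B "- 1"]
  by (simp add: a_minus_def Z.smult_minus_one scaleC_minus_one)

end

section \<open>Holomorphy of the lift and the main theorem\<close>

context weighted_sequence
begin

lemma lift_holomorphic:
  fixes U :: "'e::complex_banach set" and f :: "'e \<Rightarrow> 'f"
  assumes U: "open U" and v: "weight_on U v" and f: "f \<in> holomorphic_maps U type_space"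
    and bound: "\<And>x \<phi>. x \<in> U \<Longrightarrow> test_functional \<phi> \<Longrightarrow> v x * cmod (\<phi> (f x)) \<le> 1"
    and g: "\<And>x. x \<in> U \<Longrightarrow> g x \<in> carrier Z" "\<And>x. x \<in> U \<Longrightarrow> S (g x) = f x"
  shows "g \<in> holomorphic_maps U Z"
proof -
  have "\<exists>E\<in>bounded_ops type_space Z.
     ((\<lambda>y. nrm Z ((g y \<ominus>\<^bsub>Z\<^esub> g x) \<ominus>\<^bsub>Z\<^esub> E (y - x)) / norm (y - x)) \<longlongrightarrow> 0) (at x within U)"
    if x: "x \<in> U" for x
  proof -
    obtain D where D: "D \<in> bounded_ops type_space type_space"
      "((\<lambda>y. norm (f y - f x - D (y - x)) / norm (y - x)) \<longlongrightarrow> 0) (at x within U)"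
      using f x by (auto simp: holomorphic_maps_def)
    have vx: "0 < v x" using v x by (simp add: weight_on_def)
    have "isCont v x" using v U x by (auto simp: weight_on_def continuous_on_eq_continuous_at)
    then obtain d where d: "d > 0" "\<And>y. dist y x < d \<Longrightarrow> dist (v y) (v x) < v x / 2"
      using vx unfolding continuous_at_eps_delta by (metis half_gt_zero)
    obtain e where e: "e > 0" "ball x e \<subseteq> U" using U x openE by blast
    define R where "R = min d e"
    \<comment> \<open>Near \<open>x\<close> the weight stays above \<open>v x / 2\<close>, so
      \<open>bound\<close> limits every test functional along \<open>f\<close> by this
      constant.\<close>
    define C where "C = 2 / v x"
    define r where "r = R / 2"
    have R: "R > 0" "ball x R \<subseteq> U" using d e by (auto simp: R_def)
    have r: "0 < r" "r < R" using R by (auto simp: r_def)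
    have C: "0 < C" using vx by (simp add: C_def)
    have bd: "cmod (\<phi> (f y)) \<le> C" if y: "y \<in> ball x R" and \<phi>: "test_functional \<phi>" for y \<phi>
    proof -
      have "v x / 2 \<le> v y" using d(2)[of y] y by (simp add: R_def dist_real_def dist_commute abs_if split: if_splits)
      then have "v x / 2 * cmod (\<phi> (f y)) \<le> v y * cmod (\<phi> (f y))" by (intro mult_right_mono) auto
      also have "\<dots> \<le> 1" using bound \<phi> y R by blast
      finally show ?thesis using vx by (simp add: C_def field_simps)
    qed
    have test: "cmod (\<phi> (D u)) \<le> C * norm u / r"
      "2 * norm u \<le> r \<Longrightarrow> cmod (\<phi> (f (x + u) - f x - D u)) \<le> 8 * C * (norm u)\<^sup>2 / r\<^sup>2"
      if \<phi>: "test_functional \<phi>" for u \<phi>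
    proof -
      obtain K where K: "\<And>a. cmod (\<phi> a) \<le> K * norm a" using \<phi> unfolding test_functional_def by blast
      have lin: "\<phi> (a + b) = \<phi> a + \<phi> b" "\<phi> (scaleC c a) = c * \<phi> a" for a b c
        using \<phi> unfolding test_functional_def by auto
      note * = holomorphic_maps_directional_bound[OF f R(2) r D lin K bd[OF _ \<phi>]]
      show "cmod (\<phi> (D u)) \<le> C * norm u / r" by (rule *(1))
      show "cmod (\<phi> (f (x + u) - f x - D u)) \<le> 8 * C * (norm u)\<^sup>2 / r\<^sup>2" if "2 * norm u \<le> r"
        by (rule *(2)[OF _ that])
    qed
    have D0: "D 0 = 0" using D(1) scaleC_zero(1)[of "D 0"] scaleC_zero(2)[of 0, where ?'a = 'e] 
      by (auto simp: bounded_ops_def dest!: spec[of _ 0])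
    \<comment> \<open>\<open>S_preimage\<close> asks for a positive bound, so \<open>u = 0\<close>
      is treated separately.\<close>
    have "\<exists>A\<in>carrier Z. S A = D u \<and> nrm Z A \<le> (2 * C / r) * norm u" for u
    proof (cases "u = 0")
      case True
      have "S \<zero>\<^bsub>Z\<^esub> = 0" using S_scale[OF Z.M.zero_closed, of 0] by simp
      then show ?thesis using True D0 Z.nrm_zero by (intro bexI[of _ "\<zero>\<^bsub>Z\<^esub>"]) auto
    next
      case False
      then have "0 < C * norm u / r" using C r by simp
      from test(1) this show ?thesis by (rule S_preimage) (auto simp: field_simps)
    qed
    then obtain E where E: "\<And>u. E u \<in> carrier Z" "\<And>u. S (E u) = D u" "\<And>u. nrm Z (E u) \<le> (2 * C / r) * norm u"
      by metis
    have EB: "E \<in> bounded_ops type_space Z"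
      unfolding bounded_ops_def
    proof (intro CollectI conjI ballI allI exI)
      \<comment> \<open>The preimages were chosen separately for each vector; linearity is inherited
        from \<open>D\<close> through the injectivity of \<open>S\<close>.\<close>
      show "E (a \<oplus>\<^bsub>type_space\<^esub> b) = E a \<oplus>\<^bsub>Z\<^esub> E b" for a b
        by (rule inj_onD[OF S_inj]) (use E D(1) in \<open>auto simp: S_add bounded_ops_def intro!: Z.M.a_closed\<close>)
      show "E (c \<odot>\<^bsub>type_space\<^esub> a) = c \<odot>\<^bsub>Z\<^esub> E a" for c a
        by (rule inj_onD[OF S_inj]) (use E D(1) in \<open>auto simp: S_scale bounded_ops_def intro!: Z.smult_cl\<close>)
      show "nrm Z (E u) \<le> (2 * C / r) * nrm type_space u" for u using E(3) by simp
    qed (use E in auto)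
    have rem: "nrm Z ((g y \<ominus>\<^bsub>Z\<^esub> g x) \<ominus>\<^bsub>Z\<^esub> E (y - x)) / norm (y - x) \<le> (16 * C / r\<^sup>2) * norm (y - x)"
      if y: "y \<in> U" "y \<noteq> x" "2 * norm (y - x) \<le> r" for y
    proof -
      define A where "A = (g y \<ominus>\<^bsub>Z\<^esub> g x) \<ominus>\<^bsub>Z\<^esub> E (y - x)"
      have A: "A \<in> carrier Z" unfolding A_def by (intro Z.M.minus_closed g E x y)
      have SA: "S A = f y - f x - D (y - x)"
        unfolding A_def by (simp add: S_minus Z.M.minus_closed g E x y)
      have pos: "0 < 8 * C * (norm (y - x))\<^sup>2 / r\<^sup>2" using C r y by simp
      have "cmod (\<phi> (f y - f x - D (y - x))) \<le> 8 * C * (norm (y - x))\<^sup>2 / r\<^sup>2" if "test_functional \<phi>" for \<phi>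
        using test(2)[OF that y(3)] by simp
      then obtain B where B: "B \<in> carrier Z" "S B = f y - f x - D (y - x)" 
        "nrm Z B \<le> 2 * (8 * C * (norm (y - x))\<^sup>2 / r\<^sup>2)" using pos by (rule S_preimage)
      \<comment> \<open>The remainder of \<open>g\<close> is itself a preimage of the remainder of
        \<open>f\<close>, hence equal to the small one. The constant 16 is 8 from the Cauchy
        estimate times 2 from \<open>S_preimage\<close>.\<close>
      have "A = B" by (rule inj_onD[OF S_inj _ A B(1)]) (simp add: SA B)
      then have "nrm Z A \<le> (16 * C / r\<^sup>2) * norm (y - x) * norm (y - x)"
        using B(3) by (simp add: power2_eq_square)
      then show ?thesis unfolding A_def[symmetric] using y(2) by (simp add: divide_le_eq)
    qed
    have ev: "\<forall>\<^sub>F y in at x within U. y \<in> U \<and> y \<noteq> x \<and> 2 * norm (y - x) \<le> r"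
      unfolding eventually_at using r by (intro exI[of _ "r/2"]) (auto simp: dist_norm)
    have "((\<lambda>y. nrm Z ((g y \<ominus>\<^bsub>Z\<^esub> g x) \<ominus>\<^bsub>Z\<^esub> E (y - x)) / norm (y - x)) \<longlongrightarrow> 0) (at x within U)"
    proof (rule tendsto_sandwich[OF _ _ tendsto_const])
      show "\<forall>\<^sub>F y in at x within U. 0 \<le> nrm Z ((g y \<ominus>\<^bsub>Z\<^esub> g x) \<ominus>\<^bsub>Z\<^esub> E (y - x)) / norm (y - x)"
        using ev by eventually_elim (intro divide_nonneg_nonneg Z.nrm_nonneg Z.M.minus_closed g E x; auto)
      show "\<forall>\<^sub>F y in at x within U. nrm Z ((g y \<ominus>\<^bsub>Z\<^esub> g x) \<ominus>\<^bsub>Z\<^esub> E (y - x)) / norm (y - x) \<le> (16 * C / r\<^sup>2) * norm (y - x)"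
        using ev by eventually_elim (rule rem; auto)
      show "((\<lambda>y. (16 * C / r\<^sup>2) * norm (y - x)) \<longlongrightarrow> 0) (at x within U)"
        using r(1) by (auto intro!: tendsto_eq_intros)
    qed
    with EB show ?thesis by blast
  qed
  then show ?thesis using g(1) by (auto simp: holomorphic_maps_def)
qed

lemma Kp_factorization_exists:
  fixes U :: "'e::complex_banach set" and f :: "'e \<Rightarrow> 'f"
  assumes U: "open U" and v: "weight_on U v" and f: "f \<in> weighted_holo U v type_space"
    and range: "weighted_range U v type_space f \<subseteq> (\<lambda>a. T (damp a)) ` unit_ball X"
  obtains g where "Kp_factorization p U v type_space f Z S g" "weighted_holo_Kup_norm p U v Z g \<le> 1"
proof -
  have "\<exists>a\<in>unit_ball X. scaleC (complex_of_real (v x)) (f x) = T (damp a)" if "x \<in> U" for x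
    using range that by (auto simp: weighted_range_def)
  then obtain \<alpha> where \<alpha>: "\<And>x. x \<in> U \<Longrightarrow> \<alpha> x \<in> unit_ball X"
    "\<And>x. x \<in> U \<Longrightarrow> scaleC (complex_of_real (v x)) (f x) = T (damp (\<alpha> x))" by metis
  have \<alpha>X: "\<alpha> x \<in> carrier X" "nrm X (\<alpha> x) \<le> 1" if "x \<in> U" for x
    using \<alpha>(1)[OF that] by (auto simp: unit_ball_def)
  have v0: "0 < v x" if "x \<in> U" for x using v that by (simp add: weight_on_def)
  define g where "g x = complex_of_real (1 / v x) \<odot>\<^bsub>Z\<^esub> q (damp (\<alpha> x))" for x
  have qZ: "q (damp (\<alpha> x)) \<in> carrier Z" if "x \<in> U" for x
    by (intro Q.q_closed damp_closed \<alpha>X that)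
  have gZ: "g x \<in> carrier Z" if "x \<in> U" for x
    unfolding g_def by (intro Z.smult_cl qZ that)
  have Sg: "S (g x) = f x" if "x \<in> U" for x
  proof -
    have "S (g x) = scaleC (complex_of_real (1 / v x)) (scaleC (complex_of_real (v x)) (f x))"
      unfolding g_def S_scale[OF qZ[OF that]] S_q[OF damp_closed[OF \<alpha>X(1)[OF that]]] \<alpha>(2)[OF that] ..
    then show ?thesis using v0[OF that] by (simp add: scaleC_scaleC)
  qed
  have vg: "complex_of_real (v x) \<odot>\<^bsub>Z\<^esub> g x = q (damp (\<alpha> x))" if "x \<in> U" for x
    unfolding g_def Z.smult_smult[OF qZ[OF that]] using v0[OF that] qZ[OF that] by simp
  have holo: "g \<in> holomorphic_maps U Z"
  proof (rule lift_holomorphic[OF U v _ _ gZ Sg])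
    show "f \<in> holomorphic_maps U type_space" using f by (simp add: weighted_holo_def)
    show "v x * cmod (\<phi> (f x)) \<le> 1" if "x \<in> U" "test_functional \<phi>" for x \<phi>
    proof -
      \<comment> \<open>A test functional sees \<open>v x\<close> times \<open>f x\<close> as the
        image of \<open>\<alpha> x\<close>, which has norm at most 1.\<close>
      have "v x * cmod (\<phi> (f x)) = cmod (\<phi> (T (damp (\<alpha> x))))"
        using that(2) v0[OF that(1)] by (simp add: test_functional_def norm_mult flip: \<alpha>(2)[OF that(1)])
      also have "\<dots> \<le> nrm X (\<alpha> x)" using that \<alpha>X by (auto simp: test_functional_def)
      finally show ?thesis using \<alpha>X(2)[OF that(1)] by simp
    qed
  qed
  have "v x * nrm Z (g x) \<le> 1" if x: "x \<in> U" for x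
  proof -
    have "v x * nrm Z (g x) = nrm Z (q (damp (\<alpha> x)))"
      using Z.nrm_smult[OF gZ[OF x], of "complex_of_real (v x)"] v0[OF x] by (simp add: vg[OF x])
    also have "\<dots> \<le> nrm X (damp (\<alpha> x))" by (intro Q.nrm_q_le damp_closed \<alpha>X x)
    also have "\<dots> \<le> nrm X (\<alpha> x)" by (intro damp_nrm \<alpha>X x)
    finally show ?thesis using \<alpha>X(2)[OF x] by simp
  qed
  then have gw: "g \<in> weighted_holo U v Z" using holo by (auto simp: weighted_holo_def intro!: bdd_aboveI2[of _ _ 1])
  have rg: "weighted_range U v Z g \<subseteq> p_conv p Z z"
    unfolding weighted_range_def using vg q_damp_p_conv[OF \<alpha>(1)] by auto
  have rgZ: "weighted_range U v Z g \<subseteq> carrier Z"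
    unfolding weighted_range_def using vg qZ by auto
  have gK: "g \<in> weighted_holo_Kup p U v Z"
    using gw rg rgZ z_uncond(1) by (auto simp: weighted_holo_Kup_def rel_uncond_p_compact_def)
  have ZQ: "Z \<in> quotient_spaces X"
    using Q.submod Q.closed by (auto simp: quotient_spaces_def)
  \<comment> \<open>Any factor above 1 suffices for membership; the sharp bound on the norm is
    \<open>op_norm_S_le\<close>.\<close>
  have "(\<lambda>n. scaleC (complex_of_real 2) (y n)) \<in> strong_seqs p type_space"
    by (rule strong_seqs_scale(1)) (use y p in \<open>auto simp: strong_seqs_type_space\<close>)
  moreover have "S ` unit_ball Z \<subseteq> p_conv p type_space (\<lambda>n. scaleC (complex_of_real 2) (y n))"
    by (rule S_ball_subset) simp
  ultimately have SK: "S \<in> p_compact_ops p Z type_space"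
    using S_bounded by (auto simp: p_compact_ops_def rel_p_compact_def)
  have "weighted_holo_Kup_norm p U v Z g \<le> weak_norm p Z z"
    unfolding weighted_holo_Kup_norm_def uncond_p_compact_measure_def
    by (rule cInf_lower) (use z_uncond(1) rg Z.weak_norm_nonneg in \<open>auto simp: uncond_seqs_def intro!: bdd_belowI[of _ 0]\<close>)
  then have "weighted_holo_Kup_norm p U v Z g \<le> 1" using z_uncond(2) by simp
  moreover have "Kp_factorization p U v type_space f Z S g"
    using ZQ SK gK Sg by (simp add: Kp_factorization_def)
  ultimately show ?thesis using that by blast
qed

text \<open>The inclusion of \<open>S_ball_subset\<close> is used for all
  \<open>\<delta> > 1\<close>, and \<open>\<delta>\<close> tends to 1.\<close>

lemma op_norm_S_le: "p_compact_op_norm p Z type_space S \<le> strong_norm p type_space y"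
proof -
  have "p_compact_op_norm p Z type_space S \<le> \<delta> * strong_norm p type_space y" if \<delta>: "1 < \<delta>" for \<delta>
  proof -
    have ys: "y \<in> strong_seqs p type_space" using y by (simp add: strong_seqs_type_space)
    have "p_compact_op_norm p Z type_space S \<le> strong_norm p type_space (\<lambda>n. scaleC (complex_of_real \<delta>) (y n))"
      unfolding p_compact_op_norm_def p_compact_measure_def
    proof (rule cInf_lower, intro CollectI exI conjI refl)
      show "(\<lambda>n. scaleC (complex_of_real \<delta>) (y n)) \<in> strong_seqs p type_space"
        by (rule strong_seqs_scale(1)[OF ys]) (use \<delta> p in auto)
    qed (auto intro!: bdd_belowI[of _ 0] S_ball_subset \<delta> simp: strong_norm_nonneg)
    also have "\<dots> = \<delta> * strong_norm p type_space y" by (rule strong_seqs_scale(2)[OF ys]) (use \<delta> p in auto)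
    finally show ?thesis .
  qed
  then have "\<forall>\<^sub>F \<delta> in at_right 1. p_compact_op_norm p Z type_space S \<le> \<delta> * strong_norm p type_space y"
    by (auto simp: eventually_at_right_field intro: exI[of _ 2])
  moreover have "((\<lambda>\<delta>. \<delta> * strong_norm p type_space y) \<longlongrightarrow> 1 * strong_norm p type_space y) (at_right 1)"
    by (intro tendsto_intros)
  ultimately show ?thesis using tendsto_lowerbound[of "\<lambda>\<delta>. \<delta> * strong_norm p type_space y"] by simp
qed

end

lemma p_compact_op_norm_nonneg:
  assumes "S \<in> p_compact_ops p Z X" shows "0 \<le> p_compact_op_norm p Z X S"
  using assms unfolding p_compact_op_norm_def p_compact_measure_def p_compact_ops_def rel_p_compact_def
  by (intro cInf_greatest) (auto simp: strong_norm_nonneg)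

lemma uncond_norm_nonneg:
  assumes "normed_cmodule Z" "g \<in> weighted_holo_Kup p U v Z" shows "0 \<le> weighted_holo_Kup_norm p U v Z g"
  using assms unfolding weighted_holo_Kup_norm_def uncond_p_compact_measure_def weighted_holo_Kup_def rel_uncond_p_compact_def
  by (intro cInf_greatest) (auto simp: uncond_seqs_def intro!: normed_cmodule.weak_norm_nonneg)

text \<open>The gap between \<open>strong_norm p type_space x\<close> and \<open>r\<close> pays for
  weights that grow to infinity: their p-th roots enlarge \<open>x\<close> to \<open>y\<close>, and
  the reciprocals of these roots are the damping factors.\<close>

lemma Kp_imp_factorization:
  fixes U :: "'e::complex_banach set" and f :: "'e \<Rightarrow> 'f::complex_banach"
  assumes U: "open U" and v: "weight_on U v" and p: "1 \<le> p" and f: "f \<in> weighted_holo U v type_space"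
    and x: "x \<in> strong_seqs p type_space" "weighted_range U v type_space f \<subseteq> p_conv p type_space x"
    and r: "strong_norm p type_space x < r"
  obtains Z S g where "Kp_factorization p U v type_space f Z S g"
    "p_compact_op_norm p Z type_space S * weighted_holo_Kup_norm p U v Z g \<le> r"
proof -
  define s where "s n = norm (x n) powr p" for n
  have s: "summable s" "\<And>n. 0 \<le> s n" using x(1) by (simp_all add: s_def[abs_def] strong_seqs_type_space)
  have r0: "0 < r" using r strong_norm_nonneg[of p type_space x] by simp
  have sx: "suminf s < r powr p"
  proof -
    have "(suminf s powr (1/p)) powr p < r powr p"
      using r p by (intro powr_less_mono2) (auto simp: strong_norm_def s_def[abs_def])
    then show ?thesis using p suminf_nonneg[OF s] by (simp add: powr_powr)
  qed
  \<comment> \<open>With this slack the weighted sum is at most \<open>r powr p\<close>, which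
    becomes the bound \<open>r\<close> for the strong norm of \<open>y\<close>.\<close>
  obtain w where w: "\<And>n. 1 \<le> w n" "incseq w" "filterlim w at_top sequentially"
    "summable (\<lambda>n. s n * w n)" "(\<Sum>n. s n * w n) \<le> suminf s + (r powr p - suminf s)"
    using summable_weights[OF s, of "r powr p - suminf s"] sx by auto
  define l where "l n = w n powr (- 1/p)" for n
  define y where "y n = scaleC (complex_of_real (w n powr (1/p))) (x n)" for n
  have w0: "0 < w n" for n using w(1)[of n] by simp
  have ny: "norm (y n) powr p = s n * w n" for n
    using p w0[of n] by (simp add: y_def norm_scaleC powr_mult powr_powr s_def mult.commute)
  interpret weighted_sequence p y l
  proof
    show "1 \<le> p" by (rule p)
    show "summable (\<lambda>n. norm (y n) powr p)" using w(4) by (simp add: ny)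
    show "0 \<le> l n" for n by (simp add: l_def)
    show "l n \<le> 1" for n using p w(1)[of n] powr_mono2'[of "- 1/p" 1 "w n"] by (simp add: l_def)
    show "decseq l" 
      unfolding l_def using p w0 w(2) by (intro decseq_SucI powr_mono2') (auto simp: incseqD)
    show "l \<longlonglongrightarrow> 0" unfolding l_def by (rule tendsto_neg_powr[OF _ w(3)]) (use p in simp)
  qed
  have Tx: "T (damp a) = (\<Sum>n. scaleC (a n) (x n))" for a
  proof -
    have "scaleC (damp a n) (y n) = scaleC (a n) (x n)" for n
      using w0[of n] by (simp add: damp_def y_def l_def scaleC_scaleC powr_minus_divide flip: of_real_mult)
    then show ?thesis by (simp add: T_def)
  qed
  have "weighted_range U v type_space f \<subseteq> (\<lambda>a. T (damp a)) ` unit_ball (coeff_space p)"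
    using x(2) by (force simp: p_conv_type_space Tx sums_iff)
  from Kp_factorization_exists[OF U v f this] obtain g where 
    g: "Kp_factorization p U v type_space f Z S g" "weighted_holo_Kup_norm p U v Z g \<le> 1" by blast
  have "S \<in> p_compact_ops p Z type_space" using g(1) by (simp add: Kp_factorization_def)
  from p_compact_op_norm_nonneg[OF this] 
  have "p_compact_op_norm p Z type_space S * weighted_holo_Kup_norm p U v Z g \<le> p_compact_op_norm p Z type_space S * 1"
    by (intro mult_left_mono g)
  also have "\<dots> \<le> strong_norm p type_space y" using op_norm_S_le by simp
  also have "\<dots> \<le> (r powr p) powr (1/p)"
    unfolding strong_norm_def using p w s by (intro powr_mono2) (auto simp: ny intro!: suminf_nonneg simp: less_imp_le[OF w0])
  also have "\<dots> = r" using p r0 by (simp add: powr_powr)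
  finally show ?thesis using that g(1) by blast
qed

theorem corollary2p13:
  fixes U :: "'e::complex_banach set" and v :: "'e \<Rightarrow> real"
    and f :: "'e \<Rightarrow> 'f::complex_banach" and p :: real
  assumes "open U" and "weight_on U v" and "1 \<le> p"
    and "f \<in> weighted_holo U v type_space"
  shows "(f \<in> weighted_holo_Kp p U v type_space \<longleftrightarrow>
            (\<exists>Z S g. Kp_factorization p U v type_space f Z S g)) \<and>
         (f \<in> weighted_holo_Kp p U v type_space \<longrightarrow>
            weighted_holo_Kp_norm p U v type_space f =
              Inf {p_compact_op_norm p Z type_space S * weighted_holo_Kup_norm p U v Z g
                   | Z S g. Kp_factorization p U v type_space f Z S g})"
proof -
  let ?m = "weighted_holo_Kp_norm p U v type_space f"
  let ?P = "{p_compact_op_norm p Z type_space S * weighted_holo_Kup_norm p U v Z g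
                   | Z S g. Kp_factorization p U v type_space f Z S g}"
  let ?X = "{x \<in> strong_seqs p type_space. weighted_range U v type_space f \<subseteq> p_conv p type_space x}"
  have Kp_iff: "f \<in> weighted_holo_Kp p U v type_space \<longleftrightarrow> ?X \<noteq> {}"
    using assms(4) by (auto simp: weighted_holo_Kp_def rel_p_compact_def)
  have m: "?m = Inf (strong_norm p type_space ` ?X)"
    unfolding weighted_holo_Kp_norm_def p_compact_measure_def by (rule arg_cong[of _ _ Inf]) auto
  \<comment> \<open>The weights always cost a little, so only values strictly above the strong norm
    of a competitor are reached.\<close>
  have fac: "\<exists>a\<in>?P. a \<le> r" if "x \<in> ?X" "strong_norm p type_space x < r" for x r
  proof (rule Kp_imp_factorization[OF assms])
    show "x \<in> strong_seqs p type_space" "weighted_range U v type_space f \<subseteq> p_conv p type_space x"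
      "strong_norm p type_space x < r"
      using that by auto
  qed blast
  have iff: "f \<in> weighted_holo_Kp p U v type_space \<longleftrightarrow> (\<exists>Z S g. Kp_factorization p U v type_space f Z S g)"
  proof
    assume "f \<in> weighted_holo_Kp p U v type_space"
    then obtain x where "x \<in> ?X" using Kp_iff by blast
    from fac[OF this, of "strong_norm p type_space x + 1"] 
    show "\<exists>Z S g. Kp_factorization p U v type_space f Z S g" by auto
  qed (use factorization_imp_Kp(1)[OF assms(3,4)] in blast)
  moreover have "?m = Inf ?P" if K: "f \<in> weighted_holo_Kp p U v type_space"
  proof (rule antisym)
    show "?m \<le> Inf ?P"
      using iff K factorization_imp_Kp(2)[OF assms(3,4)] by (intro cInf_greatest) auto
    \<comment> \<open>An infimum of reals lies below the members only when the set is bounded below;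
      here all products are nonnegative.\<close>
    have bdd: "bdd_below ?P"
    proof (rule bdd_belowI[of _ 0], clarify)
      fix Z S g assume F: "Kp_factorization p U v type_space f Z S g"
      then show "0 \<le> p_compact_op_norm p Z type_space S * weighted_holo_Kup_norm p U v Z g"
        using normed_cmodule_quotient[OF assms(3)]
        by (intro mult_nonneg_nonneg p_compact_op_norm_nonneg uncond_norm_nonneg) (auto simp: Kp_factorization_def)
    qed
    have "Inf ?P \<le> strong_norm p type_space x" if "x \<in> ?X" for x
    proof (rule dense_ge)
      fix r assume "strong_norm p type_space x < r"
      from fac[OF \<open>x \<in> ?X\<close> this] obtain a where "a \<in> ?P" "a \<le> r" by blast
      then show "Inf ?P \<le> r" using cInf_lower[OF _ bdd] by (meson order_trans)
    qed
    then show "Inf ?P \<le> ?m"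
      unfolding m using K Kp_iff by (intro cInf_greatest) auto
  qed
  ultimately show ?thesis by blast
qed

end
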